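(* Let $1\le p<m$ and let $X=Gr(p,m)$ with its $T=(\mathbb{C}^* )^m$-action, let $\Lambda=\mathbb{Z}[T_1,\dots,T_m]$ and let $QH^*_T(X)$ be the $T$-equivariant quantum cohomology of $X$ with equivariant quantum Schubert classes $\sigma_\lambda$ (notation as in the context). Then: (a) There is a canonical isomorphism of $\Lambda[q]$-algebras \[\Lambda[q][h_1,\dots,h_{m-p}]/\langle E_{p+1},\dots,E_{m-1},\,E_m+(-1)^{m-p}q\rangle\longrightarrow QH^*_T(X)\] sending $h_i$ to $\sigma_{(i)}$ for $1\le i\le m-p$; more generally, for every partition $\lambda$ contained in the $p\times(m-p)$ rectangle, the image of $s_\lambda$ is the Schubert class $\sigma_\lambda$. (b) (Dual version) There is a canonical isomorphism of $\Lambda[q]$-algebras \[\Lambda[q][e_1,\dots,e_p]/\langle H_{m-p+1},\dots,H_{m-1},\,H_m+(-1)^{p}q\rangle\longrightarrow QH^*_T(X)\] sending $e_j$ to $\sigma_{(1)^j}$ for $1\le j\le p$, and $\widetilde{s}_\lambda$ to $\sigma_\lambda$ for every partition $\lambda$ contained in the $p\times(m-p)$ rectangle.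
   Context: Setting: $X=Gr(p,m)$ is the Grassmannian of $p$-dimensional subspaces of $\mathbb{C}^m$, with the action of $T=(\mathbb{C}^* )^m$ induced from $GL(m)$. $\Lambda=H^*_T(pt)=\mathbb{Z}[T_1,\dots,T_m]$, $\deg T_i=1$, where $-T_i$ is the $T$-equivariant first Chern class of the weight line $\mathbb{C}f_i$ ($f_i$ the $i$-th standard basis vector). $q$ is an indeterminate of degree $m$. Partitions $\lambda=(\lambda_1,\dots,\lambda_p)$ in the $p\times(m-p)$ rectangle are integer sequences $m-p\ge\lambda_1\ge\dots\ge\lambda_p\ge0$; $|\lambda|=\sum\lambda_i$; $\lambda'$ is the conjugate partition; $(i)=(i,0,\dots,0)$ and $(1)^i=(1,\dots,1,0,\dots,0)$ with $i$ ones. With $F_k=\langle f_1,\dots,f_k\rangle$ the standard flag, the Schubert variety is $\Omega_\lambda=\{V\in X:\dim(V\cap F_{m-p+i-\lambda_i})\ge i,\ 1\le i\le p\}$; it is $T$-invariant and defines the equivariant Schubert class $\sigma^T_\lambda\in H^{2|\lambda|}_T(X)$. $QH^*_T(X)$ is the $T$-equivariant (small) quantum cohomology ring of Givental–Kim: the graded commutative $\Lambda[q]$-algebra which is free over $\Lambda[q]$ with basis $\{\sigma_\lambda\}$ ($\lambda$ in the rectangle, $\deg\sigma_\lambda=|\lambda|$, $\sigma_\lambda$ corresponding to $\sigma^T_\lambda$), with product $\sigma_\lambda\circ\sigma_\mu=\sum_{d\ge0}\sum_\nu q^d c^{\nu,d}_{\lambda,\mu}\sigma_\nu$, where $c^{\nu,d}_{\lambda,\mu}$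 are the 3-point genus-0 $T$-equivariant Gromov–Witten invariants. (For orientation of conventions: it satisfies $\sigma_\lambda\circ\sigma_{(1)}=\sum_{\mu}\sigma_\mu+\big(\sum_{i=1}^pT_{m-p+i-\lambda_i}-\sum_{j=m-p+1}^mT_j\big)\sigma_\lambda+q\sigma_{\lambda^-}$, the sum over $\mu$ in the rectangle obtained from $\lambda$ by adding one box, where $\lambda^-$ is obtained by removing $m-1$ boxes from the border rim of $\lambda$ and the last term is omitted if that is impossible, i.e. unless $\lambda_1=m-p$ and $\lambda_p>0$.) Notation for the presentations: define $t=(t_i)_{i\in\mathbb{Z}}$ by $t_i=T_{m-i+1}$ for $1\le i\le m$ and $t_i=0$ otherwise. $h_1,\dots,h_{m-p}$ and $e_1,\dots,e_p$ are indeterminates, with conventions $h_0=e_0=1$, $h_j=0$ if $j<0$ or $j>m-p$, $e_i=0$ if $i<0$ or $i>p$. For integers $j$ and $s\ge0$ define $\tau^{-s}h_j\in\Lambda[h_1,\dots,h_{m-p}]$ by $\tau^0h_j=h_j$ and $\tau^{-s}h_j=\tau^{-s+1}h_j+(t_{j+p-s}-t_{1-s})\tau^{-s+1}h_{j-1}$ for $s\ge1$; and $\tau^se_i\in\Lambda[e_1,\dots,e_p]$ by $\tau^0e_i=e_i$ and $\tau^se_i=\tau^{s-1}e_i+(t_s-t_{p-i+s+1})\tau^{s-1}e_{i-1}$ for $s\ge1$. For $\lambda$ in the rectangle set $s_\lambda=\det(\tau^{1-j}h_{\lambda_i+j-i})_{1\le i,j\le p}$ and $\widetilde{s}_\lambda=\det(\tau^{j-1}e_{\lambda'_i+j-i})_{1\le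 i,j\le m-p}$. For $m-p<k\le m$ set $H_k=\det(\tau^{j-1}e_{1+j-i})_{1\le i,j\le k}$, and for $p<k\le m$ set $E_k=\det(\tau^{1-j}h_{1+j-i})_{1\le i,j\le k}$. *)

theory Defs
  imports
    "HOL-Library.Poly_Mapping"
    "HOL-Algebra.QuotRing"
    "Jordan_Normal_Form.Determinant"
begin

text \<open>All polynomial rings live in one type of integer polynomials; a particular ring is cut out
  by its set of variables. Thus $\Lambda \subseteq \Lambda[q] \subseteq \Lambda[q][h]$ are literal
  inclusions.\<close>

datatype indet = TVar nat | qVar | hVar nat | eVar nat

type_synonym mpoly = "(indet \<Rightarrow>\<^sub>0 nat) \<Rightarrow>\<^sub>0 int"

definition Var :: "indet \<Rightarrow> mpoly" where
  "Var x = Poly_Mapping.single (Poly_Mapping.single x 1) 1"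

definition polys_in :: "indet set \<Rightarrow> mpoly set" where
  "polys_in V = {f. \<forall>k \<in> Poly_Mapping.keys f. Poly_Mapping.keys k \<subseteq> V}"

definition poly_ring :: "indet set \<Rightarrow> mpoly ring" where
  "poly_ring V = \<lparr>carrier = polys_in V, monoid.mult = (*), one = 1, zero = 0, add = (+)\<rparr>"

definition homogeneous_poly :: "mpoly \<Rightarrow> int \<Rightarrow> bool" where
  "homogeneous_poly f d \<longleftrightarrow>
     (\<forall>k \<in> Poly_Mapping.keys f. int (\<Sum>x \<in> Poly_Mapping.keys k. Poly_Mapping.lookup k x) = d)"

definition T_vars :: "nat \<Rightarrow> indet set" where
  "T_vars m = TVar ` {1..m}"

definition Lambda :: "nat \<Rightarrow> mpoly set" where
  "Lambda m = polys_in (T_vars m)"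

definition Lambda_q :: "nat \<Rightarrow> mpoly set" where
  "Lambda_q m = polys_in (insert qVar (T_vars m))"

abbreviation TT :: "nat \<Rightarrow> mpoly" where "TT i \<equiv> Var (TVar i)"
abbreviation qq :: mpoly where "qq \<equiv> Var qVar"


text \<open>A partition with at most $p$ parts is the function $i \mapsto \lambda_i$ on
  $\{1,\dots,p\}$, extended by $0$.\<close>

type_synonym part = "nat \<Rightarrow> nat"

definition partitions_in :: "nat \<Rightarrow> nat \<Rightarrow> part set" where
  "partitions_in p m =
     {la. (\<forall>i \<in> {1..p}. la i \<le> m - p) \<and>
          (\<forall>i \<in> {1..p}. \<forall>j \<in> {1..p}. i \<le> j \<longrightarrow> la j \<le> la i) \<and>
          (\<forall>i. i \<notin> {1..p} \<longrightarrow> la i = 0)}"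

definition part_size :: "nat \<Rightarrow> part \<Rightarrow> nat" where
  "part_size p la = (\<Sum>i = 1..p. la i)"

definition conj_part :: "nat \<Rightarrow> part \<Rightarrow> part" where
  "conj_part p la j = card {i \<in> {1..p}. j \<le> la i}"

definition empty_part :: part where
  "empty_part = (\<lambda>_. 0)"

definition row_part :: "nat \<Rightarrow> part" where
  "row_part i = (\<lambda>k. if k = 1 then i else 0)"

definition col_part :: "nat \<Rightarrow> part" where
  "col_part i = (\<lambda>k. if 1 \<le> k \<and> k \<le> i then 1 else 0)"

definition add_box :: "nat \<Rightarrow> nat \<Rightarrow> part \<Rightarrow> part set" where
  "add_box p m la = {mu \<in> partitions_in p m. \<exists>i \<in> {1..p}. mu = la(i := la i + 1)}"

text \<open>The border rim of $\lambda$ consists of the boxes $(i,j)$ of $\lambda$ such that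
  $(i+1,j+1)$ is not a box of $\lambda$. It has at most $m-1$ boxes, with equality exactly when
  $\lambda_1 = m-p$ and $\lambda_p > 0$; removing all of it leaves
  $(\lambda_2-1,\dots,\lambda_p-1,0)$. Only used in that case.\<close>

definition rim_removed :: "nat \<Rightarrow> part \<Rightarrow> part" where
  "rim_removed p la = (\<lambda>i. if 1 \<le> i \<and> i < p then la (i + 1) - 1 else 0)"


text \<open>The free $\Lambda[q]$-module on the partitions in the rectangle, multiplied by means of
  structure constants \<open>c la mu nu d\<close> (standing for $c^{\nu,d}_{\lambda,\mu}$). An element is its
  coefficient function. For homogeneous \<open>c\<close> the sum over \<open>d\<close> below is finite, because
  $md \le |\lambda|+|\mu|$ whenever $c^{\nu,d}_{\lambda,\mu} \neq 0$.\<close>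

type_synonym struct_consts = "part \<Rightarrow> part \<Rightarrow> part \<Rightarrow> nat \<Rightarrow> mpoly"

definition schubert :: "part \<Rightarrow> part \<Rightarrow> mpoly" where
  "schubert la = (\<lambda>nu. if nu = la then 1 else 0)"

definition qh_smult :: "mpoly \<Rightarrow> (part \<Rightarrow> mpoly) \<Rightarrow> part \<Rightarrow> mpoly" where
  "qh_smult a x = (\<lambda>nu. a * x nu)"

definition qh_mult ::
  "nat \<Rightarrow> nat \<Rightarrow> struct_consts \<Rightarrow> (part \<Rightarrow> mpoly) \<Rightarrow> (part \<Rightarrow> mpoly) \<Rightarrow> part \<Rightarrow> mpoly" where
  "qh_mult p m c x y = (\<lambda>nu. if nu \<in> partitions_in p m
     then \<Sum>la \<in> partitions_in p m. \<Sum>mu \<in> partitions_in p m.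
            x la * y mu * (\<Sum>d | c la mu nu d \<noteq> 0. qq ^ d * c la mu nu d)
     else 0)"

definition QH :: "nat \<Rightarrow> nat \<Rightarrow> struct_consts \<Rightarrow> (part \<Rightarrow> mpoly) ring" where
  "QH p m c = \<lparr>
     carrier = {x. (\<forall>la \<in> partitions_in p m. x la \<in> Lambda_q m) \<and>
                   (\<forall>la. la \<notin> partitions_in p m \<longrightarrow> x la = 0)},
     monoid.mult = qh_mult p m c,
     one = schubert empty_part,
     zero = (\<lambda>_. 0),
     add = (\<lambda>x y nu. x nu + y nu)\<rparr>"

text \<open>The properties of the 3-point genus-0 $T$-equivariant Gromov--Witten invariants of
  $Gr(p,m)$ through which they enter: $c^{\nu,d}_{\lambda,\mu} \in \Lambda$ is homogeneous of
  degree $|\lambda|+|\mu|-|\nu|-md$, the product they define is commutative, associative and has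
  the fundamental class $\sigma_\emptyset$ as unit, and multiplication by the divisor class is
  given by the equivariant quantum Chevalley rule. These properties determine the constants: over
  $\mathrm{Frac}(\Lambda[q])$ the algebra is generated by $\sigma_{(1)}$.\<close>

locale equivariant_quantum_cohomology =
  fixes p m :: nat and c :: struct_consts
  assumes consts_in_Lambda:
    "\<lbrakk>la \<in> partitions_in p m; mu \<in> partitions_in p m; nu \<in> partitions_in p m\<rbrakk>
      \<Longrightarrow> c la mu nu d \<in> Lambda m"
  and consts_homogeneous:
    "\<lbrakk>la \<in> partitions_in p m; mu \<in> partitions_in p m; nu \<in> partitions_in p m\<rbrakk>
      \<Longrightarrow> homogeneous_poly (c la mu nu d)
            (int (part_size p la) + int (part_size p mu) - int (part_size p nu) - int m * int d)"
  and QH_cring: "cring (QH p m c)"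
  and chevalley:
    "\<lbrakk>la \<in> partitions_in p m; nu \<in> partitions_in p m\<rbrakk>
      \<Longrightarrow> (schubert la \<otimes>\<^bsub>QH p m c\<^esub> schubert (row_part 1)) nu =
            (\<Sum>mu \<in> add_box p m la. schubert mu nu)
          + ((\<Sum>i = 1..p. TT (m - p + i - la i)) - (\<Sum>j = m - p + 1..m. TT j)) * schubert la nu
          + (if la 1 = m - p \<and> 0 < la p then qq * schubert (rim_removed p la) nu else 0)"


definition tt :: "nat \<Rightarrow> int \<Rightarrow> mpoly" where
  "tt m i = (if 1 \<le> i \<and> i \<le> int m then TT (nat (int m - i + 1)) else 0)"

definition hh :: "nat \<Rightarrow> nat \<Rightarrow> int \<Rightarrow> mpoly" where
  "hh p m j = (if j = 0 then 1
               else if 1 \<le> j \<and> j \<le> int m - int p then Var (hVar (nat j)) else 0)"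

definition ee :: "nat \<Rightarrow> int \<Rightarrow> mpoly" where
  "ee p i = (if i = 0 then 1 else if 1 \<le> i \<and> i \<le> int p then Var (eVar (nat i)) else 0)"

text \<open>\<open>tau_h p m s j\<close> is $\tau^{-s} h_j$, and \<open>tau_e p m s i\<close> is $\tau^{s} e_i$.\<close>

primrec tau_h :: "nat \<Rightarrow> nat \<Rightarrow> nat \<Rightarrow> int \<Rightarrow> mpoly" where
  "tau_h p m 0 j = hh p m j"
| "tau_h p m (Suc s) j = tau_h p m s j
     + (tt m (j + int p - int (Suc s)) - tt m (1 - int (Suc s))) * tau_h p m s (j - 1)"

primrec tau_e :: "nat \<Rightarrow> nat \<Rightarrow> nat \<Rightarrow> int \<Rightarrow> mpoly" where
  "tau_e p m 0 i = ee p i"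
| "tau_e p m (Suc s) i = tau_e p m s i
     + (tt m (int (Suc s)) - tt m (int p - i + int (Suc s) + 1)) * tau_e p m s (i - 1)"

text \<open>Matrix indices start at $0$: the entry at \<open>(i, j)\<close> below is the one written with
  $(i+1, j+1)$ in the usual indexing.\<close>

definition s_poly :: "nat \<Rightarrow> nat \<Rightarrow> part \<Rightarrow> mpoly" where
  "s_poly p m la =
     det (mat p p (\<lambda>(i, j). tau_h p m j (int (la (i + 1)) + int j - int i)))"

definition s_dual_poly :: "nat \<Rightarrow> nat \<Rightarrow> part \<Rightarrow> mpoly" where
  "s_dual_poly p m la =
     det (mat (m - p) (m - p) (\<lambda>(i, j). tau_e p m j (int (conj_part p la (i + 1)) + int j - int i)))"

definition E_poly :: "nat \<Rightarrow> nat \<Rightarrow> nat \<Rightarrow> mpoly" where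
  "E_poly p m k = det (mat k k (\<lambda>(i, j). tau_h p m j (1 + int j - int i)))"

definition H_poly :: "nat \<Rightarrow> nat \<Rightarrow> nat \<Rightarrow> mpoly" where
  "H_poly p m k = det (mat k k (\<lambda>(i, j). tau_e p m j (1 + int j - int i)))"


definition h_ring :: "nat \<Rightarrow> nat \<Rightarrow> mpoly ring" where
  "h_ring p m = poly_ring (insert qVar (T_vars m) \<union> hVar ` {1..m - p})"

definition h_ideal :: "nat \<Rightarrow> nat \<Rightarrow> mpoly set" where
  "h_ideal p m = Idl\<^bsub>h_ring p m\<^esub>
     (E_poly p m ` {p + 1..m - 1} \<union> {E_poly p m m + (-1) ^ (m - p) * qq})"

definition e_ring :: "nat \<Rightarrow> nat \<Rightarrow> mpoly ring" where
  "e_ring p m = poly_ring (insert qVar (T_vars m) \<union> eVar ` {1..p})"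

definition e_ideal :: "nat \<Rightarrow> nat \<Rightarrow> mpoly set" where
  "e_ideal p m = Idl\<^bsub>e_ring p m\<^esub>
     (H_poly p m ` {m - p + 1..m - 1} \<union> {H_poly p m m + (-1) ^ p * qq})"

abbreviation h_class :: "nat \<Rightarrow> nat \<Rightarrow> mpoly \<Rightarrow> mpoly set" where
  "h_class p m f \<equiv> h_ideal p m +>\<^bsub>h_ring p m\<^esub> f"

abbreviation e_class :: "nat \<Rightarrow> nat \<Rightarrow> mpoly \<Rightarrow> mpoly set" where
  "e_class p m f \<equiv> e_ideal p m +>\<^bsub>e_ring p m\<^esub> f"

end

theory Submission
  imports Defs "HOL-Algebra.Algebraic_Closure_Type"
begin

text \<open>
  Put $(x|t)^a = (x-t_1)\cdots(x-t_a)$. The recursion for $\tau^{-s}h_j$ says that there is a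
  linear functional $L$ with $L((x|t)^a) = h_{a+1-p}$ and $L((x|t)^a x^s) = \tau^{-s}h_{a+s+1-p}$,
  so $s_\lambda$ is the determinant of $L((x|t)^{a_i}x^j)$ with $a_i = \lambda_i+p-i$, and it is
  indexed by a $p$-subset of $\{0,\dots,m-1\}$. The relations $E_k$ say exactly that
  $P(x) = (x|t)^m + (-1)^p q$ has a monic factor $\chi$ of degree $p$, and that, up to the degrees
  that matter, $L$ is the residue functional $f \mapsto \mathrm{Res}\, f/\chi$. Hence
  multiplication by $x$ acts on the rows of these determinants as the companion matrix of $\chi$.
  Comparing coefficients in the resulting characteristic polynomial identity shows that the
  $s_\lambda$ span the quotient and satisfy the quantum Chevalley rule. They are linearly
  independent because at a generic point $P$ has $m$ distinct roots, and every $p$-subset of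
  roots is a point of the quotient at which $s_\lambda$ is a ratio of Vandermonde-like
  determinants. Finally, an operator on the free module that commutes with the Chevalley operator
  and kills $\sigma_\emptyset$ vanishes: coefficientwise in $q$ this reduces to the classical
  operator, which has the distinct eigenvalues $\sum_i t_{a_i+1}$. This forces the two products to
  agree. The dual version is the same statement with $p$-subsets replaced by their reversed
  complements and $t_i$ by $-t_{m+1-i}$.\<close>

text \<open>The Chevalley rule alone does not describe the ring: over \<Lambda>[q] the divisor class
  need not generate it, only over the fraction field. This shapes both halves of the argument. For
  spanning, every coefficient of \<chi> is read off from the characteristic polynomial identity, not
  just the subleading one; together they recover all E_i and from these all generators. For
  multiplicativity, no product is computed: multiplication by a fixed element is formed in the
  quotient and in the quantum ring, and the difference of the two operators commutes with the
  divisor class. Fractions are avoided in this last argument by using explicit eigenvectors with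
  polynomial entries. The signs have one source. The relation for E_m turns the summand dropped from
  L(\<chi> x^(m-1)) into (-1)^p q, so (x|t)^m acts as (-1)^(p-1) q. A row that wraps around must
  pass the p - 1 other rows, which costs the same sign again; hence q enters the Chevalley rule with
  coefficient +1.\<close>

instantiation indet :: linorder
begin

text \<open>Residues modulo 4 keep the four kinds of variables apart. The order itself is arbitrary:
  ordered variables give ordered monomials, and these make \<open>mpoly\<close> an integral domain,
  as required for cancellation and for the fraction field.\<close>

primrec indet_code :: "indet \<Rightarrow> nat" where
  "indet_code (TVar i) = 4 * i"
| "indet_code qVar = 1"
| "indet_code (hVar i) = 4 * i + 2"
| "indet_code (eVar i) = 4 * i + 3"

definition less_eq_indet :: "indet \<Rightarrow> indet \<Rightarrow> bool" where
  "x \<le> y \<longleftrightarrow> indet_code x \<le> indet_code y"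

definition less_indet :: "indet \<Rightarrow> indet \<Rightarrow> bool" where
  "x < y \<longleftrightarrow> indet_code x < indet_code y"

instance
proof
  have inj: "x = y" if "indet_code x = indet_code y" for x y
    using that by (cases x; cases y; simp; presburger)
  fix x y z :: indet
  show "(x < y) = (x \<le> y \<and> \<not> y \<le> x)"
    by (auto simp: less_eq_indet_def less_indet_def)
  show "x \<le> x" by (simp add: less_eq_indet_def)
  show "x \<le> y \<Longrightarrow> y \<le> z \<Longrightarrow> x \<le> z" by (simp add: less_eq_indet_def)
  show "x \<le> y \<Longrightarrow> y \<le> x \<Longrightarrow> x = y" by (simp add: less_eq_indet_def inj)
  show "x \<le> y \<or> y \<le> x" by (auto simp: less_eq_indet_def)
qed

end

section \<open>Evaluation of integer polynomials, and the subrings cut out by sets of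
  variables\<close>

definition eval_monom :: "(indet \<Rightarrow> 'a::comm_ring_1) \<Rightarrow> (indet \<Rightarrow>\<^sub>0 nat) \<Rightarrow> 'a" where
  "eval_monom v k = (\<Prod>x\<in>Poly_Mapping.keys k. v x ^ Poly_Mapping.lookup k x)"

definition eval_mpoly :: "(indet \<Rightarrow> 'a::comm_ring_1) \<Rightarrow> mpoly \<Rightarrow> 'a" where
  "eval_mpoly v f = (\<Sum>k\<in>Poly_Mapping.keys f. of_int (Poly_Mapping.lookup f k) * eval_monom v k)"

lemma eval_monom_superset:
  assumes "finite A" "Poly_Mapping.keys k \<subseteq> A"
  shows "eval_monom v k = (\<Prod>x\<in>A. v x ^ Poly_Mapping.lookup k x)"
  unfolding eval_monom_def using assms
  by (intro prod.mono_neutral_left) (auto simp: in_keys_iff)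

lemma eval_monom_add: "eval_monom v (k + l) = eval_monom v k * eval_monom v l"
proof -
  let ?A = "Poly_Mapping.keys k \<union> Poly_Mapping.keys l"
  have "Poly_Mapping.keys (k + l) \<subseteq> ?A" by (rule Poly_Mapping.keys_add)
  then show ?thesis
    by (simp add: eval_monom_superset[of ?A] lookup_add power_add prod.distrib)
qed

lemma eval_mpoly_superset:
  assumes "finite A" "Poly_Mapping.keys f \<subseteq> A"
  shows "eval_mpoly v f = (\<Sum>k\<in>A. of_int (Poly_Mapping.lookup f k) * eval_monom v k)"
  unfolding eval_mpoly_def using assms
  by (intro sum.mono_neutral_left) (auto simp: in_keys_iff)

lemma eval_mpoly_add: "eval_mpoly v (f + g) = eval_mpoly v f + eval_mpoly v g"
proof -
  let ?A = "Poly_Mapping.keys f \<union> Poly_Mapping.keys g"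
  have "Poly_Mapping.keys (f + g) \<subseteq> ?A" by (rule Poly_Mapping.keys_add)
  then show ?thesis
    by (simp add: eval_mpoly_superset[of ?A] lookup_add distrib_right sum.distrib)
qed

lemma eval_mpoly_0 [simp]: "eval_mpoly v 0 = 0"
  by (simp add: eval_mpoly_def)

lemma eval_mpoly_sum: "eval_mpoly v (sum f A) = (\<Sum>x\<in>A. eval_mpoly v (f x))"
  by (induction A rule: infinite_finite_induct) (auto simp: eval_mpoly_add)

lemma eval_mpoly_single: "eval_mpoly v (Poly_Mapping.single k a) = of_int a * eval_monom v k"
  by (cases "a = 0") (auto simp: eval_mpoly_def)

lemma mpoly_sum_monomials:
  fixes f :: mpoly
  shows "f = (\<Sum>k\<in>Poly_Mapping.keys f. Poly_Mapping.single k (Poly_Mapping.lookup f k))"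
proof (rule poly_mapping_eqI)
  fix l
  show "Poly_Mapping.lookup f l
    = Poly_Mapping.lookup (\<Sum>k\<in>Poly_Mapping.keys f. Poly_Mapping.single k (Poly_Mapping.lookup f k)) l"
    by (simp add: lookup_sum lookup_single when_def in_keys_iff)
qed

lemma eval_mpoly_mult: "eval_mpoly v (f * g) = eval_mpoly v f * eval_mpoly v g"
proof -
  let ?s = "\<lambda>f k. Poly_Mapping.single k (Poly_Mapping.lookup f k) :: mpoly"
  have "f * g = (\<Sum>k\<in>Poly_Mapping.keys f. \<Sum>l\<in>Poly_Mapping.keys g. ?s f k * ?s g l)"
    by (subst mpoly_sum_monomials[of f], subst mpoly_sum_monomials[of g]) (simp add: sum_product)
  also have "eval_mpoly v \<dots> = eval_mpoly v f * eval_mpoly v g"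
    unfolding eval_mpoly_sum mult_single eval_mpoly_single
    by (simp add: eval_mpoly_def sum_product eval_monom_add algebra_simps)
  finally show ?thesis .
qed

lemma eval_mpoly_1 [simp]: "eval_mpoly v 1 = 1"
proof -
  have "eval_mpoly v (Poly_Mapping.single 0 1) = 1"
    unfolding eval_mpoly_single by (simp add: eval_monom_def)
  then show ?thesis by simp
qed

lemma eval_mpoly_Var [simp]: "eval_mpoly v (Var x) = v x"
  unfolding Var_def eval_mpoly_single by (simp add: eval_monom_def)

interpretation eval_mpoly: comm_ring_hom "eval_mpoly v" for v
  by unfold_locales (auto simp: eval_mpoly_add eval_mpoly_mult)

lemma eval_mpoly_diff [simp]: "eval_mpoly v (f - g) = eval_mpoly v f - eval_mpoly v g"
  by (rule eval_mpoly.hom_minus)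

lemma polys_in_0 [simp, intro]: "0 \<in> polys_in V"
  by (simp add: polys_in_def)

lemma polys_in_single: "Poly_Mapping.keys k \<subseteq> V \<Longrightarrow> Poly_Mapping.single k a \<in> polys_in V"
  by (simp add: polys_in_def)

lemma polys_in_1 [simp, intro]: "1 \<in> polys_in V"
  using polys_in_single[of 0 V 1] by simp

lemma polys_in_Var [intro]: "x \<in> V \<Longrightarrow> Var x \<in> polys_in V"
  unfolding Var_def by (rule polys_in_single) simp

lemma polys_in_add [intro]: "f \<in> polys_in V \<Longrightarrow> g \<in> polys_in V \<Longrightarrow> f + g \<in> polys_in V"
  using Poly_Mapping.keys_add[of f g] unfolding polys_in_def by blast

lemma polys_in_uminus [intro]: "f \<in> polys_in V \<Longrightarrow> - f \<in> polys_in V"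
  by (auto simp: polys_in_def)

lemma polys_in_diff [intro]: "f \<in> polys_in V \<Longrightarrow> g \<in> polys_in V \<Longrightarrow> f - g \<in> polys_in V"
  using polys_in_add[of f V "- g"] by auto

lemma polys_in_mult [intro]:
  assumes "f \<in> polys_in V" "g \<in> polys_in V" shows "f * g \<in> polys_in V"
  unfolding polys_in_def
proof (clarify)
  fix k x assume k: "k \<in> Poly_Mapping.keys (f * g)" and x: "x \<in> Poly_Mapping.keys k"
  from k obtain a b where "k = a + b" "a \<in> Poly_Mapping.keys f" "b \<in> Poly_Mapping.keys g"
    using Poly_Mapping.keys_mult[of f g] by blast
  then show "x \<in> V" using x assms Poly_Mapping.keys_add[of a b] unfolding polys_in_def by blast
qed

lemma polys_in_sum [intro]: "(\<And>x. x \<in> A \<Longrightarrow> f x \<in> polys_in V) \<Longrightarrow> sum f A \<in> polys_in V"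
  by (induction A rule: infinite_finite_induct) auto

lemma polys_in_power [intro]: "f \<in> polys_in V \<Longrightarrow> f ^ n \<in> polys_in V"
  by (induction n) auto

lemma polys_in_of_int [simp, intro]: "of_int n \<in> polys_in V"
  by (induction n rule: int_induct[of _ 0]) auto

lemma polys_in_mono: "V \<subseteq> W \<Longrightarrow> polys_in V \<subseteq> polys_in W"
  unfolding polys_in_def by blast

text \<open>Agreement of ring homomorphisms on a polynomial subring can thus be checked on
  constants, sums and products with one variable. A monomial is built up by induction on its total
  degree.\<close>

lemma polys_in_induct [consumes 1, case_names const add mult]:
  assumes f: "f \<in> polys_in V"
    and const: "\<And>n. P (of_int n)"
    and add: "\<And>f g. f \<in> polys_in V \<Longrightarrow> g \<in> polys_in V \<Longrightarrow> P f \<Longrightarrow> P g \<Longrightarrow> P (f + g)"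
    and mult: "\<And>x f. x \<in> V \<Longrightarrow> f \<in> polys_in V \<Longrightarrow> P f \<Longrightarrow> P (Var x * f)"
  shows "P f"
proof -
  have single: "P (Poly_Mapping.single k a)" if "Poly_Mapping.keys k \<subseteq> V" for k a
    using that
  proof (induction "\<Sum>x\<in>Poly_Mapping.keys k. Poly_Mapping.lookup k x" arbitrary: k)
    case 0
    have "k = 0" using 0 by (intro poly_mapping_eqI) (metis in_keys_iff lookup_zero finite_keys sum_eq_0_iff)
    then show ?case using const[of a] by (simp add: single_of_int[symmetric])
  next
    case (Suc n)
    from Suc(2) have "Poly_Mapping.keys k \<noteq> {}" by auto
    then obtain x where x: "x \<in> Poly_Mapping.keys k" by blast
    let ?l = "k - Poly_Mapping.single x (1::nat)"
    have k: "k = Poly_Mapping.single x 1 + ?l"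
      using x by (intro poly_mapping_eqI) (auto simp: lookup_add lookup_minus lookup_single when_def in_keys_iff)
    have sub: "Poly_Mapping.keys ?l \<subseteq> Poly_Mapping.keys k"
      by (auto simp: in_keys_iff lookup_minus)
    have "(\<Sum>y\<in>Poly_Mapping.keys k. Poly_Mapping.lookup k y)
        = (\<Sum>y\<in>Poly_Mapping.keys k. Poly_Mapping.lookup ?l y + (if y = x then 1 else 0))"
      by (rule sum.cong) (auto simp: lookup_minus lookup_single when_def in_keys_iff)
    also have "\<dots> = (\<Sum>y\<in>Poly_Mapping.keys ?l. Poly_Mapping.lookup ?l y) + 1"
      using x sub
      by (simp add: sum.distrib, intro sum.mono_neutral_right) (auto simp: in_keys_iff)
    finally have "n = (\<Sum>y\<in>Poly_Mapping.keys ?l. Poly_Mapping.lookup ?l y)" using Suc(2) by simp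
    then have P: "P (Poly_Mapping.single ?l a)" using Suc(1) Suc(3) sub by blast
    have "Poly_Mapping.single k a = Var x * Poly_Mapping.single ?l a"
      unfolding Var_def mult_single using k by simp
    then show ?case using P mult[of x "Poly_Mapping.single ?l a"] polys_in_single[of ?l V a] x sub Suc(3)
      by auto
  qed
  have "P (\<Sum>k\<in>A. Poly_Mapping.single k (Poly_Mapping.lookup f k))
      \<and> (\<Sum>k\<in>A. Poly_Mapping.single k (Poly_Mapping.lookup f k)) \<in> polys_in V"
    if "finite A" "A \<subseteq> Poly_Mapping.keys f" for A
    using that
  proof (induction A rule: finite_induct)
    case empty
    show ?case using const[of 0] by simp
  next
    case (insert k A)
    then have "Poly_Mapping.keys k \<subseteq> V" using f by (auto simp: polys_in_def)
    then show ?case using insert single add polys_in_single by auto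
  qed
  then show ?thesis using mpoly_sum_monomials[of f] by (metis finite_keys order_refl)
qed

lemma eval_mpoly_cong:
  assumes "f \<in> polys_in V" "\<And>x. x \<in> V \<Longrightarrow> v x = w x"
  shows "eval_mpoly v f = eval_mpoly w f"
  using assms(1)
  by (induction rule: polys_in_induct)
    (auto simp: eval_mpoly.hom_of_int eval_mpoly_add eval_mpoly_mult assms(2))

lemma poly_ring_simps [simp]:
  "carrier (Defs.poly_ring V) = polys_in V" "x \<otimes>\<^bsub>Defs.poly_ring V\<^esub> y = x * y"
  "x \<oplus>\<^bsub>Defs.poly_ring V\<^esub> y = x + y" "\<one>\<^bsub>Defs.poly_ring V\<^esub> = 1" "\<zero>\<^bsub>Defs.poly_ring V\<^esub> = 0"
  by (simp_all add: Defs.poly_ring_def)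

lemma cring_poly_ring: "cring (Defs.poly_ring V)"
proof (rule cringI)
  show "abelian_group (Defs.poly_ring V)"
  proof (rule abelian_groupI)
    fix x assume "x \<in> carrier (Defs.poly_ring V)"
    then show "\<exists>y\<in>carrier (Defs.poly_ring V). y \<oplus>\<^bsub>Defs.poly_ring V\<^esub> x = \<zero>\<^bsub>Defs.poly_ring V\<^esub>"
      by (intro bexI[of _ "- x"]) auto
  qed (auto simp: algebra_simps)
  show "comm_monoid (Defs.poly_ring V)"
    by (rule comm_monoidI) (auto simp: algebra_simps)
qed (auto simp: algebra_simps)

hide_const (open) up_ring.coeff up_ring.monom Polynomials.degree

section \<open>Determinants: multilinearity, pencils, Hessenberg and companion matrices\<close>

lemma det_mat_def:
  "det (mat n n (\<lambda>(i, j). f i j) :: 'a::comm_ring_1 mat)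
    = (\<Sum>\<pi> | \<pi> permutes {0..<n}. signof \<pi> * (\<Prod>i = 0..<n. f i (\<pi> i)))"
proof -
  have "(\<Prod>i = 0..<n. mat n n (\<lambda>(i, j). f i j) $$ (i, \<pi> i)) = (\<Prod>i = 0..<n. f i (\<pi> i))"
    if "\<pi> permutes {0..<n}" for \<pi>
    using permutes_in_image[OF that] by (intro prod.cong) auto
  then show ?thesis by (subst det_def'[of _ n]) (auto intro!: sum.cong)
qed

lemma det_mat_cong:
  "(\<And>i j. i < n \<Longrightarrow> j < n \<Longrightarrow> f i j = g i j) \<Longrightarrow>
    det (mat n n (\<lambda>(i, j). f i j)) = det (mat n n (\<lambda>(i, j). g i j) :: 'a::comm_ring_1 mat)"
  by (intro arg_cong[where f = det] eq_matI) auto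

text \<open>All rows are expanded at once: a choice function \<open>g\<close> picks one summand in
  each row. This turns determinants of combined rows into combinations of determinants with
  prescribed row indices.\<close>

lemma det_rows_sum:
  fixes c :: "nat \<Rightarrow> 'b \<Rightarrow> 'a::comm_ring_1"
  assumes "finite B"
  shows "det (mat n n (\<lambda>(i, j). \<Sum>b\<in>B. c i b * u i b j))
    = (\<Sum>g\<in>PiE {0..<n} (\<lambda>_. B). (\<Prod>i = 0..<n. c i (g i)) * det (mat n n (\<lambda>(i, j). u i (g i) j)))"
proof -
  have "det (mat n n (\<lambda>(i, j). \<Sum>b\<in>B. c i b * u i b j))
      = (\<Sum>\<pi> | \<pi> permutes {0..<n}. signof \<pi> *
          (\<Sum>g\<in>PiE {0..<n} (\<lambda>_. B). \<Prod>i = 0..<n. c i (g i) * u i (g i) (\<pi> i)))"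
    unfolding det_mat_def using assms by (intro sum.cong refl arg_cong2[where f = "(*)"] prod_sum_PiE) auto
  also have "\<dots> = (\<Sum>g\<in>PiE {0..<n} (\<lambda>_. B). (\<Prod>i = 0..<n. c i (g i)) *
      (\<Sum>\<pi> | \<pi> permutes {0..<n}. signof \<pi> * (\<Prod>i = 0..<n. u i (g i) (\<pi> i))))"
    unfolding sum_distrib_left prod.distrib by (subst sum.swap) (simp add: mult.left_commute)
  finally show ?thesis unfolding det_mat_def .
qed

lemma det_row_lin:
  fixes M :: "nat \<Rightarrow> nat \<Rightarrow> 'a::comm_ring_1"
  assumes "r < n"
  shows "det (mat n n (\<lambda>(i, j). if i = r then \<alpha> * x j + \<beta> * y j else M i j))
    = \<alpha> * det (mat n n (\<lambda>(i, j). if i = r then x j else M i j))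
    + \<beta> * det (mat n n (\<lambda>(i, j). if i = r then y j else M i j))"
proof -
  have eq: "(\<Prod>i = 0..<n. if i = r then z (\<pi> i) else M i (\<pi> i))
      = z (\<pi> r) * (\<Prod>i \<in> {0..<n} - {r}. M i (\<pi> i))" for z :: "nat \<Rightarrow> 'a" and \<pi>
    using assms by (subst prod.remove[of _ r]) (auto intro!: prod.cong)
  show ?thesis
    unfolding det_mat_def eq eq[of "\<lambda>j. \<alpha> * x j + \<beta> * y j"]
    by (simp add: sum_distrib_left algebra_simps flip: sum.distrib)
qed

lemma det_const_poly:
  fixes f :: "nat \<Rightarrow> nat \<Rightarrow> 'a::comm_ring_1"
  shows "det (mat n n (\<lambda>(i, j). [:f i j:])) = [:det (mat n n (\<lambda>(i, j). f i j)):]"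
proof -
  interpret comm_ring_hom "\<lambda>x::'a. [:x:]"
    by unfold_locales (auto simp: one_pCons)
  show ?thesis
    by (subst hom_det[symmetric], rule arg_cong[where f = det], rule eq_matI) auto
qed

text \<open>The analogue of "minus the trace" for a pencil uX - w whose leading matrix
  \<open>u\<close> is not assumed invertible.\<close>

lemma coeff_det_pencil:
  fixes u w :: "nat \<Rightarrow> nat \<Rightarrow> 'a::comm_ring_1"
  assumes "n > 0"
  shows "coeff (det (mat n n (\<lambda>(i, j). [:- w i j, u i j:]))) (n - 1)
    = - (\<Sum>r<n. det (mat n n (\<lambda>(i, j). if i = r then w i j else u i j)))"
proof -
  \<comment> \<open>A Boolean marks each row: \<open>True\<close> takes the part -w,
    \<open>False\<close> the part uX. A choice with r marked rows lives in degree n - r only, so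
    exactly the choices with one marked row survive.\<close>
  let ?c = "\<lambda>(i::nat) b. if b then [:-1:] else [:0, 1 :: 'a:]"
  let ?u = "\<lambda>i b j. if b then w i j else u i j"
  let ?D = "\<lambda>g. det (mat n n (\<lambda>(i, j). ?u i (g i) j))"
  let ?P = "PiE {0..<n} (\<lambda>_. UNIV :: bool set)"
  let ?e = "\<lambda>r i. if i \<in> {0..<n} then i = r else undefined :: bool"
  have hom: "det (mat n n (\<lambda>(i, j). [:?u i (g i) j:])) = [:?D g:]" for g
    by (rule det_const_poly)
  have "det (mat n n (\<lambda>(i, j). [:- w i j, u i j:]))
      = det (mat n n (\<lambda>(i, j). \<Sum>b\<in>UNIV. ?c i b * [:?u i b j:]))"
    by (rule det_mat_cong) (simp add: UNIV_bool)
  also have "\<dots> = (\<Sum>g\<in>?P. (\<Prod>i = 0..<n. ?c i (g i)) * [:?D g:])"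
    by (subst det_rows_sum) (auto simp: hom)
  also have "coeff \<dots> (n - 1) = (\<Sum>g\<in>?P. coeff ((\<Prod>i = 0..<n. ?c i (g i)) * [:?D g:]) (n - 1))"
    by (simp add: coeff_sum)
  also have "\<dots> = (\<Sum>g\<in>?e ` {..<n}. coeff ((\<Prod>i = 0..<n. ?c i (g i)) * [:?D g:]) (n - 1))"
  proof (rule sum.mono_neutral_right)
    show "\<forall>g\<in>?P - ?e ` {..<n}. coeff ((\<Prod>i = 0..<n. ?c i (g i)) * [:?D g:]) (n - 1) = 0"
    proof
      fix g assume g: "g \<in> ?P - ?e ` {..<n}"
      let ?A = "{i \<in> {0..<n}. g i}"
      have "card ?A \<noteq> 1"
      proof
        assume "card ?A = 1"
        then obtain r where r: "?A = {r}" by (auto simp: card_1_singleton_iff)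
        then have "g = ?e r" using g by (intro ext) (auto simp: PiE_def extensional_def)
        then show False using g r by auto
      qed
      have "(\<Prod>i = 0..<n. ?c i (g i)) = (\<Prod>i\<in>?A. [:-1:]) * (\<Prod>i\<in>{0..<n} - ?A. [:0, 1:])"
        by (subst prod.subset_diff[of ?A]) (auto intro!: prod.cong arg_cong2[where f = "(*)"] simp: mult.commute)
      also have "\<dots> = [:-1:] ^ card ?A * [:0, 1:] ^ (n - card ?A)"
      proof -
        have "card ({0..<n} - ?A) = n - card ?A" by (subst card_Diff_subset) auto
        then show ?thesis unfolding prod_constant by simp
      qed
      also have "\<dots> = monom ((-1) ^ card ?A) (n - card ?A)"
        by (simp add: poly_const_pow monom_altdef)
      finally have eq: "(\<Prod>i = 0..<n. ?c i (g i)) = monom ((-1) ^ card ?A) (n - card ?A)" .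
      have "card ?A \<le> n" by (metis (lifting) card_mono card_atLeastLessThan diff_zero finite_atLeastLessThan mem_Collect_eq subsetI)
      then have "n - card ?A \<noteq> n - 1" using \<open>card ?A \<noteq> 1\<close> assms by auto
      then show "coeff ((\<Prod>i = 0..<n. ?c i (g i)) * [:?D g:]) (n - 1) = 0"
        unfolding eq by (simp add: coeff_monom)
    qed
  qed (auto intro!: finite_PiE)
  also have "\<dots> = (\<Sum>r<n. coeff ((\<Prod>i = 0..<n. ?c i (?e r i)) * [:?D (?e r):]) (n - 1))"
  proof (subst sum.reindex)
    show "inj_on ?e {..<n}"
    proof (rule inj_onI)
      fix r r' assume "r \<in> {..<n}" "?e r = ?e r'"
      then show "r = r'" using fun_cong[of "?e r" "?e r'" r] by simp
    qed
  qed simp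
  also have "\<dots> = (\<Sum>r<n. - det (mat n n (\<lambda>(i, j). if i = r then w i j else u i j)))"
  proof (rule sum.cong[OF refl])
    fix r assume r: "r \<in> {..<n}"
    have "(\<Prod>i = 0..<n. ?c i (?e r i)) = ?c r True * (\<Prod>i\<in>{0..<n} - {r}. [:0, 1:])"
      using r by (subst prod.remove[of _ r]) (auto intro!: prod.cong)
    also have "\<dots> = monom (-1) (n - 1)" using r by (simp add: monom_altdef)
    finally have eq: "(\<Prod>i = 0..<n. ?c i (?e r i)) = monom (-1) (n - 1)" .
    have "?D (?e r) = det (mat n n (\<lambda>(i, j). if i = r then w i j else u i j))"
      by (rule det_mat_cong) auto
    then show "coeff ((\<Prod>i = 0..<n. ?c i (?e r i)) * [:?D (?e r):]) (n - 1)
        = - det (mat n n (\<lambda>(i, j). if i = r then w i j else u i j))"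
      unfolding eq by simp
  qed
  finally show ?thesis by (simp add: sum_negf)
qed

text \<open>In the Leibniz expansion, scaling row \<open>r\<close> multiplies the term of
  \<open>\<pi>\<close> by \<open>z (\<pi> r)\<close>, and the sum of these factors over all rows
  does not depend on \<open>\<pi>\<close>.\<close>

lemma sum_det_scale_row:
  fixes A :: "nat \<Rightarrow> nat \<Rightarrow> 'a::comm_ring_1"
  shows "(\<Sum>r<n. det (mat n n (\<lambda>(i, j). if i = r then z j * A i j else A i j)))
    = (\<Sum>j<n. z j) * det (mat n n (\<lambda>(i, j). A i j))"
proof -
  have eq: "(\<Prod>i = 0..<n. if i = r then z (\<pi> i) * A i (\<pi> i) else A i (\<pi> i))
      = z (\<pi> r) * (\<Prod>i = 0..<n. A i (\<pi> i))" if "r < n" for r \<pi>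
    using that by (simp add: prod.remove[of "{0..<n}" r] mult.assoc)
  have "(\<Sum>r<n. det (mat n n (\<lambda>(i, j). if i = r then z j * A i j else A i j)))
      = (\<Sum>r<n. \<Sum>\<pi> | \<pi> permutes {0..<n}. signof \<pi> * (z (\<pi> r) * (\<Prod>i = 0..<n. A i (\<pi> i))))"
    unfolding det_mat_def by (intro sum.cong refl) (simp add: eq)
  also have "\<dots> = (\<Sum>\<pi> | \<pi> permutes {0..<n}. (\<Sum>r<n. z (\<pi> r)) * (signof \<pi> * (\<Prod>i = 0..<n. A i (\<pi> i))))"
    by (subst sum.swap) (simp add: sum_distrib_right sum_distrib_left mult.left_commute)
  also have "\<dots> = (\<Sum>\<pi> | \<pi> permutes {0..<n}. (\<Sum>j<n. z j) * (signof \<pi> * (\<Prod>i = 0..<n. A i (\<pi> i))))"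
  proof (intro sum.cong refl)
    fix \<pi> assume "\<pi> \<in> {\<pi>. \<pi> permutes {0..<n}}"
    then have "(\<Sum>r<n. z (\<pi> r)) = (\<Sum>j<n. z j)"
      using sum.permute[of \<pi> "{..<n}" z] by (simp add: lessThan_atLeast0 comp_def)
    then show "(\<Sum>r<n. z (\<pi> r)) * (signof \<pi> * (\<Prod>i = 0..<n. A i (\<pi> i)))
        = (\<Sum>j<n. z j) * (signof \<pi> * (\<Prod>i = 0..<n. A i (\<pi> i)))" by simp
  qed
  finally show ?thesis unfolding det_mat_def sum_distrib_left .
qed

lemma det_equal_rows:
  fixes f :: "nat \<Rightarrow> nat \<Rightarrow> 'a::comm_ring_1"
  assumes "r < n" "r' < n" "r \<noteq> r'" "\<And>j. j < n \<Longrightarrow> f r j = f r' j"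
  shows "det (mat n n (\<lambda>(i, j). f i j)) = 0"
  by (rule det_identical_rows[of _ n r r']) (use assms in auto)

lemma det_equal_cols:
  fixes f :: "nat \<Rightarrow> nat \<Rightarrow> 'a::comm_ring_1"
  assumes "r < n" "r' < n" "r \<noteq> r'" "\<And>i. i < n \<Longrightarrow> f i r = f i r'"
  shows "det (mat n n (\<lambda>(i, j). f i j)) = 0"
  by (rule det_identical_columns[of _ n r r']) (use assms in auto)

lemma det_mat_permute_rows:
  fixes f :: "nat \<Rightarrow> nat \<Rightarrow> 'a::comm_ring_1"
  assumes "\<pi> permutes {0..<n}"
  shows "det (mat n n (\<lambda>(i, j). f (\<pi> i) j)) = signof \<pi> * det (mat n n (\<lambda>(i, j). f i j))"
proof -
  have "mat n n (\<lambda>(i, j). mat n n (\<lambda>(i, j). f i j) $$ (\<pi> i, j)) = mat n n (\<lambda>(i, j). f (\<pi> i) j)"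
    using permutes_in_image[OF assms] by (intro eq_matI) auto
  then show ?thesis
    using det_permute_rows[of "mat n n (\<lambda>(i, j). f i j)" n \<pi>] assms by simp
qed

text \<open>Laplace expansion along the last row, which contains only the subdiagonal 1 and the
  border entry, gives a two-term recursion in \<open>n\<close>.\<close>

lemma det_bordered_hessenberg:
  fixes f :: "nat \<Rightarrow> nat \<Rightarrow> 'a::comm_ring_1"
  assumes f0: "\<And>i j. j + 1 < i \<Longrightarrow> f i j = 0" and f1: "\<And>j. f (Suc j) j = 1"
  shows "det (mat (Suc n) (Suc n) (\<lambda>(i, j). if j = n then c i else f i j))
    = (\<Sum>i\<le>n. (-1) ^ (n - i) * c i * det (mat i i (\<lambda>(i, j). f i j)))"
proof (induction n)
  case 0
  show ?case by (subst det_single) auto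
next
  case (Suc n)
  let ?A = "mat (Suc (Suc n)) (Suc (Suc n)) (\<lambda>(i, j). if j = Suc n then c i else f i j)"
  have "det ?A = (\<Sum>j<Suc (Suc n). ?A $$ (Suc n, j) * cofactor ?A (Suc n) j)"
    by (rule laplace_expansion_row) auto
  also have "\<dots> = (\<Sum>j\<in>{n, Suc n}. ?A $$ (Suc n, j) * cofactor ?A (Suc n) j)"
    by (rule sum.mono_neutral_right) (auto simp: f0)
  also have "\<dots> = cofactor ?A (Suc n) n + c (Suc n) * cofactor ?A (Suc n) (Suc n)"
    by (simp add: f1)
  also have "mat_delete ?A (Suc n) (Suc n) = mat (Suc n) (Suc n) (\<lambda>(i, j). f i j)"
    by (intro eq_matI) (auto simp: mat_delete_def)
  then have "cofactor ?A (Suc n) (Suc n) = det (mat (Suc n) (Suc n) (\<lambda>(i, j). f i j))"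
    by (simp add: cofactor_def)
  also have "mat_delete ?A (Suc n) n = mat (Suc n) (Suc n) (\<lambda>(i, j). if j = n then c i else f i j)"
    by (intro eq_matI) (auto simp: mat_delete_def)
  then have "cofactor ?A (Suc n) n
      = - det (mat (Suc n) (Suc n) (\<lambda>(i, j). if j = n then c i else f i j))"
    by (simp add: cofactor_def)
  finally show ?case
    unfolding Suc.IH by (simp add: Suc_diff_le sum_negf[symmetric] mult.assoc)
qed

text \<open>With the genuine last column as border, the expansion becomes an alternating recursion
  between the leading minors; the subdiagonal 1 supplies the summand
  \<open>i = Suc n\<close>.\<close>

lemma det_hessenberg:
  fixes f :: "nat \<Rightarrow> nat \<Rightarrow> 'a::comm_ring_1"
  assumes "\<And>i j. j + 1 < i \<Longrightarrow> f i j = 0" and "\<And>j. f (Suc j) j = 1"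
  shows "(\<Sum>i\<le>Suc n. (-1) ^ i * det (mat i i (\<lambda>(i, j). f i j)) * f i n) = 0"
proof -
  have sgn: "(-1) ^ i = (-1) ^ n * (-1 :: 'a) ^ (n - i)" if "i \<le> n" for i
    using that by (auto simp: le_iff_add power_add mult.assoc simp flip: power_mult_distrib)
  have "mat (Suc n) (Suc n) (\<lambda>(i, j). if j = n then f i n else f i j)
      = mat (Suc n) (Suc n) (\<lambda>(i, j). f i j)" by (intro eq_matI) auto
  with det_bordered_hessenberg[of f n "\<lambda>i. f i n", OF assms]
  have "det (mat (Suc n) (Suc n) (\<lambda>(i, j). f i j))
      = (\<Sum>i\<le>n. (-1) ^ (n - i) * f i n * det (mat i i (\<lambda>(i, j). f i j)))" by simp
  then have "(-1) ^ n * det (mat (Suc n) (Suc n) (\<lambda>(i, j). f i j))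
      = (\<Sum>i\<le>n. (-1) ^ i * det (mat i i (\<lambda>(i, j). f i j)) * f i n)"
    by (simp only: sum_distrib_left, intro sum.cong refl) (subst sgn, simp_all add: ac_simps)
  then show ?thesis by (simp add: assms(2))
qed

text \<open>Expansion along the first row: the corner minor is the same matrix of size n, and the
  minor of \<open>c 0\<close> is triangular with -1 on the diagonal, which cancels the cofactor
  sign.\<close>

lemma det_companion:
  fixes y :: "'a::comm_ring_1"
  shows "det (mat n n (\<lambda>(i, j). (if i = j then y else 0) - (if i = Suc j then 1 else 0)
      + (if Suc j = n then c i else 0))) = y ^ n + (\<Sum>i<n. c i * y ^ i)"
proof (induction n arbitrary: c)
  case 0
  show ?case by simp
next
  case (Suc n)
  let ?f = "\<lambda>n c (i, j). (if i = j then y else 0) - (if i = Suc j then 1 else 0)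
      + (if Suc j = n then c i else 0)"
  let ?A = "mat (Suc n) (Suc n) (?f (Suc n) c)"
  show ?case
  proof (cases "n = 0")
    case True
    then show ?thesis by (subst det_single) auto
  next
    case False
    have "det ?A = (\<Sum>j<Suc n. ?A $$ (0, j) * cofactor ?A 0 j)"
      by (rule laplace_expansion_row) auto
    also have "\<dots> = (\<Sum>j\<in>{0, n}. ?A $$ (0, j) * cofactor ?A 0 j)"
      by (rule sum.mono_neutral_right) auto
    also have "\<dots> = y * cofactor ?A 0 0 + c 0 * cofactor ?A 0 n"
      using False by simp
    also have "mat_delete ?A 0 0 = mat n n (?f n (\<lambda>i. c (Suc i)))"
      by (intro eq_matI) (auto simp: mat_delete_def)
    then have "cofactor ?A 0 0 = y ^ n + (\<Sum>i<n. c (Suc i) * y ^ i)"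
      using Suc.IH[of "\<lambda>i. c (Suc i)"] by (simp add: cofactor_def)
    also have "det (mat_delete ?A 0 n) = prod_list (diag_mat (mat_delete ?A 0 n))"
      by (rule det_upper_triangular[of _ n]) (auto simp: mat_delete_def upper_triangular_def)
    then have "cofactor ?A 0 n = (-1) ^ n * (\<Prod>i = 0..<n. - 1)"
      by (auto simp: cofactor_def prod_list_diag_prod mat_delete_def intro!: prod.cong arg_cong2[where f = "(*)"])
    then have "cofactor ?A 0 n = 1" by (simp flip: power_mult_distrib)
    finally show ?thesis
      by (simp add: lessThan_Suc_eq_insert_0 sum.reindex algebra_simps sum_distrib_left
          flip: image_Suc_lessThan)
  qed
qed

text \<open>A vector in the kernel of the transpose yields a polynomial of degree below
  \<open>n\<close> with \<open>n\<close> distinct roots. It is not zero, because the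
  \<open>F i\<close> are monic of increasing degree and the last nonzero coordinate is its leading
  coefficient.\<close>

lemma det_newton_vandermonde_nonzero:
  fixes F :: "nat \<Rightarrow> 'a::idom poly"
  assumes deg: "\<And>i. i < n \<Longrightarrow> degree (F i) = i" and monic: "\<And>i. i < n \<Longrightarrow> coeff (F i) i = 1"
    and inj: "inj_on \<xi> {0..<n}"
  shows "det (mat n n (\<lambda>(i, j). poly (F i) (\<xi> j))) \<noteq> 0"
proof
  assume 0: "det (mat n n (\<lambda>(i, j). poly (F i) (\<xi> j))) = 0"
  let ?A = "mat n n (\<lambda>(j, i). poly (F i) (\<xi> j))"
  have "?A = transpose_mat (mat n n (\<lambda>(i, j). poly (F i) (\<xi> j)))" by (intro eq_matI) auto
  then have "det ?A = 0" using 0 det_transpose[of "mat n n (\<lambda>(i, j). poly (F i) (\<xi> j))" n] by simp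
  then obtain v where v: "v \<in> carrier_vec n" "v \<noteq> 0\<^sub>v n" "?A *\<^sub>v v = 0\<^sub>v n"
    using det_0_iff_vec_prod_zero[of ?A n] by auto
  define G where "G = (\<Sum>i<n. smult (v $ i) (F i))"
  have root: "poly G (\<xi> j) = 0" if "j < n" for j
  proof -
    have "(?A *\<^sub>v v) $ j = 0" using that by (subst v(3)) simp
    moreover have "(?A *\<^sub>v v) $ j = (\<Sum>i<n. poly (F i) (\<xi> j) * v $ i)"
      using v(1) that by (simp add: scalar_prod_def lessThan_atLeast0)
    ultimately show ?thesis by (simp add: G_def poly_sum mult.commute)
  qed
  have zero: "v $ i = 0" if "i < n" for i
  proof (rule ccontr)
    assume "v $ i \<noteq> 0"
    let ?S = "{i. i < n \<and> v $ i \<noteq> 0}"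
    have fin: "finite ?S" and ne: "?S \<noteq> {}" using that \<open>v $ i \<noteq> 0\<close> by auto
    define d where "d = Max ?S"
    have d: "d < n" "v $ d \<noteq> 0" using Max_in[OF fin ne] by (auto simp: d_def)
    have top: "v $ i = 0" if "i < n" "i > d" for i
    proof (rule ccontr)
      assume "v $ i \<noteq> 0"
      then have "i \<in> ?S" using that by simp
      then have "i \<le> d" unfolding d_def using fin by (rule Max_ge[rotated])
      then show False using that by simp
    qed
    have "coeff G d = (\<Sum>i<n. if i = d then v $ d else 0)"
      unfolding G_def coeff_sum
    proof (rule sum.cong)
      fix i assume "i \<in> {..<n}"
      then show "coeff (smult (v $ i) (F i)) d = (if i = d then v $ d else 0)"
        using top[of i] monic[of i] deg[of i] d
        by (cases i d rule: linorder_cases) (auto simp: coeff_eq_0)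
    qed auto
    then have "coeff G d = v $ d" using d by simp
    then have "G \<noteq> 0" using d by auto
    have "degree G \<le> n - 1"
      unfolding G_def using deg by (intro degree_sum_le) (auto intro: order.trans[OF degree_smult_le])
    moreover have "card (\<xi> ` {0..<n}) \<le> card {x. poly G x = 0}"
      using root poly_roots_finite[OF \<open>G \<noteq> 0\<close>] by (intro card_mono) auto
    ultimately show False
      using card_poly_roots_bound[OF \<open>G \<noteq> 0\<close>] d by (simp add: card_image[OF inj])
  qed
  have "v = 0\<^sub>v n" using v(1) zero by (intro eq_vecI) auto
  then show False using v by simp
qed

section \<open>Subsets listed in decreasing order\<close>

definition dec_enum :: "nat set \<Rightarrow> nat \<Rightarrow> nat" where
  "dec_enum S i = rev (sorted_list_of_set S) ! i"

lemma dec_enum_less: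
  assumes "finite S" "i < j" "j < card S"
  shows "dec_enum S j < dec_enum S i"
proof -
  have "sorted_wrt (<) (sorted_list_of_set S)" by simp
  moreover have "length (sorted_list_of_set S) = card S" by simp
  ultimately show ?thesis
    using assms unfolding dec_enum_def
    by (simp add: rev_nth sorted_wrt_nth_less)
qed

lemma dec_enum_image:
  assumes "finite S"
  shows "dec_enum S ` {0..<card S} = S"
proof -
  have "set (rev (sorted_list_of_set S)) = S" using assms by simp
  moreover have "length (rev (sorted_list_of_set S)) = card S" by simp
  ultimately show ?thesis
    unfolding dec_enum_def by (metis nth_image order_refl take_all_iff)
qed

lemma dec_enum_mem: "finite S \<Longrightarrow> i < card S \<Longrightarrow> dec_enum S i \<in> S"
  using dec_enum_image[of S] by auto

lemma dec_enum_inj: "finite S \<Longrightarrow> inj_on (dec_enum S) {0..<card S}"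
  using dec_enum_image[of S] by (intro eq_card_imp_inj_on) auto

lemma dec_enum_unique:
  assumes dec: "\<And>i j. i < j \<Longrightarrow> j < n \<Longrightarrow> a j < a i" and i: "i < n"
  shows "dec_enum (a ` {0..<n}) i = a i"
proof -
  let ?l = "rev (map a [0..<n])"
  have "sorted_wrt (<) ?l"
    unfolding sorted_wrt_iff_nth_less by (auto simp: rev_nth intro!: dec)
  then have "sorted ?l" "distinct ?l" by (auto simp: strict_sorted_iff)
  then have "sorted_list_of_set (set ?l) = ?l"
    by (rule sorted_list_of_set.idem_if_sorted_distinct)
  then show ?thesis using i unfolding dec_enum_def by (simp add: rev_map[symmetric])
qed

text \<open>Sorting the rows costs only a sign, so distinct row indices always lead back to a
  determinant attached to a subset.\<close>

lemma det_rows_dec_enum: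
  fixes u :: "nat \<Rightarrow> nat \<Rightarrow> 'a::comm_ring_1"
  assumes inj: "inj_on b {0..<n}"
  obtains e where "e \<in> {1, - 1}" "det (mat n n (\<lambda>(i, j). u (b i) j))
    = e * det (mat n n (\<lambda>(i, j). u (dec_enum (b ` {0..<n}) i) j))"
proof -
  let ?S = "b ` {0..<n}" and ?N = "{0..<n}"
  let ?e = "dec_enum ?S"
  have card: "card ?S = n" using inj by (simp add: card_image)
  have e: "bij_betw ?e ?N ?S"
    using dec_enum_inj[of ?S] dec_enum_image[of ?S] card by (simp add: bij_betw_def)
  define \<pi> where "\<pi> = (\<lambda>i. if i \<in> ?N then inv_into ?N ?e (b i) else i)"
  have "bij_betw \<pi> ?N ?N"
  proof (rule bij_betw_cong[THEN iffD1])
    show "bij_betw (inv_into ?N ?e \<circ> b) ?N ?N"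
      using inj bij_betw_inv_into[OF e] by (intro bij_betw_trans[of b _ ?S]) (auto simp: bij_betw_def)
  qed (auto simp: \<pi>_def)
  then have perm: "\<pi> permutes ?N" by (rule bij_imp_permutes) (auto simp: \<pi>_def)
  have eq: "?e (\<pi> i) = b i" if "i < n" for i
    using that e unfolding \<pi>_def by (auto simp: bij_betw_def intro!: f_inv_into_f)
  have "det (mat n n (\<lambda>(i, j). u (b i) j)) = det (mat n n (\<lambda>(i, j). u (?e (\<pi> i)) j))"
    by (rule det_mat_cong) (simp add: eq)
  also have "\<dots> = signof \<pi> * det (mat n n (\<lambda>(i, j). u (?e i) j))"
    by (rule det_mat_permute_rows[OF perm])
  finally show thesis using that[OF signof_pm_one] by blast
qed

text \<open>Congruences are kept inside the ambient type: determinants and \<open>poly\<close> are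
  available for types of class \<open>comm_ring_1\<close>, whereas the quotient rings of the theorem
  are records. \<open>poly_coeffs\<close> carries the setting over to polynomials coefficientwise,
  which is the form needed for pencils.\<close>

locale subring_ideal =
  fixes R I :: "'a::comm_ring_1 set"
  assumes R_one: "1 \<in> R" and R_add: "x \<in> R \<Longrightarrow> y \<in> R \<Longrightarrow> x + y \<in> R"
    and R_uminus: "x \<in> R \<Longrightarrow> - x \<in> R" and R_mult: "x \<in> R \<Longrightarrow> y \<in> R \<Longrightarrow> x * y \<in> R"
    and I_R: "x \<in> I \<Longrightarrow> x \<in> R" and I_zero: "0 \<in> I"
    and I_add: "x \<in> I \<Longrightarrow> y \<in> I \<Longrightarrow> x + y \<in> I"
    and I_mult: "r \<in> R \<Longrightarrow> x \<in> I \<Longrightarrow> r * x \<in> I"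
begin

lemma R_zero: "0 \<in> R" using I_R I_zero by blast

lemma I_uminus: "x \<in> I \<Longrightarrow> - x \<in> I"
  using I_mult[of "- 1" x] R_uminus[OF R_one] by simp

lemma I_diff: "x \<in> I \<Longrightarrow> y \<in> I \<Longrightarrow> x - y \<in> I"
  using I_add[of x "- y"] I_uminus[of y] by simp

lemma I_mult': "x \<in> I \<Longrightarrow> r \<in> R \<Longrightarrow> x * r \<in> I"
  using I_mult[of r x] by (simp add: mult.commute)

lemma R_sum: "(\<And>x. x \<in> A \<Longrightarrow> f x \<in> R) \<Longrightarrow> sum f A \<in> R"
  by (induction A rule: infinite_finite_induct) (auto intro: R_add R_zero)

lemma I_sum: "(\<And>x. x \<in> A \<Longrightarrow> f x \<in> I) \<Longrightarrow> sum f A \<in> I"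
  by (induction A rule: infinite_finite_induct) (auto intro: I_add I_zero)

lemma R_prod: "(\<And>x. x \<in> A \<Longrightarrow> f x \<in> R) \<Longrightarrow> prod f A \<in> R"
  by (induction A rule: infinite_finite_induct) (auto intro: R_mult R_one)

lemma R_power: "x \<in> R \<Longrightarrow> x ^ n \<in> R"
  by (induction n) (auto intro: R_mult R_one)

lemma R_signof: "signof \<pi> \<in> R"
  by (cases \<pi> rule: sign_cases) (auto intro: R_one R_uminus)

lemma prod_diff_in_I:
  assumes "\<And>x. x \<in> A \<Longrightarrow> f x \<in> R \<and> g x \<in> R \<and> f x - g x \<in> I"
  shows "prod f A - prod g A \<in> I"
  using assms
proof (induction A rule: infinite_finite_induct)
  case (insert x A)
  have "prod f (insert x A) - prod g (insert x A)
      = f x * (prod f A - prod g A) + prod g A * (f x - g x)"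
    using insert by (simp add: algebra_simps)
  moreover have "prod g A \<in> R" using insert by (intro R_prod) auto
  ultimately show ?case using insert by (auto intro!: I_add I_mult)
qed (auto intro: I_zero)

lemma det_in_R:
  assumes "\<And>i j. i < n \<Longrightarrow> j < n \<Longrightarrow> f i j \<in> R"
  shows "det (mat n n (\<lambda>(i, j). f i j)) \<in> R"
  unfolding det_mat_def
proof (intro R_sum R_mult R_prod R_signof)
  fix \<pi> i assume "\<pi> \<in> {\<pi>. \<pi> permutes {0..<n}}" "i \<in> {0..<n}"
  then show "f i (\<pi> i) \<in> R" using permutes_in_image[of \<pi> "{0..<n}" i] by (auto intro: assms)
qed

lemma det_diff_in_I:
  assumes "\<And>i j. i < n \<Longrightarrow> j < n \<Longrightarrow> f i j \<in> R \<and> g i j \<in> R \<and> f i j - g i j \<in> I"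
  shows "det (mat n n (\<lambda>(i, j). f i j)) - det (mat n n (\<lambda>(i, j). g i j)) \<in> I"
  unfolding det_mat_def sum_subtractf[symmetric] right_diff_distrib[symmetric]
proof (intro I_sum I_mult R_signof prod_diff_in_I)
  fix \<pi> i assume "\<pi> \<in> {\<pi>. \<pi> permutes {0..<n}}" "i \<in> {0..<n}"
  then show "f i (\<pi> i) \<in> R \<and> g i (\<pi> i) \<in> R \<and> f i (\<pi> i) - g i (\<pi> i) \<in> I"
    using permutes_in_image[of \<pi> "{0..<n}" i] by (intro assms) auto
qed

lemma poly_coeffs: "subring_ideal {F. \<forall>n. coeff F n \<in> R} {F. \<forall>n. coeff F n \<in> I}"
  by unfold_locales
    (auto simp: coeff_mult intro: R_zero R_one R_add R_uminus R_mult I_R I_zero I_add R_sum I_sum I_mult)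

end

text \<open>With \<open>t\<close>-shifted powers $(x|t)^a = (x-t_1)\cdots(x-t_a)$ and a linear functional
  $L$ with $L((x|t)^a) = $ \<open>g a\<close>, the value is $L((x|t)^a (x|\beta)^j)$.\<close>

primrec fac_shift :: "(int \<Rightarrow> 'a::comm_ring_1) \<Rightarrow> (int \<Rightarrow> 'a) \<Rightarrow> (nat \<Rightarrow> 'a) \<Rightarrow> nat \<Rightarrow> int \<Rightarrow> 'a" where
  "fac_shift t g \<beta> 0 a = g a"
| "fac_shift t g \<beta> (Suc j) a
    = fac_shift t g \<beta> j (a + 1) + (t (a + 1) - \<beta> (Suc j)) * fac_shift t g \<beta> j a"

text \<open>The coefficient of x^l in the expanded product (x|\<beta>)^j.\<close>

primrec shift_coeff :: "(nat \<Rightarrow> 'a::comm_ring_1) \<Rightarrow> nat \<Rightarrow> nat \<Rightarrow> 'a" where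
  "shift_coeff \<beta> 0 l = (if l = 0 then 1 else 0)"
| "shift_coeff \<beta> (Suc j) l
    = (if l = 0 then 0 else shift_coeff \<beta> j (l - 1)) - \<beta> (Suc j) * shift_coeff \<beta> j l"

lemma shift_coeff_upper: "l > j \<Longrightarrow> shift_coeff \<beta> j l = 0"
  by (induction j arbitrary: l) auto

lemma shift_coeff_diag: "shift_coeff \<beta> j j = 1"
  by (induction j) (auto simp: shift_coeff_upper)

lemma fac_shift_expand:
  "n > j \<Longrightarrow> fac_shift t g \<beta> j a = (\<Sum>l<n. fac_shift t g (\<lambda>_. 0) l a * shift_coeff \<beta> j l)"
proof (induction j arbitrary: a n)
  case 0
  then have "{..<n} = insert 0 {1..<n}" by auto
  then show ?case by simp
next
  case (Suc j)
  then obtain n' where n: "n = Suc n'" "n' > j" by (cases n) auto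
  let ?f = "\<lambda>l a. fac_shift t g (\<lambda>_. 0) l a"
  have "fac_shift t g \<beta> (Suc j) a = (\<Sum>l<n'. ?f l (a + 1) * shift_coeff \<beta> j l)
      + (t (a + 1) - \<beta> (Suc j)) * (\<Sum>l<n'. ?f l a * shift_coeff \<beta> j l)"
    using Suc.IH n by simp
  also have "\<dots> = (\<Sum>l<n'. ?f (Suc l) a * shift_coeff \<beta> j l)
      - \<beta> (Suc j) * (\<Sum>l<n'. ?f l a * shift_coeff \<beta> j l)"
    by (simp add: algebra_simps sum.distrib sum_distrib_left sum_subtractf)
  also have "(\<Sum>l<n'. ?f l a * shift_coeff \<beta> j l) = (\<Sum>l<n. ?f l a * shift_coeff \<beta> j l)"
    using n by (simp add: shift_coeff_upper)
  also have "(\<Sum>l<n'. ?f (Suc l) a * shift_coeff \<beta> j l)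
      = (\<Sum>l<n. ?f l a * (if l = 0 then 0 else shift_coeff \<beta> j (l - 1)))"
    unfolding n(1) by (subst sum.lessThan_Suc_shift) simp
  finally show ?case
    by (simp add: sum_subtractf sum_distrib_left algebra_simps)
qed

text \<open>Passing from the (x|\<beta>)^j to the x^j is a unitriangular change of columns. This
  removes the second shift that the operators on the e_i carry in the dual version.\<close>

lemma det_fac_shift:
  "det (mat n n (\<lambda>(i, j). fac_shift t g \<beta> j (a i)))
    = det (mat n n (\<lambda>(i, j). fac_shift t g (\<lambda>_. 0) j (a i)))"
proof -
  let ?A = "mat n n (\<lambda>(i, j). fac_shift t g (\<lambda>_. 0) j (a i))"
  let ?B = "mat n n (\<lambda>(l, j). shift_coeff \<beta> j l)"
  have "mat n n (\<lambda>(i, j). fac_shift t g \<beta> j (a i)) = ?A * ?B"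
    by (intro eq_matI) (auto simp: scalar_prod_def fac_shift_expand[of _ n] lessThan_atLeast0)
  moreover have "det ?B = prod_list (diag_mat ?B)"
    by (rule det_upper_triangular[of _ n]) (auto simp: upper_triangular_def shift_coeff_upper)
  then have "det ?B = 1" by (simp add: prod_list_diag_prod shift_coeff_diag)
  ultimately show ?thesis by (simp add: det_mult[of _ n])
qed

section \<open>Linear functionals given by moments, and shifted powers\<close>

definition lin_ext :: "(nat \<Rightarrow> 'a::comm_ring_1) \<Rightarrow> 'a poly \<Rightarrow> 'a" where
  "lin_ext u F = (\<Sum>l\<le>degree F. coeff F l * u l)"

lemma lin_ext_bound:
  assumes "degree F \<le> n" shows "lin_ext u F = (\<Sum>l\<le>n. coeff F l * u l)"
  unfolding lin_ext_def using assms
  by (intro sum.mono_neutral_left) (auto simp: coeff_eq_0)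

lemma lin_ext_0 [simp]: "lin_ext u 0 = 0" by (simp add: lin_ext_def)

lemma lin_ext_add: "lin_ext u (F + H) = lin_ext u F + lin_ext u H"
proof -
  let ?n = "max (degree F) (degree H)"
  have "degree (F + H) \<le> ?n" by (rule degree_add_le_max)
  then show ?thesis by (simp add: lin_ext_bound[of _ ?n] distrib_right sum.distrib)
qed

lemma lin_ext_smult: "lin_ext u (smult c F) = c * lin_ext u F"
  by (simp add: lin_ext_bound[of _ "degree F"] degree_smult_le sum_distrib_left mult.assoc)

lemma lin_ext_sum: "lin_ext u (sum F A) = (\<Sum>x\<in>A. lin_ext u (F x))"
  by (induction A rule: infinite_finite_induct) (auto simp: lin_ext_add)

lemma lin_ext_monom: "lin_ext u (monom c n) = c * u n"
  by (subst lin_ext_bound[of _ n])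
    (auto simp: degree_monom_le coeff_monom if_distrib[of "\<lambda>x. x * _"] cong: if_cong)

lemma lin_ext_pCons: "lin_ext u (pCons c F) = c * u 0 + lin_ext (\<lambda>l. u (Suc l)) F"
proof -
  have "degree (pCons c F) \<le> Suc (degree F)" by (rule degree_pCons_le)
  then have "lin_ext u (pCons c F) = (\<Sum>l\<le>Suc (degree F). coeff (pCons c F) l * u l)"
    by (rule lin_ext_bound)
  also have "\<dots> = c * u 0 + lin_ext (\<lambda>l. u (Suc l)) F"
    unfolding lin_ext_def by (subst sum.atMost_Suc_shift) simp
  finally show ?thesis .
qed

lemma lin_ext_fun_add: "lin_ext (\<lambda>l. u l + c * w l) F = lin_ext u F + c * lin_ext w F"
  by (simp add: lin_ext_def sum.distrib sum_distrib_left algebra_simps)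

definition fac_power :: "(int \<Rightarrow> 'a::comm_ring_1) \<Rightarrow> nat \<Rightarrow> 'a poly" where
  "fac_power t n = (\<Prod>l = 1..n. [:- t (int l), 1:])"

lemma fac_power_0 [simp]: "fac_power t 0 = 1"
  by (simp add: fac_power_def)

lemma fac_power_Suc: "fac_power t (Suc n) = [:- t (int n + 1), 1:] * fac_power t n"
  by (simp add: fac_power_def mult.commute add.commute)

lemma fac_power_monic:
  fixes t :: "int \<Rightarrow> 'a::comm_ring_1"
  shows "degree (fac_power t n) = n \<and> coeff (fac_power t n) n = 1"
proof (induction n)
  case (Suc n)
  have c: "coeff (fac_power t (Suc n)) (Suc n) = 1"
    using Suc by (simp add: fac_power_Suc coeff_eq_0)
  have "degree (fac_power t (Suc n)) \<le> degree [:- t (int n + 1), 1:] + degree (fac_power t n)"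
    unfolding fac_power_Suc by (rule degree_mult_le)
  then have "degree (fac_power t (Suc n)) \<le> Suc n" using Suc by simp
  moreover have "Suc n \<le> degree (fac_power t (Suc n))" using c by (intro le_degree) auto
  ultimately show ?case using c by simp
qed simp

text \<open>The recursion of \<open>fac_shift\<close> is the identity x (x|t)^b = (x|t)^(b+1) +
  t_(b+1) (x|t)^b seen through the functional, so a change of base to b is a factor (x|t)^b.\<close>

lemma lin_ext_fac_power:
  "lin_ext (\<lambda>l. fac_shift t g (\<lambda>_. 0) l 0) (fac_power t b * F)
    = lin_ext (\<lambda>l. fac_shift t g (\<lambda>_. 0) l (int b)) F"
proof (induction b arbitrary: F)
  case (Suc b)
  let ?L = "\<lambda>a. lin_ext (\<lambda>l. fac_shift t g (\<lambda>_. 0) l a)"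
  have "fac_power t (Suc b) * F = fac_power t b * ([:- t (int b + 1), 1:] * F)"
    by (simp only: fac_power_Suc ac_simps)
  then have "?L 0 (fac_power t (Suc b) * F) = ?L (int b) ([:- t (int b + 1), 1:] * F)"
    using Suc by simp
  also have "[:- t (int b + 1), 1:] * F = smult (- t (int b + 1)) F + pCons 0 F"
    by simp
  also have "?L (int b) \<dots> = - t (int b + 1) * ?L (int b) F + ?L (int b) (pCons 0 F)"
    by (simp only: lin_ext_add lin_ext_smult)
  also have "?L (int b) (pCons 0 F) = ?L (int b + 1) F + t (int b + 1) * ?L (int b) F"
    by (simp add: lin_ext_pCons lin_ext_fun_add)
  finally show ?case by (simp add: add.commute)
qed simp

lemma fac_power_subleading:
  "coeff (fac_power t (Suc n)) n = - (\<Sum>l = 0..<Suc n. t (int l + 1))"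
proof (induction n)
  case 0
  show ?case by (simp add: fac_power_Suc)
next
  case (Suc n)
  have "coeff (fac_power t (Suc n)) (Suc n) = 1" using fac_power_monic by blast
  then show ?case using Suc by (subst fac_power_Suc) (simp add: algebra_simps)
qed

text \<open>One setting for both versions: k = p with the generators h_i, or k = m - p with the
  generators e_i and the reversed negated parameters. \<open>t_sums\<close> separates the classical
  eigenvalues of the divisor class, and \<open>t_inj\<close> keeps the Vandermonde determinants at
  fixed points nonzero.\<close>

locale factorial_presentation =
  fixes k m :: nat and t :: "int \<Rightarrow> mpoly" and gv :: "nat \<Rightarrow> indet"
  assumes k_pos: "0 < k" and k_less: "k < m"
    and t_in: "t (i::int) \<in> Lambda m"
    and t_out: "\<not> (1 \<le> (i::int) \<and> i \<le> int m) \<Longrightarrow> t i = 0"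
    and t_inj: "inj_on t {1..int m}"
    and t_sums: "\<lbrakk>S \<subseteq> {0..<m}; S' \<subseteq> {0..<m}; card S = k; card S' = k;
      (\<Sum>a\<in>S. t (int a + 1)) = (\<Sum>a\<in>S'. t (int a + 1))\<rbrakk> \<Longrightarrow> S = S'"
    and gv_inj: "inj gv"
    and gv_fresh: "gv n \<notin> insert qVar (T_vars m)"
begin

definition gen :: "int \<Rightarrow> mpoly" where
  "gen j = (if j = 0 then 1 else if 1 \<le> j \<and> j \<le> int m - int k then Var (gv (nat j)) else 0)"

text \<open>\<open>G j a\<close> stands for L((x|t)^a x^j). The base is an integer because the rows
  of \<open>E\<close> have bases k, k - 1, ..., which run below zero.\<close>

definition G :: "nat \<Rightarrow> int \<Rightarrow> mpoly" where
  "G = fac_shift t (\<lambda>a. gen (a + 1 - int k)) (\<lambda>_. 0)"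

definition E :: "nat \<Rightarrow> mpoly" where
  "E c = det (mat c c (\<lambda>(i, j). G j (int k - int i)))"

definition V :: "indet set" where
  "V = insert qVar (T_vars m) \<union> gv ` {1..m - k}"

abbreviation R :: "mpoly set" where "R \<equiv> polys_in V"

definition I :: "mpoly set" where
  "I = Idl\<^bsub>Defs.poly_ring V\<^esub> (E ` {k + 1..m - 1} \<union> {E m + (-1) ^ (m - k) * qq})"

definition Ks :: "nat set set" where
  "Ks = {S. S \<subseteq> {0..<m} \<and> card S = k}"

definition s :: "nat set \<Rightarrow> mpoly" where
  "s S = det (mat k k (\<lambda>(i, j). G j (int (dec_enum S i))))"

lemma G_0: "G 0 a = gen (a + 1 - int k)" by (simp add: G_def)

lemma G_Suc: "G (Suc j) a = G j (a + 1) + t (a + 1) * G j a" by (simp add: G_def)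

lemma G_low: "a + int j < int k - 1 \<Longrightarrow> G j a = 0"
  by (induction j arbitrary: a) (auto simp: G_0 G_Suc gen_def)

lemma G_one: "a + int j = int k - 1 \<Longrightarrow> G j a = 1"
  by (induction j arbitrary: a) (auto simp: G_0 G_Suc gen_def G_low)

lemma G_high: "a \<ge> int m \<Longrightarrow> G j a = 0"
  using k_less by (induction j arbitrary: a) (auto simp: G_0 G_Suc gen_def)

lemma Lambda_q_in_R: "f \<in> Lambda_q m \<Longrightarrow> f \<in> R"
  unfolding Lambda_q_def V_def using polys_in_mono by blast

lemma t_in_Lambda_q: "t i \<in> Lambda_q m"
  using t_in[of i] polys_in_mono[of "T_vars m" "insert qVar (T_vars m)"]
  by (auto simp: Lambda_def Lambda_q_def)

lemma qq_in_Lambda_q: "qq \<in> Lambda_q m"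
  by (auto simp: Lambda_q_def)

lemma t_in_R: "t i \<in> R" and qq_in_R: "qq \<in> R"
  using t_in_Lambda_q qq_in_Lambda_q Lambda_q_in_R by auto

lemma gen_in_R: "gen j \<in> R"
  by (auto simp: gen_def V_def nat_le_iff of_nat_diff intro!: polys_in_Var)

lemma G_in_R: "G j a \<in> R"
  by (induction j arbitrary: a) (auto simp: G_0 G_Suc intro!: gen_in_R t_in_R polys_in_add polys_in_mult)

lemma subring_R: "subring_ideal R R"
  by unfold_locales auto

lemma E_in_R: "E c \<in> R"
  unfolding E_def by (rule subring_ideal.det_in_R[OF subring_R]) (simp add: G_in_R)

lemma s_in_R: "s S \<in> R"
  unfolding s_def by (rule subring_ideal.det_in_R[OF subring_R]) (simp add: G_in_R)

lemma generators_subset: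
  "E ` {k + 1..m - 1} \<union> {E m + (-1) ^ (m - k) * qq} \<subseteq> carrier (Defs.poly_ring V)"
  using E_in_R by (auto intro!: polys_in_add polys_in_mult polys_in_power polys_in_uminus qq_in_R)

lemma I_ideal: "ideal I (Defs.poly_ring V)"
proof -
  interpret cring "Defs.poly_ring V" by (rule cring_poly_ring)
  show ?thesis unfolding I_def by (rule genideal_ideal[OF generators_subset])
qed

sublocale subring_ideal R I
proof -
  interpret ideal I "Defs.poly_ring V" by (rule I_ideal)
  show "subring_ideal R I"
  proof unfold_locales
    show "x \<in> I \<Longrightarrow> x \<in> R" for x using Icarr by simp
    show "0 \<in> I" using additive_subgroup.zero_closed[OF is_additive_subgroup] by simp
    show "x \<in> I \<Longrightarrow> y \<in> I \<Longrightarrow> x + y \<in> I" for x y using additive_subgroup.a_closed[OF is_additive_subgroup, of x y] by simp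
    show "r \<in> R \<Longrightarrow> x \<in> I \<Longrightarrow> r * x \<in> I" for r x using I_l_closed[of x r] by simp
  qed auto
qed

lemma E_in_I: "k < c \<Longrightarrow> c < m \<Longrightarrow> E c \<in> I"
  and Em_in_I: "E m + (-1) ^ (m - k) * qq \<in> I"
proof -
  interpret cring "Defs.poly_ring V" by (rule cring_poly_ring)
  have "E ` {k + 1..m - 1} \<union> {E m + (-1) ^ (m - k) * qq} \<subseteq> I"
    unfolding I_def by (rule genideal_self[OF generators_subset])
  then show "k < c \<Longrightarrow> c < m \<Longrightarrow> E c \<in> I" "E m + (-1) ^ (m - k) * qq \<in> I" by auto
qed

text \<open>Row i of the matrix of \<open>E\<close> starts from the base k - i, so
  \<open>G_low\<close> and \<open>G_one\<close> make that matrix Hessenberg with ones on the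
  subdiagonal.\<close>

lemma E_recursion: "(\<Sum>i\<le>Suc c. (-1) ^ i * E i * G c (int k - int i)) = 0"
  unfolding E_def
  by (rule det_hessenberg[of "\<lambda>i j. G j (int k - int i)"]) (auto intro: G_low G_one)

lemma E_0 [simp]: "E 0 = 1" by (simp add: E_def)

lemma E_1: "E 1 = gen 1"
  unfolding E_def by (subst det_single) (auto simp: G_0)

subsection \<open>The companion matrix of the universal factor\<close>

text \<open>The coefficients are chosen so that L(\<chi> x^c) consists of the first k + 1 summands
  of \<open>E_recursion\<close>; the truncation drops only multiples of the E_i with i > k.\<close>

definition chi :: "mpoly poly" where
  "chi = (\<Sum>i\<le>k. smult ((-1) ^ i * E i) (fac_power t (k - i)))"

lemma coeff_chi:
  assumes "i \<le> k"
  shows "coeff chi (k - i) = (\<Sum>l\<le>i. (-1) ^ l * E l * coeff (fac_power t (k - l)) (k - i))"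
proof -
  have "coeff chi (k - i) = (\<Sum>l\<le>k. (-1) ^ l * E l * coeff (fac_power t (k - l)) (k - i))"
    by (simp add: chi_def coeff_sum)
  also have "\<dots> = (\<Sum>l\<le>i. (-1) ^ l * E l * coeff (fac_power t (k - l)) (k - i))"
    using assms fac_power_monic[of t] by (intro sum.mono_neutral_right) (auto simp: coeff_eq_0)
  finally show ?thesis .
qed

lemma coeff_chi_k: "coeff chi k = 1"
  using coeff_chi[of 0] fac_power_monic[of t k] by simp

lemma degree_chi: "degree chi = k"
proof (rule antisym)
  show "degree chi \<le> k"
    unfolding chi_def using fac_power_monic[of t]
    by (intro degree_sum_le) (auto intro!: order.trans[OF degree_smult_le])
  show "k \<le> degree chi" using coeff_chi_k by (intro le_degree) auto
qed

lemma coeff_fac_power_in_Lambda_q: "coeff (fac_power t n) l \<in> Lambda_q m"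
proof -
  have "subring_ideal (Lambda_q m) (Lambda_q m)"
    unfolding Lambda_q_def by unfold_locales auto
  then interpret L: subring_ideal "{F. \<forall>n. coeff F n \<in> Lambda_q m}" "{F. \<forall>n. coeff F n \<in> Lambda_q m}"
    by (rule subring_ideal.poly_coeffs)
  have "fac_power t n \<in> {F. \<forall>n. coeff F n \<in> Lambda_q m}"
    unfolding fac_power_def
    using t_in_Lambda_q by (intro L.R_prod) (auto simp: coeff_pCons Lambda_q_def split: nat.splits)
  then show ?thesis by simp
qed

lemma coeff_chi_in_R: "coeff chi l \<in> R"
  unfolding chi_def coeff_sum coeff_smult
  using E_in_R Lambda_q_in_R[OF coeff_fac_power_in_Lambda_q] by (intro R_sum R_mult R_power R_uminus) auto

abbreviation Lf :: "int \<Rightarrow> mpoly poly \<Rightarrow> mpoly" where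
  "Lf a \<equiv> lin_ext (\<lambda>l. G l a)"

lemma Lf_fac_power: "Lf 0 (fac_power t b * F) = Lf (int b) F"
  unfolding G_def by (rule lin_ext_fac_power)

lemma Lf_chi_monom: "Lf 0 (chi * monom 1 c) = (\<Sum>i\<le>k. (-1) ^ i * E i * G c (int k - int i))"
proof -
  have "Lf 0 (chi * monom 1 c) = (\<Sum>i\<le>k. (-1) ^ i * E i * Lf 0 (fac_power t (k - i) * monom 1 c))"
    by (simp only: chi_def sum_distrib_right mult_smult_left lin_ext_sum lin_ext_smult)
  then show ?thesis
    by (simp add: Lf_fac_power lin_ext_monom of_nat_diff)
qed

text \<open>The full alternating sum vanishes, so L(\<chi> x^c) is minus its tail. For c < m - 1 the
  tail lies in the ideal; at c = m - 1 there is one more summand (-1)^m E_m, which the last relation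
  converts into the q-term.\<close>

lemma Lf_chi_monom_mod:
  assumes "c < m"
  shows "Lf 0 (chi * monom 1 c) - (if c = m - 1 then (-1) ^ k * qq else 0) \<in> I"
proof -
  let ?f = "\<lambda>i. (-1) ^ i * E i * G c (int k - int i)"
  \<comment> \<open>For c + 1 < k the recursion has fewer summands than \<chi>. The missing ones
    vanish by \<open>G_low\<close>, so both sums can be compared up to the larger bound.\<close>
  let ?N = "max k (Suc c)"
  have 1: "sum ?f {..k} = sum ?f {..?N} - sum ?f {k<..?N}"
    using sum.union_disjoint[of "{..k}" "{k<..?N}" ?f] ivl_disj_int_one(3)[of k ?N]
    by (simp add: ivl_disj_un)
  have "sum ?f {..?N} = sum ?f {..Suc c}"
    by (rule sum.mono_neutral_right) (auto intro: G_low)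
  then have 2: "sum ?f {..?N} = 0" by (simp only: E_recursion)
  have I: "?f i \<in> I" if "k < i" "i < m" for i
    using E_in_I[OF that] by (intro I_mult' I_mult G_in_R) auto
  show ?thesis
  proof (cases "c = m - 1")
    case False
    then have "sum ?f {k<..?N} \<in> I" using assms I by (intro I_sum) auto
    then show ?thesis using False 1 2 I_uminus by (simp add: Lf_chi_monom)
  next
    case True
    then have eq: "{k<..?N} = insert m {k<..<m}" using k_less by auto
    have "?f m = (-1) ^ m * E m" using True k_less by (simp add: G_one)
    then have 3: "sum ?f {k<..?N} = (-1) ^ m * E m + sum ?f {k<..<m}" unfolding eq by simp
    have 4: "(-1) ^ m * ((-1) ^ (m - k) * qq) = (-1) ^ k * qq"
      using k_less minus_one_power_iff[of "m + (m - k)", where 'a = mpoly]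
        minus_one_power_iff[of k, where 'a = mpoly]
      by (simp flip: mult.assoc power_add)
    have "Lf 0 (chi * monom 1 c) - (-1) ^ k * qq
        = - ((-1) ^ m * (E m + (-1) ^ (m - k) * qq)) - sum ?f {k<..<m}"
      unfolding Lf_chi_monom 1 2 3 distrib_left 4 by simp
    also have "\<dots> \<in> I"
    proof (intro I_diff I_sum)
      show "- ((-1) ^ m * (E m + (-1) ^ (m - k) * qq)) \<in> I"
        using Em_in_I by (intro I_uminus I_mult) auto
    qed (use I in auto)
    finally show ?thesis using True by simp
  qed
qed

text \<open>Expanding (x|t)^a in powers of x, only a = m - 1 reaches the exceptional exponent, and
  there the coefficient is 1.\<close>

lemma Lf_chi_mod:
  assumes "a < m"
  shows "Lf (int a) chi - (if a = m - 1 then (-1) ^ k * qq else 0) \<in> I"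
proof -
  let ?e = "\<lambda>c. if c = m - 1 then (-1) ^ k * qq else 0"
  have "fac_power t a * chi = (\<Sum>c\<le>a. smult (coeff (fac_power t a) c) (chi * monom 1 c))"
    by (subst poly_as_sum_of_monoms'[of "fac_power t a" a, symmetric])
      (use fac_power_monic[of t a] in \<open>auto simp: sum_distrib_right smult_monom intro!: sum.cong\<close>,
        metis mult.commute mult_smult_right smult_monom mult.right_neutral)
  then have "Lf (int a) chi = (\<Sum>c\<le>a. coeff (fac_power t a) c * Lf 0 (chi * monom 1 c))"
    by (simp only: Lf_fac_power[symmetric] lin_ext_sum lin_ext_smult)
  moreover have "?e a = (\<Sum>c\<le>a. coeff (fac_power t a) c * ?e c)"
    using assms fac_power_monic[of t a]
    by (cases "a = m - 1") (auto simp: if_distrib[of "\<lambda>x. _ * x"] cong: if_cong)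
  ultimately have "Lf (int a) chi - ?e a
      = (\<Sum>c\<le>a. coeff (fac_power t a) c * (Lf 0 (chi * monom 1 c) - ?e c))"
    by (simp only: right_diff_distrib sum_subtractf)
  also have "\<dots> \<in> I"
    using assms Lf_chi_monom_mod Lambda_q_in_R[OF coeff_fac_power_in_Lambda_q]
    by (intro I_sum I_mult) auto
  finally show ?thesis .
qed

text \<open>Reducing the rows modulo \<open>I\<close> turns $(x|t)^m$ into $(-1)^{k-1}q$.\<close>

definition row :: "nat \<Rightarrow> nat \<Rightarrow> mpoly" where
  "row a j = (if a = m then (if Suc j = k then (-1) ^ (k - 1) * qq else 0) else G j (int a))"

text \<open>The moments of x (x|t)^a, with the reduced value in place of (x|t)^m.\<close>

definition xrow :: "nat \<Rightarrow> nat \<Rightarrow> mpoly" where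
  "xrow a j = row (Suc a) j + t (int a + 1) * row a j"

lemma row_in_R: "row a j \<in> R"
  using qq_in_R G_in_R by (auto simp: row_def)

lemma row_m: "j < k \<Longrightarrow> row m j = (-1) ^ (k - 1) * qq * row 0 j"
  using k_less by (auto simp: row_def G_one intro!: G_low)

lemma xrow_eq: "a < m \<Longrightarrow> Suc j < k \<Longrightarrow> xrow a j = row a (Suc j)"
  by (auto simp: xrow_def row_def G_Suc G_high algebra_simps)

text \<open>Together with \<open>xrow_eq\<close> this is the companion matrix: multiplication by x
  shifts the columns, and the last one is rewritten by means of L((x|t)^a \<chi>). At a = m - 1 the
  value stored in \<open>row m\<close> cancels the defect (-1)^k q of
  \<open>Lf_chi_mod\<close>.\<close>

lemma xrow_mod:
  assumes "a < m"
  shows "xrow a (k - 1) + (\<Sum>l<k. coeff chi l * row a l) \<in> I"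
proof -
  let ?e = "if a = m - 1 then (-1) ^ k * qq else 0"
  have "Lf (int a) chi = (\<Sum>l\<le>k. coeff chi l * G l (int a))"
    by (simp add: lin_ext_def degree_chi)
  also have "{..k} = insert k {..<k}" by auto
  also have "(\<Sum>l\<in>insert k {..<k}. coeff chi l * G l (int a))
      = G k (int a) + (\<Sum>l<k. coeff chi l * row a l)"
    using assms by (simp add: coeff_chi_k row_def)
  also have "G k (int a) = G (k - 1) (int a + 1) + t (int a + 1) * G (k - 1) (int a)"
    using G_Suc[of "k - 1" "int a"] k_pos by simp
  also have "\<dots> = xrow a (k - 1) + ?e"
  proof (cases "a = m - 1")
    case True
    have "(-1 :: mpoly) ^ k = - ((-1) ^ (k - 1))" using k_pos by (cases k) auto
    moreover have "G (k - 1) (int a + 1) = 0" using True by (intro G_high) auto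
    moreover have "Suc a = m" using True assms by simp
    ultimately show ?thesis using True k_pos assms by (simp add: xrow_def row_def)
  next
    case False
    then have "Suc a \<noteq> m" by simp
    then show ?thesis using assms False by (simp add: xrow_def row_def add.commute)
  qed
  finally show ?thesis using Lf_chi_mod[OF assms] by (simp add: algebra_simps)
qed

text \<open>Modulo \<open>I\<close> the pencil is the matrix of rows times X - C, with C the
  companion matrix of \<chi>, so its determinant is \<chi>(X) times that of the rows. The
  coefficient of X^(k-1) gives the Chevalley rule, and all coefficients together give
  spanning.\<close>

lemma pencil_mod:
  assumes a: "\<And>i. i < k \<Longrightarrow> a i < m"
  shows "coeff (det (mat k k (\<lambda>(i, j). [:- xrow (a i) j, row (a i) j:]))) n
    - coeff chi n * det (mat k k (\<lambda>(i, j). row (a i) j)) \<in> I"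
proof -
  interpret P: subring_ideal "{F. \<forall>n. coeff F n \<in> R}" "{F. \<forall>n. coeff F n \<in> I}"
    by (rule poly_coeffs)
  \<comment> \<open>\<open>?z\<close> is \<open>xrow\<close> with the last column replaced by the
    combination prescribed by \<chi>. For it the matrix factorisation is exact; the congruence
    enters only when \<open>?z\<close> is traded for \<open>xrow\<close>.\<close>
  let ?z = "\<lambda>i j. if Suc j < k then row (a i) (Suc j) else - (\<Sum>l<k. coeff chi l * row (a i) l)"
  let ?M = "mat k k (\<lambda>(i, j). [:row (a i) j:])"
  let ?C = "mat k k (\<lambda>(i, j). (if i = j then [:0, 1:] else 0) - (if i = Suc j then 1 else 0)
      + (if Suc j = k then [:coeff chi i:] else 0))"
  have "mat k k (\<lambda>(i, j). [:- ?z i j, row (a i) j:]) = ?M * ?C"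
  proof (rule eq_matI)
    fix i j assume "i < dim_row (?M * ?C)" "j < dim_col (?M * ?C)"
    then have i: "i < k" and j: "j < k" by auto
    let ?r = "\<lambda>l. [:row (a i) l:]"
    have "(?M * ?C) $$ (i, j) = (\<Sum>l<k. ?r l * ((if l = j then [:0, 1:] else 0)
        - (if l = Suc j then 1 else 0) + (if Suc j = k then [:coeff chi l:] else 0)))"
      using i j by (simp add: scalar_prod_def lessThan_atLeast0)
    also have "\<dots> = (\<Sum>l<k. if l = j then ?r l * [:0, 1:] else 0) - (\<Sum>l<k. if l = Suc j then ?r l else 0)
        + (\<Sum>l<k. if Suc j = k then [:coeff chi l * row (a i) l:] else 0)"
      unfolding sum.distrib[symmetric] sum_subtractf[symmetric]
      by (intro sum.cong refl) (auto simp: algebra_simps)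
    also have "\<dots> = [:- ?z i j, row (a i) j:]"
    proof (cases "Suc j < k")
      case True
      then show ?thesis using j by simp
    next
      case False
      then have "Suc j = k" using j by simp
      then have "[:- ?z i j, row (a i) j:] = [:0, row (a i) j:] + [:\<Sum>l<k. coeff chi l * row (a i) l:]"
        by simp
      also have "[:\<Sum>l<k. coeff chi l * row (a i) l:] = (\<Sum>l<k. [:coeff chi l * row (a i) l:])"
        by (intro poly_eqI) (auto simp: coeff_sum coeff_pCons split: nat.splits)
      finally show ?thesis using \<open>Suc j = k\<close> by simp
    qed
    finally show "mat k k (\<lambda>(i, j). [:- ?z i j, row (a i) j:]) $$ (i, j) = (?M * ?C) $$ (i, j)"
      using i j by simp
  qed auto
  then have "det (mat k k (\<lambda>(i, j). [:- ?z i j, row (a i) j:])) = det ?M * det ?C"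
    by (simp add: det_mult[of _ k])
  also have "det ?C = [:0, 1:] ^ k + (\<Sum>i<k. [:coeff chi i:] * [:0, 1:] ^ i)"
    by (rule det_companion)
  also have "\<dots> = (\<Sum>i\<le>k. monom (coeff chi i) i)"
    unfolding lessThan_Suc_atMost[symmetric]
    by (simp add: coeff_chi_k monom_altdef add.commute)
  also have "\<dots> = chi" using poly_as_sum_of_monoms[of chi] by (simp add: degree_chi)
  finally have "det (mat k k (\<lambda>(i, j). [:- ?z i j, row (a i) j:]))
      = smult (det (mat k k (\<lambda>(i, j). row (a i) j))) chi"
    by (simp add: det_const_poly)
  moreover have "det (mat k k (\<lambda>(i, j). [:- xrow (a i) j, row (a i) j:]))
      - det (mat k k (\<lambda>(i, j). [:- ?z i j, row (a i) j:])) \<in> {F. \<forall>n. coeff F n \<in> I}"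
  proof (rule P.det_diff_in_I)
    fix i j assume i: "i < k" and j: "j < k"
    have x: "xrow (a i) j \<in> R"
      unfolding xrow_def by (intro R_add R_mult row_in_R t_in_R)
    have z: "?z i j \<in> R" using row_in_R coeff_chi_in_R by (auto intro!: R_sum R_uminus R_mult)
    have d: "?z i j - xrow (a i) j \<in> I"
    proof (cases "Suc j < k")
      case True
      then show ?thesis using xrow_eq[OF a[OF i]] I_zero by simp
    next
      case False
      then have "j = k - 1" using j by simp
      then have "?z i j - xrow (a i) j = - (xrow (a i) (k - 1) + (\<Sum>l<k. coeff chi l * row (a i) l))"
        using False by simp
      then show ?thesis using I_uminus[OF xrow_mod[OF a[OF i]]] by (simp only:)
    qed
    show "[:- xrow (a i) j, row (a i) j:] \<in> {F. \<forall>n. coeff F n \<in> R} \<and>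
        [:- ?z i j, row (a i) j:] \<in> {F. \<forall>n. coeff F n \<in> R} \<and>
        [:- xrow (a i) j, row (a i) j:] - [:- ?z i j, row (a i) j:] \<in> {F. \<forall>n. coeff F n \<in> I}"
      using x z d row_in_R[of "a i" j] R_zero I_zero R_uminus[OF x] R_uminus[OF z]
      by (auto simp: coeff_pCons split: nat.splits)
  qed
  ultimately show ?thesis by (simp add: mult.commute)
qed

section \<open>Determinants indexed by subsets\<close>

abbreviation Drow :: "(nat \<Rightarrow> nat) \<Rightarrow> mpoly" where
  "Drow b \<equiv> det (mat k k (\<lambda>(i, j). row (b i) j))"

lemma Ks_finite: "S \<in> Ks \<Longrightarrow> finite S"
  unfolding Ks_def using finite_subset by blast

lemma finite_Ks: "finite Ks"
  unfolding Ks_def by (rule finite_subset[of _ "Pow {0..<m}"]) auto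

lemma dec_enum_Ks: "S \<in> Ks \<Longrightarrow> i < k \<Longrightarrow> dec_enum S i \<in> S" "S \<in> Ks \<Longrightarrow> i < k \<Longrightarrow> dec_enum S i < m"
  using dec_enum_mem[of S i] Ks_finite[of S] by (auto simp: Ks_def)

lemma s_Drow: "S \<in> Ks \<Longrightarrow> s S = Drow (dec_enum S)"
  unfolding s_def using dec_enum_Ks(2)[of S] by (intro det_mat_cong) (auto simp: row_def)

lemma s_decreasing:
  assumes "\<And>i j. i < j \<Longrightarrow> j < k \<Longrightarrow> a j < a i"
  shows "s (a ` {0..<k}) = det (mat k k (\<lambda>(i, j). G j (int (a i))))"
  unfolding s_def by (rule det_mat_cong) (simp add: dec_enum_unique[of k a] assms)

text \<open>For a one-row shape the matrix is upper triangular, and \<open>G_one\<close> makes every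
  diagonal entry but the first equal to 1.\<close>

lemma s_row:
  assumes "j \<le> m - k"
  shows "s (insert (k - 1 + j) {0..<k - 1}) = gen (int j)"
proof -
  define a where "a = (\<lambda>i. if i = 0 then k - 1 + j else k - 1 - i)"
  have a0: "a 0 = k - 1 + j" by (simp add: a_def)
  have a1: "a i = k - 1 - i" if "0 < i" for i using that by (simp add: a_def)
  have "a ` {0..<k} = a ` insert 0 {1..<k}"
    using k_pos by (intro arg_cong[where f = "image a"]) auto
  also have "\<dots> = insert (k - 1 + j) (a ` {1..<k})" by (simp only: image_insert a0)
  also have "a ` {1..<k} = {0..<k - 1}"
  proof (intro equalityI subsetI)
    fix x assume "x \<in> {0..<k - 1}"
    then have "x = a (k - 1 - x)" "k - 1 - x \<in> {1..<k}" using a1[of "k - 1 - x"] by simp_all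
    then show "x \<in> a ` {1..<k}" by (rule image_eqI)
  next
    fix x assume "x \<in> a ` {1..<k}"
    then obtain i where "1 \<le> i" "i < k" "x = a i" by auto
    then show "x \<in> {0..<k - 1}" using a1[of i] by simp
  qed
  finally have im: "a ` {0..<k} = insert (k - 1 + j) {0..<k - 1}" .
  have dec: "a j < a i" if "i < j" "j < k" for i j
    using that by (cases "i = 0") (simp_all add: a_def)
  have low: "a i + j < k - 1" if "j < i" "i < k" for i j
    using that by (simp add: a_def)
  have "s (a ` {0..<k}) = det (mat k k (\<lambda>(i, j). G j (int (a i))))"
    by (rule s_decreasing) (rule dec)
  also have "\<dots> = prod_list (diag_mat (mat k k (\<lambda>(i, j). G j (int (a i)))))"
  proof (rule det_upper_triangular[of _ k])
    show "upper_triangular (mat k k (\<lambda>(i, j). G j (int (a i))))"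
    proof (rule upper_triangularI)
      fix i j assume "j < i" "i < dim_row (mat k k (\<lambda>(i, j). G j (int (a i))))"
      then have "j < i" "i < k" by simp_all
      moreover have "G j (int (a i)) = 0" using low[OF \<open>j < i\<close> \<open>i < k\<close>] by (intro G_low) linarith
      ultimately show "mat k k (\<lambda>(i, j). G j (int (a i))) $$ (i, j) = 0" by simp
    qed
  qed simp
  also have "\<dots> = (\<Prod>i = 0..<k. G i (int (a i)))"
    by (simp add: prod_list_diag_prod)
  also have "\<dots> = (\<Prod>i = 0..<k. if i = 0 then gen (int j) else 1)"
  proof (rule prod.cong[OF refl])
    fix i assume i: "i \<in> {0..<k}"
    show "G i (int (a i)) = (if i = 0 then gen (int j) else 1)"
    proof (cases "i = 0")
      case True
      have "int (k - 1 + j) + 1 - int k = int j" using k_pos by linarith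
      then show ?thesis using True by (simp only: a0 G_0 if_True simp_thms)
    next
      case False
      have "int (a i) + int i = int k - 1" using False i by (simp add: a_def)
      then show ?thesis using False by (simp add: G_one)
    qed
  qed
  also have "\<dots> = gen (int j)" using k_pos by (simp add: prod.delta)
  finally show ?thesis unfolding im .
qed

lemma s_base: "s {0..<k} = 1"
proof -
  have "insert (k - 1 + 0) {0..<k - 1} = {0..<k}" using k_pos by auto
  then show ?thesis using s_row[of 0] by (simp add: gen_def)
qed

lemma base_in_Ks: "{0..<k} \<in> Ks"
  using k_less by (auto simp: Ks_def)

subsection \<open>The quantum Chevalley rule modulo the relations\<close>

text \<open>A subset is a configuration of beads on m cyclically arranged places. A bead moving up
  one place adds a box; a bead wrapping from m - 1 to 0 removes a rim of m - 1 boxes.\<close>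

definition moves :: "nat set \<Rightarrow> nat set" where
  "moves S = {a \<in> S. Suc a \<notin> S \<and> Suc a < m}"

definition move :: "nat set \<Rightarrow> nat \<Rightarrow> nat set" where
  "move S a = insert (Suc a) (S - {a})"

definition wraps :: "nat set \<Rightarrow> bool" where
  "wraps S \<longleftrightarrow> m - 1 \<in> S \<and> 0 \<notin> S"

definition wrap :: "nat set \<Rightarrow> nat set" where
  "wrap S = insert 0 (S - {m - 1})"

definition weight :: "nat set \<Rightarrow> mpoly" where
  "weight S = (\<Sum>a\<in>S. t (int a + 1))"

lemma move_in_Ks: "S \<in> Ks \<Longrightarrow> a \<in> moves S \<Longrightarrow> move S a \<in> Ks"
  using Ks_finite[of S] k_pos by (auto simp: Ks_def moves_def move_def)

lemma wrap_in_Ks: "S \<in> Ks \<Longrightarrow> wraps S \<Longrightarrow> wrap S \<in> Ks"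
  using Ks_finite[of S] k_pos k_less by (auto simp: Ks_def wraps_def wrap_def)

abbreviation row_det :: "(nat \<Rightarrow> nat \<Rightarrow> mpoly) \<Rightarrow> (nat \<Rightarrow> nat) \<Rightarrow> mpoly" where
  "row_det u b \<equiv> det (mat k k (\<lambda>(i, j). u (b i) j))"

lemma row_det_decreasing:
  assumes "\<And>i j. i < j \<Longrightarrow> j < k \<Longrightarrow> a j < a i"
  shows "row_det u (dec_enum (a ` {0..<k})) = row_det u a"
  by (rule det_mat_cong) (simp add: dec_enum_unique[of k a] assms)

text \<open>Raising one row index keeps the indices decreasing, or repeats a row and gives 0, or
  produces row m. The condition on \<open>u m\<close> covers both the quantum rows, with c =
  (-1)^(k-1) q, and the classical localisations, with c = 0.\<close>

lemma det_move:
  fixes u :: "nat \<Rightarrow> nat \<Rightarrow> mpoly"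
  assumes S: "S \<in> Ks" and r: "r < k" and x: "x = dec_enum S r"
    and um: "\<And>j. j < k \<Longrightarrow> u m j = c * u 0 j"
  shows "row_det u ((dec_enum S)(r := Suc x)) = (if x \<in> moves S then row_det u (dec_enum (move S x))
    else if x = m - 1 \<and> 0 \<notin> S then (-1) ^ (k - 1) * c * row_det u (dec_enum (wrap S)) else 0)"
proof -
  define a where "a = dec_enum S"
  have fin: "finite S" by (rule Ks_finite[OF S])
  have card: "card S = k" and sub: "S \<subseteq> {0..<m}" using S unfolding Ks_def by blast+
  have x: "x = a r" using x by (simp add: a_def)
  have aS: "a i \<in> S" "a i < m" if "i < k" for i using dec_enum_Ks[OF S that] by (simp_all add: a_def)
  have xS: "x \<in> S" using aS(1)[OF r] x by simp
  have inj: "inj_on a {0..<k}" using dec_enum_inj[OF fin] card by (simp add: a_def)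
  have dec: "a j < a i" if "i < j" "j < k" for i j
    using dec_enum_less[OF fin] that card by (simp add: a_def)
  have im: "a ` {0..<k} = S" using dec_enum_image[OF fin] card by (simp add: a_def)
  have im': "a ` ({0..<k} - {r}) = S - {x}"
    using inj_on_image_set_diff[OF inj, of "{0..<k}" "{r}"] im r x by auto
  have img: "(a(r := y)) ` {0..<k} = insert y (S - {x})" for y
  proof -
    have "insert r ({0..<k} - {r}) = {0..<k}" using r by auto
    then have "(a(r := y)) ` {0..<k} = insert y (a ` ({0..<k} - {r}))"
      using image_insert[of "a(r := y)" r "{0..<k} - {r}"] by simp
    then show ?thesis unfolding im' .
  qed
  have rep: "row_det u (a(r := y)) = 0" if "y \<in> S" "y \<noteq> x" for y
  proof -
    have "y \<in> a ` {0..<k}" using that im by simp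
    then obtain r' where r': "r' < k" "y = a r'" by auto
    then show ?thesis
      using that x r by (intro det_equal_rows[of r _ r']) auto
  qed
  consider "Suc x \<in> S" | "x \<in> moves S" | "Suc x \<notin> S" "x = m - 1"
  proof -
    have "x < m" using xS sub by auto
    then show thesis using that xS by (cases "Suc x \<in> S"; cases "Suc x = m") (auto simp: moves_def)
  qed
  then have "row_det u (a(r := Suc x)) = (if x \<in> moves S then row_det u (dec_enum (move S x))
    else if x = m - 1 \<and> 0 \<notin> S then (-1) ^ (k - 1) * c * row_det u (dec_enum (wrap S)) else 0)"
  proof cases
    case 1
    then have "x \<notin> moves S" "x \<noteq> m - 1" using sub by (auto simp: moves_def)
    then show ?thesis using rep[of "Suc x"] 1 by simp
  next
    case 2
    have d: "(a(r := Suc x)) j < (a(r := Suc x)) i" if "i < j" "j < k" for i j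
    proof -
      have "a i \<noteq> Suc x" if "i < k" for i using aS(1)[OF that] 2 by (auto simp: moves_def)
      moreover have "i < k" using that by simp
      ultimately have "a i \<noteq> Suc x" by blast
      then show ?thesis
        using dec[OF that] x that by (cases "i = r"; cases "j = r") (auto intro: Suc_lessI)
    qed
    have "row_det u (dec_enum (move S x)) = row_det u (a(r := Suc x))"
      unfolding move_def img[symmetric] by (rule row_det_decreasing) (rule d)
    then show ?thesis using 2 by simp
  next
    case 3
    then have nm: "x \<notin> moves S" and sm: "Suc x = m" using k_less by (auto simp: moves_def)
    let ?b = "a(r := 0)"
    have "row_det u (a(r := Suc x)) = det (mat k k (\<lambda>(i, j). if i = r
        then c * u 0 j + 0 * u 0 j else u (a i) j))"
      by (rule det_mat_cong) (auto simp: sm um)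
    also have "\<dots> = c * det (mat k k (\<lambda>(i, j). if i = r then u 0 j else u (a i) j))"
      by (subst det_row_lin[OF r]) simp
    also have "det (mat k k (\<lambda>(i, j). if i = r then u 0 j else u (a i) j)) = row_det u ?b"
      by (rule det_mat_cong) auto
    finally have eq: "row_det u (a(r := Suc x)) = c * row_det u ?b" .
    show ?thesis
    proof (cases "0 \<in> S")
      case True
      moreover have "0 \<noteq> x" using 3 k_less k_pos by simp
      ultimately show ?thesis using nm eq rep[of 0] by (simp del: fun_upd_apply)
    next
      case False
      \<comment> \<open>The largest possible index m - 1 sits in the top row. Once it is replaced by
        0, this row has to pass the k - 1 others to restore the decreasing order, which is the
        cyclic shift \<open>idx\<close>.\<close>
      have "r = 0"
      proof (rule ccontr)
        assume "r \<noteq> 0"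
        then have "x < a 0" using dec[of 0 r] r x by simp
        moreover have "a 0 < m" using aS(2) k_pos by simp
        ultimately show False using 3 by simp
      qed
      define idx where "idx = (\<lambda>i. if i < k - 1 then i + 1 else i - (k - 1))"
      define d where "d = (\<lambda>i. if i = k - 1 then 0 else a (Suc i))"
      have c: "d i = ?b (idx i)" "idx i < k" if "i < k" for i
        using that \<open>r = 0\<close> by (auto simp: d_def idx_def)
      have "row_det u (dec_enum (d ` {0..<k})) = row_det u d"
      proof (rule row_det_decreasing)
        fix i j assume ij: "i < j" "j < k"
        have "a (Suc i) \<noteq> 0"
        proof
          assume "a (Suc i) = 0"
          moreover have "Suc i < k" using ij by simp
          ultimately show False using False aS(1)[of "Suc i"] by simp
        qed
        then show "d j < d i" using ij dec[of "Suc i" "Suc j"] by (auto simp: d_def)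
      qed
      also have "d ` {0..<k} = ?b ` {0..<k}"
      proof (intro equalityI subsetI)
        fix y assume "y \<in> ?b ` {0..<k}"
        then obtain i where i: "i < k" "y = ?b i" by auto
        show "y \<in> d ` {0..<k}"
        proof (cases "i = 0")
          case True
          then show ?thesis using i \<open>r = 0\<close> k_pos by (intro image_eqI[of _ _ "k - 1"]) (auto simp: d_def)
        next
          case False
          then show ?thesis using i \<open>r = 0\<close> by (intro image_eqI[of _ _ "i - 1"]) (auto simp: d_def)
        qed
      next
        fix y assume "y \<in> d ` {0..<k}"
        then obtain i where "i < k" "y = d i" by auto
        then show "y \<in> ?b ` {0..<k}" using c[of i] by (intro image_eqI[of _ _ "idx i"]) simp_all
      qed
      finally have "row_det u (dec_enum (wrap S)) = row_det u d" using img[of 0] 3 by (simp add: wrap_def)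
      also have "row_det u ?b = (-1) ^ (k - 1) * row_det u d"
      proof -
        have i: "(if i < k - 1 then i + 1 else i - (k - 1)) = idx i" for i by (simp add: idx_def)
        have "row_det u ?b = (-1) ^ ((k - 1) * 1) * det (mat (k - 1 + 1) (k - 1 + 1) (\<lambda>(i, j).
            mat k k (\<lambda>(i, j). u (?b i) j) $$ (if i < k - 1 then i + 1 else i - (k - 1), j)))"
          using k_pos by (intro det_swap_rows) auto
        moreover have "mat (k - 1 + 1) (k - 1 + 1) (\<lambda>(i, j).
            mat k k (\<lambda>(i, j). u (?b i) j) $$ (if i < k - 1 then i + 1 else i - (k - 1), j))
          = mat k k (\<lambda>(i, j). u (d i) j)"
          unfolding i using k_pos c by (intro eq_matI) (simp_all del: fun_upd_apply)
        ultimately show ?thesis by simp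
      qed
      then have "row_det u d = (-1) ^ (k - 1) * row_det u ?b" by (simp flip: mult.assoc power_mult_distrib)
      finally show ?thesis using nm eq False 3 by (simp add: mult_ac)
    qed
  qed
  then show ?thesis unfolding a_def .
qed

text \<open>Each row in turn is multiplied by x: the shifts move beads, and the diagonal parts add
  up to the weight.\<close>

lemma sum_det_move:
  fixes u :: "nat \<Rightarrow> nat \<Rightarrow> mpoly"
  assumes S: "S \<in> Ks" and um: "\<And>j. j < k \<Longrightarrow> u m j = c * u 0 j"
  shows "(\<Sum>r<k. det (mat k k (\<lambda>(i, j). if i = r
      then u (Suc (dec_enum S i)) j + t (int (dec_enum S i) + 1) * u (dec_enum S i) j
      else u (dec_enum S i) j)))
    = (\<Sum>x\<in>moves S. row_det u (dec_enum (move S x))) + weight S * row_det u (dec_enum S)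
    + (if wraps S then (-1) ^ (k - 1) * c * row_det u (dec_enum (wrap S)) else 0)"
proof -
  define a where "a = dec_enum S"
  let ?D = "\<lambda>S. row_det u (dec_enum S)"
  have fin: "finite S" by (rule Ks_finite[OF S])
  have card: "card S = k" and sub: "S \<subseteq> {0..<m}" using S unfolding Ks_def by blast+
  have bij: "bij_betw a {..<k} S"
    using dec_enum_inj[OF fin] dec_enum_image[OF fin] card by (simp add: a_def bij_betw_def lessThan_atLeast0)
  let ?f = "\<lambda>x. (if x \<in> moves S then ?D (move S x)
      else if x = m - 1 \<and> 0 \<notin> S then (-1) ^ (k - 1) * c * ?D (wrap S) else 0) + t (int x + 1) * ?D S"
  have "(\<Sum>r<k. det (mat k k (\<lambda>(i, j). if i = r
      then u (Suc (a i)) j + t (int (a i) + 1) * u (a i) j else u (a i) j)))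
      = (\<Sum>r<k. ?f (a r))"
  proof (rule sum.cong[OF refl])
    fix r assume "r \<in> {..<k}"
    then have r: "r < k" by simp
    have "det (mat k k (\<lambda>(i, j). if i = r
          then u (Suc (a i)) j + t (int (a i) + 1) * u (a i) j else u (a i) j))
        = det (mat k k (\<lambda>(i, j). if i = r then 1 * u (Suc (a r)) j
            + t (int (a r) + 1) * u (a r) j else u (a i) j))"
      by (rule det_mat_cong) auto
    also have "\<dots> = 1 * det (mat k k (\<lambda>(i, j). if i = r then u (Suc (a r)) j else u (a i) j))
        + t (int (a r) + 1) * det (mat k k (\<lambda>(i, j). if i = r then u (a r) j else u (a i) j))"
      by (rule det_row_lin[OF r])
    also have "det (mat k k (\<lambda>(i, j). if i = r then u (a r) j else u (a i) j)) = ?D S"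
      unfolding a_def by (rule det_mat_cong) auto
    also have "det (mat k k (\<lambda>(i, j). if i = r then u (Suc (a r)) j else u (a i) j))
        = row_det u (a(r := Suc (a r)))"
      by (rule det_mat_cong) auto
    also have "row_det u (a(r := Suc (a r))) = (if a r \<in> moves S then ?D (move S (a r))
        else if a r = m - 1 \<and> 0 \<notin> S then (-1) ^ (k - 1) * c * ?D (wrap S) else 0)"
      unfolding a_def by (rule det_move[OF S r refl um])
    finally show "det (mat k k (\<lambda>(i, j). if i = r
        then u (Suc (a i)) j + t (int (a i) + 1) * u (a i) j else u (a i) j)) = ?f (a r)"
      by (simp only: mult_1_left)
  qed
  also have "\<dots> = sum ?f S" by (rule sum.reindex_bij_betw[OF bij])
  also have "\<dots> = (\<Sum>x\<in>S. if x \<in> moves S then ?D (move S x)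
      else if x = m - 1 \<and> 0 \<notin> S then (-1) ^ (k - 1) * c * ?D (wrap S) else 0) + weight S * ?D S"
    unfolding sum.distrib weight_def sum_distrib_right ..
  also have "(\<Sum>x\<in>S. if x \<in> moves S then ?D (move S x)
      else if x = m - 1 \<and> 0 \<notin> S then (-1) ^ (k - 1) * c * ?D (wrap S) else 0)
    = (\<Sum>x\<in>S. if x \<in> moves S then ?D (move S x) else 0)
      + (\<Sum>x\<in>S. if x = m - 1 \<and> 0 \<notin> S then (-1) ^ (k - 1) * c * ?D (wrap S) else 0)"
    unfolding sum.distrib[symmetric] using k_less
    by (intro sum.cong) (auto simp: moves_def)
  also have "(\<Sum>x\<in>S. if x \<in> moves S then ?D (move S x) else 0) = (\<Sum>x\<in>moves S. ?D (move S x))"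
    using fin by (subst sum.inter_restrict[symmetric]) (auto intro!: sum.cong simp: moves_def)
  also have "(\<Sum>x\<in>S. if x = m - 1 \<and> 0 \<notin> S then (-1) ^ (k - 1) * c * ?D (wrap S) else 0)
      = (if wraps S then (-1) ^ (k - 1) * c * ?D (wrap S) else 0)"
    using fin by (cases "0 \<in> S") (auto simp: wraps_def)
  finally show ?thesis unfolding a_def by (simp only: ac_simps)
qed

text \<open>This is the coefficient of X^(k-1) in \<open>pencil_mod\<close>: the trace-like sum over
  rows on one side, and on the other the subleading coefficient of \<chi>, which contributes the
  base weight and E_1 = gen 1. The signs from \<open>row_m\<close> and from the wrap cancel.\<close>

lemma chevalley_mod:
  assumes S: "S \<in> Ks"
  shows "gen 1 * s S - ((\<Sum>x\<in>moves S. s (move S x)) + (weight S - weight {0..<k}) * s S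
    + (if wraps S then qq * s (wrap S) else 0)) \<in> I"
proof -
  define a where "a = dec_enum S"
  have "coeff (det (mat k k (\<lambda>(i, j). [:- xrow (a i) j, row (a i) j:]))) (k - 1)
      = - (\<Sum>r<k. det (mat k k (\<lambda>(i, j). if i = r then xrow (a i) j else row (a i) j)))"
    by (rule coeff_det_pencil[OF k_pos])
  also have "\<dots> = - ((\<Sum>x\<in>moves S. s (move S x)) + weight S * s S
      + (if wraps S then (-1) ^ (k - 1) * ((-1) ^ (k - 1) * qq) * s (wrap S) else 0))"
    unfolding a_def xrow_def
    by (subst sum_det_move[where u = row and c = "(-1) ^ (k - 1) * qq", OF S row_m])
      (use S move_in_Ks wrap_in_Ks in \<open>simp_all add: s_Drow\<close>)
  also have "(-1) ^ (k - 1) * ((-1) ^ (k - 1) * qq) = qq" by simp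
  finally have lhs: "coeff (det (mat k k (\<lambda>(i, j). [:- xrow (a i) j, row (a i) j:]))) (k - 1)
    = - ((\<Sum>x\<in>moves S. s (move S x)) + weight S * s S + (if wraps S then qq * s (wrap S) else 0))" .
  have "coeff (fac_power t k) (k - 1) = - weight {0..<k}"
    using fac_power_subleading[of t "k - 1"] k_pos by (simp add: weight_def)
  moreover have "coeff (fac_power t (k - 1)) (k - 1) = 1" using fac_power_monic[of t "k - 1"] by simp
  ultimately have chi: "coeff chi (k - 1) = - weight {0..<k} - gen 1"
    using coeff_chi[of 1] k_pos E_1 by simp
  have "coeff (det (mat k k (\<lambda>(i, j). [:- xrow (a i) j, row (a i) j:]))) (k - 1)
    - coeff chi (k - 1) * s S \<in> I"
    unfolding s_Drow[OF S] a_def using dec_enum_Ks(2)[OF S] by (rule pencil_mod)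
  moreover have "- (A + x * f + W) - (- y - g) * f = g * f - (A + (x - y) * f + W)"
    for A W x y g f :: mpoly by (simp add: algebra_simps)
  ultimately show ?thesis unfolding lhs chi by (simp only:)
qed

subsection \<open>The determinants span the quotient\<close>

definition Sp :: "mpoly set" where
  "Sp = {f \<in> R. \<exists>x. (\<forall>S\<in>Ks. x S \<in> Lambda_q m) \<and> f - (\<Sum>S\<in>Ks. x S * s S) \<in> I}"

lemma I_in_Sp: "f \<in> I \<Longrightarrow> f \<in> Sp"
  unfolding Sp_def by (auto intro!: I_R exI[of _ "\<lambda>_. 0"] simp: Lambda_q_def)

lemma Sp_add: "f \<in> Sp \<Longrightarrow> g \<in> Sp \<Longrightarrow> f + g \<in> Sp"
proof -
  assume "f \<in> Sp" "g \<in> Sp"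
  then obtain x y where f: "f \<in> R" "g \<in> R" and x: "\<forall>S\<in>Ks. x S \<in> Lambda_q m" "f - (\<Sum>S\<in>Ks. x S * s S) \<in> I"
    and y: "\<forall>S\<in>Ks. y S \<in> Lambda_q m" "g - (\<Sum>S\<in>Ks. y S * s S) \<in> I"
    unfolding Sp_def by blast
  have "f + g - (\<Sum>S\<in>Ks. (x S + y S) * s S) = (f - (\<Sum>S\<in>Ks. x S * s S)) + (g - (\<Sum>S\<in>Ks. y S * s S))"
    by (simp add: distrib_right sum.distrib)
  then have "f + g - (\<Sum>S\<in>Ks. (x S + y S) * s S) \<in> I" using I_add x y by (simp only:)
  then show ?thesis
    unfolding Sp_def using f x y
    by (auto intro!: exI[of _ "\<lambda>S. x S + y S"] simp: Lambda_q_def)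
qed

lemma Sp_mult: "c \<in> Lambda_q m \<Longrightarrow> f \<in> Sp \<Longrightarrow> c * f \<in> Sp"
proof -
  assume c: "c \<in> Lambda_q m" and "f \<in> Sp"
  then obtain x where f: "f \<in> R" and x: "\<forall>S\<in>Ks. x S \<in> Lambda_q m" "f - (\<Sum>S\<in>Ks. x S * s S) \<in> I"
    unfolding Sp_def by blast
  have "c * f - (\<Sum>S\<in>Ks. (c * x S) * s S) = c * (f - (\<Sum>S\<in>Ks. x S * s S))"
    by (simp add: right_diff_distrib sum_distrib_left mult.assoc)
  then have "c * f - (\<Sum>S\<in>Ks. (c * x S) * s S) \<in> I"
    using I_mult[OF Lambda_q_in_R[OF c]] x by (simp only:)
  then show ?thesis
    unfolding Sp_def using f x c Lambda_q_in_R[OF c]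
    by (auto intro!: exI[of _ "\<lambda>S. c * x S"] simp: Lambda_q_def)
qed

lemma Sp_uminus: "f \<in> Sp \<Longrightarrow> - f \<in> Sp"
  using Sp_mult[of "- 1" f] by (auto simp: Lambda_q_def)

lemma Sp_sum: "(\<And>x. x \<in> A \<Longrightarrow> f x \<in> Sp) \<Longrightarrow> sum f A \<in> Sp"
  by (induction A rule: infinite_finite_induct) (auto intro: Sp_add I_in_Sp I_zero)

lemma s_in_Sp: "S \<in> Ks \<Longrightarrow> s S \<in> Sp"
proof -
  assume S: "S \<in> Ks"
  have "s S - (\<Sum>S'\<in>Ks. (if S' = S then 1 else 0) * s S') = 0"
    using S finite_Ks by (simp add: if_distrib[of "\<lambda>x. x * _"] cong: if_cong)
  then have "s S - (\<Sum>S'\<in>Ks. (if S' = S then 1 else 0) * s S') \<in> I" by (simp only: I_zero)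
  then show ?thesis
    unfolding Sp_def
    by (intro CollectI conjI exI[of _ "\<lambda>S'. if S' = S then 1 else 0"] s_in_R) (simp_all add: Lambda_q_def)
qed

lemma Drow_in_Sp:
  assumes b: "\<And>i. i < k \<Longrightarrow> b i < m"
  shows "Drow b \<in> Sp"
proof (cases "inj_on b {0..<k}")
  case True
  let ?S = "b ` {0..<k}"
  have S: "?S \<in> Ks" using b True by (auto simp: Ks_def card_image)
  obtain e where "e \<in> {1, - 1}" "Drow b = e * Drow (dec_enum ?S)"
    by (rule det_rows_dec_enum[OF True, of row])
  then show ?thesis using s_in_Sp[OF S] Sp_uminus by (auto simp: s_Drow[OF S])
next
  case False
  then obtain r r' where "r < k" "r' < k" "r \<noteq> r'" "b r = b r'" by (auto simp: inj_on_def)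
  then have "Drow b = 0" by (intro det_equal_rows[of r _ r']) auto
  then show ?thesis using I_in_Sp I_zero by simp
qed

text \<open>Each entry row of the pencil is a \<Lambda>[q]-combination of rows with index below m,
  so by multilinearity its determinant has coefficients in the span; \<open>pencil_mod\<close>
  identifies them with the coefficients of \<chi> times s.\<close>

lemma coeff_chi_mult_in_Sp:
  assumes S: "S \<in> Ks"
  shows "coeff chi n * s S \<in> Sp"
proof -
  let ?a = "dec_enum S"
  have a: "?a i < m" if "i < k" for i using dec_enum_Ks S that by simp
  \<comment> \<open>The matrix of multiplication by x on the rows 0, ..., m - 1: a cyclic shift with
    the parameters on the diagonal and the signed q in the corner.\<close>
  define c where "c = (\<lambda>a b. (if b = Suc a then 1 else 0) + (if b = a then t (int a + 1) else 0)
      + (if Suc a = m \<and> b = 0 then (-1) ^ (k - 1) * qq else 0))"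
  have xrow: "xrow x j = (\<Sum>b\<in>{0..<m}. c x b * row b j)" if x: "x < m" and j: "j < k" for x j
  proof -
    have "(\<Sum>b\<in>{0..<m}. c x b * row b j) = (\<Sum>b\<in>{0..<m}. if b = Suc x then row b j else 0)
        + (\<Sum>b\<in>{0..<m}. if b = x then t (int x + 1) * row b j else 0)
        + (\<Sum>b\<in>{0..<m}. if b = 0 then (if Suc x = m then (-1) ^ (k - 1) * qq * row 0 j else 0) else 0)"
      unfolding sum.distrib[symmetric] c_def by (intro sum.cong) (auto simp: algebra_simps)
    also have "\<dots> = xrow x j"
      using x row_m[OF j] by (auto simp: xrow_def)
    finally show ?thesis ..
  qed
  let ?c = "\<lambda>i b. [:- c (?a i) b, if b = ?a i then 1 else 0:]"
  have "det (mat k k (\<lambda>(i, j). [:- xrow (?a i) j, row (?a i) j:]))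
      = det (mat k k (\<lambda>(i, j). \<Sum>b\<in>{0..<m}. ?c i b * [:row b j:]))"
  proof (rule det_mat_cong)
    fix i j assume ij: "i < k" "j < k"
    show "[:- xrow (?a i) j, row (?a i) j:] = (\<Sum>b\<in>{0..<m}. ?c i b * [:row b j:])"
    proof (rule poly_eqI)
      fix n
      have "(\<Sum>b\<in>{0..<m}. if b = ?a i then row b j else 0) = row (?a i) j"
        using a[OF ij(1)] by simp
      moreover have "coeff (\<Sum>b\<in>{0..<m}. ?c i b * [:row b j:]) n
          = (\<Sum>b\<in>{0..<m}. if n = 0 then - (c (?a i) b * row b j)
              else if n = 1 then (if b = ?a i then row b j else 0) else 0)"
        unfolding coeff_sum by (intro sum.cong refl) (auto simp: coeff_pCons split: nat.splits)
      ultimately show "coeff [:- xrow (?a i) j, row (?a i) j:] n = coeff (\<Sum>b\<in>{0..<m}. ?c i b * [:row b j:]) n"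
        unfolding xrow[OF a[OF ij(1)] ij(2)]
        by (auto simp: coeff_pCons sum_negf split: nat.splits)
    qed
  qed
  also have "\<dots> = (\<Sum>g\<in>PiE {0..<k} (\<lambda>_. {0..<m}). (\<Prod>i = 0..<k. ?c i (g i)) * [:Drow g:])"
    by (subst det_rows_sum) (auto simp: det_const_poly)
  finally have eq: "coeff (det (mat k k (\<lambda>(i, j). [:- xrow (?a i) j, row (?a i) j:]))) n
      = (\<Sum>g\<in>PiE {0..<k} (\<lambda>_. {0..<m}). coeff (\<Prod>i = 0..<k. ?c i (g i)) n * Drow g)"
    by (simp add: coeff_sum mult.commute)
  have "coeff (\<Prod>i = 0..<k. ?c i (g i)) n \<in> Lambda_q m" for g
  proof -
    have sub: "subring_ideal (Lambda_q m) (Lambda_q m)"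
      unfolding Lambda_q_def by unfold_locales auto
    then interpret L: subring_ideal "{F. \<forall>n. coeff F n \<in> Lambda_q m}" "{F. \<forall>n. coeff F n \<in> Lambda_q m}"
      by (rule subring_ideal.poly_coeffs)
    note L = subring_ideal.R_add[OF sub] subring_ideal.R_mult[OF sub] subring_ideal.R_power[OF sub]
      subring_ideal.R_uminus[OF sub] subring_ideal.R_one[OF sub] subring_ideal.R_zero[OF sub]
    have "(-1) ^ (k - 1) * qq \<in> Lambda_q m" by (intro L qq_in_Lambda_q)
    then have c: "c x b \<in> Lambda_q m" for x b
      unfolding c_def by (intro L(1)) (simp_all add: t_in_Lambda_q L(5,6))
    have "(\<Prod>i = 0..<k. ?c i (g i)) \<in> {F. \<forall>n. coeff F n \<in> Lambda_q m}"
      using c subring_ideal.R_uminus[OF sub] subring_ideal.R_one[OF sub] subring_ideal.R_zero[OF sub]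
      by (intro L.R_prod) (auto simp: coeff_pCons split: nat.splits)
    then show ?thesis by simp
  qed
  then have "coeff (det (mat k k (\<lambda>(i, j). [:- xrow (?a i) j, row (?a i) j:]))) n \<in> Sp"
    unfolding eq by (intro Sp_sum Sp_mult Drow_in_Sp) (auto simp: PiE_def Pi_def)
  moreover have "coeff (det (mat k k (\<lambda>(i, j). [:- xrow (?a i) j, row (?a i) j:]))) n - coeff chi n * s S \<in> I"
    unfolding s_Drow[OF S] using a by (rule pencil_mod)
  then have "- (coeff (det (mat k k (\<lambda>(i, j). [:- xrow (?a i) j, row (?a i) j:]))) n - coeff chi n * s S) \<in> Sp"
    using I_in_Sp Sp_uminus by blast
  ultimately show ?thesis using Sp_add by fastforce
qed

text \<open>The stabiliser of the span is a ring containing \<Lambda>[q]. Once it contains all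
  generators, applying it to s = 1 at the base subset shows that the span is everything.\<close>

definition Mult :: "mpoly set" where
  "Mult = {f \<in> R. \<forall>S\<in>Ks. f * s S \<in> Sp}"

lemma Mult_Sp:
  assumes f: "f \<in> Mult" and g: "g \<in> Sp"
  shows "f * g \<in> Sp"
proof -
  obtain x where x: "\<And>S. S \<in> Ks \<Longrightarrow> x S \<in> Lambda_q m" "g - (\<Sum>S\<in>Ks. x S * s S) \<in> I"
    using g unfolding Sp_def by blast
  have "f * g = f * (g - (\<Sum>S\<in>Ks. x S * s S)) + (\<Sum>S\<in>Ks. x S * (f * s S))"
    by (simp add: right_diff_distrib sum_distrib_left mult_ac)
  also have "\<dots> \<in> Sp"
  proof (rule Sp_add)
    show "f * (g - (\<Sum>S\<in>Ks. x S * s S)) \<in> Sp"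
      using f x(2) by (intro I_in_Sp I_mult) (auto simp: Mult_def)
    show "(\<Sum>S\<in>Ks. x S * (f * s S)) \<in> Sp"
      using f x(1) by (auto simp: Mult_def intro!: Sp_sum Sp_mult[of "x _"])
  qed
  finally show ?thesis .
qed

lemma Mult_add: "f \<in> Mult \<Longrightarrow> g \<in> Mult \<Longrightarrow> f + g \<in> Mult"
  unfolding Mult_def by (auto simp: distrib_right intro: Sp_add)

lemma Mult_mult: "f \<in> Mult \<Longrightarrow> g \<in> Mult \<Longrightarrow> f * g \<in> Mult"
  using Mult_Sp[of f] unfolding Mult_def by (auto simp: mult.assoc)

lemma Mult_Lambda_q: "f \<in> Lambda_q m \<Longrightarrow> f \<in> Mult"
  unfolding Mult_def using Lambda_q_in_R Sp_mult s_in_Sp by auto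

lemma Mult_I: "f \<in> I \<Longrightarrow> f \<in> Mult"
  unfolding Mult_def using I_R I_in_Sp I_mult'[OF _ s_in_R] by auto

lemma Mult_of_int: "of_int n \<in> Mult"
  by (rule Mult_Lambda_q) (simp add: Lambda_q_def)

lemma Mult_minus: "f \<in> Mult \<Longrightarrow> - f \<in> Mult"
  using Mult_mult[OF Mult_of_int[of "- 1"]] by simp

lemma Mult_power: "f \<in> Mult \<Longrightarrow> f ^ n \<in> Mult"
  using Mult_of_int[of 1] by (induction n) (auto intro: Mult_mult)

lemma Mult_sum: "(\<And>x. x \<in> A \<Longrightarrow> f x \<in> Mult) \<Longrightarrow> sum f A \<in> Mult"
  using Mult_of_int[of 0] by (induction A rule: infinite_finite_induct) (auto intro: Mult_add)

text \<open>Up to k, the coefficients of \<chi> determine the E_i by a unitriangular system with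
  entries in \<Lambda>; between k and m the E_i lie in the ideal.\<close>

lemma E_in_Mult: "i < m \<Longrightarrow> E i \<in> Mult"
proof (induction i rule: less_induct)
  case (less i)
  show ?case
  proof (cases "i \<le> k")
    case True
    have c1: "coeff chi (k - i) \<in> Mult"
      unfolding Mult_def using coeff_chi_in_R coeff_chi_mult_in_Sp by auto
    have c2: "coeff chi (k - i) = (-1) ^ i * E i
        + (\<Sum>l<i. (-1) ^ l * E l * coeff (fac_power t (k - l)) (k - i))"
      using coeff_chi[OF True] fac_power_monic[of t "k - i"]
      by (simp add: lessThan_Suc_atMost[symmetric] add.commute)
    have c3: "(\<Sum>l<i. (-1) ^ l * E l * coeff (fac_power t (k - l)) (k - i)) \<in> Mult"
    proof (rule Mult_sum)
      fix l assume "l \<in> {..<i}"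
      then have "E l \<in> Mult" using less by auto
      moreover have "(-1) ^ l \<in> Mult" using Mult_power[OF Mult_of_int[of "-1"]] by simp
      ultimately show "(-1) ^ l * E l * coeff (fac_power t (k - l)) (k - i) \<in> Mult"
        using Mult_Lambda_q[OF coeff_fac_power_in_Lambda_q] by (intro Mult_mult)
    qed
    have "(-1) ^ i * E i \<in> Mult"
      using Mult_add[OF c1 Mult_minus[OF c3]] unfolding c2 by simp
    then show ?thesis
      using Mult_mult[OF Mult_power[OF Mult_of_int[of "-1"], of i], of "(-1) ^ i * E i"] by simp
  next
    case False
    then show ?thesis using E_in_I less.prems Mult_I by simp
  qed
qed

lemma G_in_Mult:
  "(\<And>i. i \<le> J \<Longrightarrow> gen i \<in> Mult) \<Longrightarrow> a + 1 - int k + int j \<le> J \<Longrightarrow> G j a \<in> Mult"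
proof (induction j arbitrary: a)
  case (Suc j)
  show ?case unfolding G_Suc
    using Suc by (intro Mult_add Mult_mult Mult_Lambda_q[OF t_in_Lambda_q] Suc.IH) auto
qed (simp add: G_0)

lemma G_minus_gen_in_Mult:
  "(\<And>i. i \<le> J \<Longrightarrow> gen i \<in> Mult) \<Longrightarrow> a - int k + int j \<le> J \<Longrightarrow>
    G j a - gen (a + 1 - int k + int j) \<in> Mult"
proof (induction j arbitrary: a)
  case 0
  then show ?case using Mult_of_int[of 0] by (simp add: G_0)
next
  case (Suc j)
  have "G (Suc j) a - gen (a + 1 - int k + int (Suc j))
      = (G j (a + 1) - gen (a + 1 + 1 - int k + int j)) + t (a + 1) * G j a"
    by (simp add: G_Suc algebra_simps)
  also have "\<dots> \<in> Mult"
    using Suc.prems by (intro Mult_add Mult_mult Mult_Lambda_q[OF t_in_Lambda_q] Suc.IH G_in_Mult[of J]) auto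
  finally show ?case .
qed

text \<open>\<open>E_recursion\<close> with the summand i = 0 isolated expresses a generator through
  lower ones and the E_i. For the j-th generator the indices stay at most j \<le> m - k < m, within
  the range of \<open>E_in_Mult\<close>.\<close>

lemma gen_in_Mult: "gen j \<in> Mult"
proof -
  have "gen (int j) \<in> Mult" for j
  proof (induction j rule: less_induct)
    case (less j)
    show ?case
    proof (cases "1 \<le> j \<and> j \<le> m - k")
      case False
      then have "gen (int j) = of_int (if j = 0 then 1 else 0)" by (auto simp: gen_def)
      then show ?thesis by (metis Mult_of_int)
    next
      case True
      define c where "c = j - 1"
      have j: "j = Suc c" using True by (simp add: c_def)
      have below: "gen i \<in> Mult" if "i \<le> int c" for i
      proof (cases "i < 0")
        case True
        then show ?thesis using Mult_of_int[of 0] by (simp add: gen_def)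
      next
        case False
        then show ?thesis using less[of "nat i"] that j by simp
      qed
      have "0 = G c (int k) + (\<Sum>i\<le>c. (-1) ^ Suc i * E (Suc i) * G c (int k - int (Suc i)))"
        using E_recursion[of c] by (subst (asm) sum.atMost_Suc_shift) simp
      then have "gen (int j) = - (G c (int k) - gen (int k + 1 - int k + int c))
          + - (\<Sum>i\<le>c. (-1) ^ Suc i * E (Suc i) * G c (int k - int (Suc i)))"
        by (simp add: j algebra_simps eq_neg_iff_add_eq_0)
      also have "\<dots> \<in> Mult"
      proof (intro Mult_add Mult_minus Mult_sum Mult_mult Mult_power)
        show "G c (int k) - gen (int k + 1 - int k + int c) \<in> Mult"
          by (rule G_minus_gen_in_Mult[of "int c"]) (auto intro: below)
        fix i assume i: "i \<in> {..c}"
        show "1 \<in> Mult" using Mult_of_int[of 1] by simp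
        show "E (Suc i) \<in> Mult" using i True j k_pos by (intro E_in_Mult) auto
        show "G c (int k - int (Suc i)) \<in> Mult"
          by (rule G_in_Mult[of "int c"]) (auto intro: below)
      qed
      finally show ?thesis .
    qed
  qed
  from this[of "nat j"] show ?thesis
    using Mult_of_int[of 0] by (cases "j < 0") (auto simp: gen_def)
qed

theorem spanning:
  assumes "f \<in> R"
  shows "\<exists>x. (\<forall>S\<in>Ks. x S \<in> Lambda_q m) \<and> f - (\<Sum>S\<in>Ks. x S * s S) \<in> I"
proof -
  have "f \<in> Mult" using assms
  proof (induction rule: polys_in_induct)
    case (mult x f)
    have "Var x \<in> Mult"
    proof (cases "x \<in> insert qVar (T_vars m)")
      case True
      then show ?thesis by (intro Mult_Lambda_q) (auto simp: Lambda_q_def)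
    next
      case False
      then obtain i where "i \<in> {1..m - k}" "x = gv i" using mult(1) by (auto simp: V_def)
      moreover from this have "gen (int i) = Var (gv i)" using k_less by (auto simp: gen_def)
      ultimately show ?thesis using gen_in_Mult[of "int i"] by simp
    qed
    then show ?case using mult Mult_mult by blast
  qed (auto intro: Mult_of_int Mult_add)
  then have "f * s {0..<k} \<in> Sp" using base_in_Ks by (simp add: Mult_def)
  then show ?thesis by (simp add: s_base Sp_def)
qed

end

lemma poly_fac_power_root:
  assumes "1 \<le> l" "l \<le> int n"
  shows "poly (fac_power t n) (t l) = 0"
proof -
  have "nat l \<in> {1..n}" using assms by auto
  then show ?thesis
    using assms by (auto simp: fac_power_def poly_prod intro!: prod_zero bexI[of _ "nat l"])
qed

context factorial_presentation
begin

subsection \<open>The commutant of multiplication by the divisor class\<close>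

definition chev0 :: "nat set \<Rightarrow> nat set \<Rightarrow> mpoly" where
  "chev0 S S' = (\<Sum>x\<in>moves S. if move S x = S' then 1 else 0)
    + (if S = S' then weight S - weight {0..<k} else 0)"

definition chev1 :: "nat set \<Rightarrow> nat set \<Rightarrow> mpoly" where
  "chev1 S S' = (if wraps S \<and> wrap S = S' then 1 else 0)"

lemma finite_moves: "S \<in> Ks \<Longrightarrow> finite (moves S)"
  using Ks_finite[of S] by (simp add: moves_def)

lemma move_inj:
  assumes "x \<in> moves S" "y \<in> moves S" "move S x = move S y"
  shows "x = y"
proof (rule ccontr)
  assume "x \<noteq> y"
  then have "x \<in> move S y" using assms by (auto simp: move_def moves_def)
  moreover have "x \<notin> move S x" by (simp add: move_def)
  ultimately show False using assms by simp
qed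

lemma sum_moves_indicator:
  assumes "S \<in> Ks"
  shows "(\<Sum>x\<in>moves S. if move S x = S' then 1 else 0 :: mpoly)
    = (if \<exists>x\<in>moves S. move S x = S' then 1 else 0)"
proof (cases "\<exists>x\<in>moves S. move S x = S'")
  case True
  then obtain x where x: "x \<in> moves S" "move S x = S'" by blast
  have "(\<Sum>y\<in>moves S. if move S y = S' then 1 else 0 :: mpoly) = (\<Sum>y\<in>moves S. if y = x then 1 else 0)"
  proof (rule sum.cong[OF refl])
    fix y assume "y \<in> moves S"
    then have "move S y = S' \<longleftrightarrow> y = x" using move_inj[of y S x] x by blast
    then show "(if move S y = S' then 1 else 0 :: mpoly) = (if y = x then 1 else 0)" by simp
  qed
  then show ?thesis using True x finite_moves[OF assms] by simp
next
  case False
  then show ?thesis by (auto intro!: sum.neutral)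
qed

lemma sum_chev0:
  assumes S: "S \<in> Ks"
  shows "(\<Sum>S'\<in>Ks. chev0 S S' * f S')
    = (\<Sum>x\<in>moves S. f (move S x)) + (weight S - weight {0..<k}) * f S"
proof -
  have "(\<Sum>S'\<in>Ks. chev0 S S' * f S') = (\<Sum>S'\<in>Ks. \<Sum>x\<in>moves S. if S' = move S x then f S' else 0)
      + (\<Sum>S'\<in>Ks. if S' = S then (weight S - weight {0..<k}) * f S' else 0)"
    unfolding sum.distrib[symmetric] chev0_def distrib_right sum_distrib_right
    by (intro sum.cong refl arg_cong2[where f = "(+)"]) auto
  also have "(\<Sum>S'\<in>Ks. \<Sum>x\<in>moves S. if S' = move S x then f S' else 0)
      = (\<Sum>x\<in>moves S. \<Sum>S'\<in>Ks. if S' = move S x then f S' else 0)"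
    by (rule sum.swap)
  also have "\<dots> = (\<Sum>x\<in>moves S. f (move S x))"
    using finite_Ks move_in_Ks[OF S] by (intro sum.cong) auto
  finally show ?thesis using finite_Ks S by simp
qed

lemma sum_chev1:
  assumes S: "S \<in> Ks"
  shows "(\<Sum>S'\<in>Ks. chev1 S S' * f S') = (if wraps S then f (wrap S) else 0)"
proof (cases "wraps S")
  case True
  then have "(\<Sum>S'\<in>Ks. chev1 S S' * f S') = (\<Sum>S'\<in>Ks. if S' = wrap S then f S' else 0)"
    by (intro sum.cong) (auto simp: chev1_def)
  then show ?thesis using True finite_Ks wrap_in_Ks[OF S] by simp
qed (simp add: chev1_def)

text \<open>The numerator of the bialternant formula for the factorial Schur polynomial at x = t_J,
  that is, the restriction to the fixed point J up to a factor depending on J alone. Working with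
  the numerator keeps the eigenvectors inside \<open>mpoly\<close>.\<close>

definition loc :: "nat set \<Rightarrow> nat set \<Rightarrow> mpoly" where
  "loc J S = row_det (\<lambda>a j. poly (fac_power t a) (t (int (dec_enum J j) + 1))) (dec_enum S)"

text \<open>Scaling column j by its node z_j multiplies the rows by x, and summing over rows gives
  the factor z_0 + ... + z_(k-1), the weight of J. Since (x|t)^m vanishes at the nodes, nothing
  wraps around.\<close>

lemma loc_eigen:
  assumes J: "J \<in> Ks" and S: "S \<in> Ks"
  shows "(\<Sum>S'\<in>Ks. chev0 S S' * loc J S') = (weight J - weight {0..<k}) * loc J S"
proof -
  define z where "z = (\<lambda>j. t (int (dec_enum J j) + 1))"
  define u where "u = (\<lambda>a j. poly (fac_power t a) (z j))"
  have loc: "loc J S = row_det u (dec_enum S)" for S by (simp add: loc_def u_def z_def)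
  have um: "u m j = 0 * u 0 j" if "j < k" for j
    using dec_enum_Ks(2)[OF J that] poly_fac_power_root[of "int (dec_enum J j) + 1" m t]
    by (simp add: u_def z_def)
  have step: "z j * u a j = u (Suc a) j + t (int a + 1) * u a j" for a j
    by (simp add: u_def fac_power_Suc algebra_simps)
  have "(\<Sum>j<k. z j) * row_det u (dec_enum S) = (\<Sum>r<k. det (mat k k (\<lambda>(i, j). if i = r
      then u (Suc (dec_enum S i)) j + t (int (dec_enum S i) + 1) * u (dec_enum S i) j
      else u (dec_enum S i) j)))"
    unfolding step[symmetric]
    by (rule sum_det_scale_row[symmetric, where A = "\<lambda>i j. u (dec_enum S i) j"])
  also have "\<dots> = (\<Sum>x\<in>moves S. row_det u (dec_enum (move S x))) + weight S * row_det u (dec_enum S)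
    + (if wraps S then (-1) ^ (k - 1) * 0 * row_det u (dec_enum (wrap S)) else 0)"
    by (rule sum_det_move[OF S um])
  also have "(\<Sum>j<k. z j) = weight J"
  proof -
    have "bij_betw (dec_enum J) {..<k} J"
      using dec_enum_inj[OF Ks_finite[OF J]] dec_enum_image[OF Ks_finite[OF J]] J
      by (simp add: bij_betw_def lessThan_atLeast0 Ks_def)
    then show ?thesis unfolding weight_def z_def by (rule sum.reindex_bij_betw)
  qed
  finally show ?thesis unfolding sum_chev0[OF S] loc by (simp add: algebra_simps)
qed

lemma loc_base:
  assumes J: "J \<in> Ks" shows "loc J {0..<k} \<noteq> 0"
proof -
  define z where "z = (\<lambda>j. t (int (dec_enum J j) + 1))"
  define u where "u = (\<lambda>a j. poly (fac_power t a) (z j))"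
  have inj: "inj_on z {0..<k}"
  proof (rule inj_onI)
    fix i j assume i: "i \<in> {0..<k}" and j: "j \<in> {0..<k}" and eq: "z i = z j"
    have "int (dec_enum J i) + 1 \<in> {1..int m}" "int (dec_enum J j) + 1 \<in> {1..int m}"
      using dec_enum_Ks(2)[OF J, of i] dec_enum_Ks(2)[OF J, of j] i j by auto
    then have "int (dec_enum J i) + 1 = int (dec_enum J j) + 1"
      using inj_onD[OF t_inj, of "int (dec_enum J i) + 1" "int (dec_enum J j) + 1"] eq
      unfolding z_def by blast
    moreover have "card J = k" using J by (simp add: Ks_def)
    ultimately show "i = j"
      using inj_onD[OF dec_enum_inj[OF Ks_finite[OF J]], of i j] i j by simp
  qed
  obtain e where e: "e \<in> {1, - 1 :: mpoly}" "row_det u id = e * row_det u (dec_enum (id ` {0..<k}))"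
    by (rule det_rows_dec_enum[of id k u]) auto
  have "row_det u id \<noteq> 0"
    unfolding u_def id_apply
    by (rule det_newton_vandermonde_nonzero) (use fac_power_monic[of t] inj in auto)
  then show ?thesis using e by (auto simp: loc_def u_def z_def)
qed

lemma weight_inj: "S \<in> Ks \<Longrightarrow> S' \<in> Ks \<Longrightarrow> weight S = weight S' \<Longrightarrow> S = S'"
  using t_sums unfolding Ks_def weight_def by blast

lemma sum_move:
  assumes "S \<in> Ks" "x \<in> moves S"
  shows "\<Sum>(move S x) = Suc (\<Sum>S)"
proof -
  have "finite S" "x \<in> S" "Suc x \<notin> S" using assms Ks_finite by (auto simp: moves_def)
  then show ?thesis
    by (simp add: move_def sum.remove[of S x])
qed

text \<open>A move raises the sum of the elements by one, so the eigenvector equation determines the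
  value at S from values at subsets of larger sum, unless S = J, where the weights coincide. The two
  alternatives express that an eigenvector is determined by its value at J, and that it is
  triangular.\<close>

lemma left_eigen_zero:
  fixes \<eta> :: "nat set \<Rightarrow> mpoly"
  assumes J: "J \<in> Ks"
    and eig: "\<And>S. S \<in> Ks \<Longrightarrow> (\<Sum>S'\<in>Ks. chev0 S S' * \<eta> S') = (weight J - weight {0..<k}) * \<eta> S"
    and S: "S \<in> Ks" and c: "\<eta> J = 0 \<or> \<Sum>J \<le> \<Sum>S \<and> S \<noteq> J"
  shows "\<eta> S = 0"
  using S c
proof (induction "m * m - \<Sum>S" arbitrary: S rule: less_induct)
  case less
  show ?case
  proof (cases "S = J")
    case True
    then show ?thesis using less.prems by simp
  next
    case False
    have "\<eta> (move S x) = 0" if x: "x \<in> moves S" for x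
    proof (rule less.hyps)
      have "\<Sum>(move S x) \<le> (\<Sum>y\<in>move S x. m)"
        using move_in_Ks[OF less.prems(1) x] by (intro sum_mono) (auto simp: Ks_def)
      also have "\<dots> \<le> m * m"
        using move_in_Ks[OF less.prems(1) x] k_less by (simp add: Ks_def)
      finally show "m * m - \<Sum>(move S x) < m * m - \<Sum>S"
        using sum_move[OF less.prems(1) x] by linarith
      show "move S x \<in> Ks" by (rule move_in_Ks[OF less.prems(1) x])
      show "\<eta> J = 0 \<or> \<Sum>J \<le> \<Sum>(move S x) \<and> move S x \<noteq> J"
        using less.prems(2) sum_move[OF less.prems(1) x] by auto
    qed
    then have "(weight S - weight {0..<k}) * \<eta> S = (weight J - weight {0..<k}) * \<eta> S"
      using eig[OF less.prems(1)] sum_chev0[OF less.prems(1), of \<eta>] by simp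
    then have "(weight S - weight J) * \<eta> S = 0" by (simp add: algebra_simps)
    then show ?thesis using weight_inj[OF less.prems(1) J] False by auto
  qed
qed

lemma loc_diag: assumes J: "J \<in> Ks" shows "loc J J \<noteq> 0"
  using left_eigen_zero[OF J loc_eigen[OF J] base_in_Ks] loc_base[OF J] by blast

text \<open>Z maps the eigenvector \<open>loc J\<close> to an eigenvector of the same weight, hence
  to a multiple of \<open>loc J\<close> over the fraction field. At the base subset the image is 0
  and \<open>loc J\<close> is not, so the multiple is 0. As the \<open>loc J\<close> are triangular
  with nonzero diagonal, Z vanishes.\<close>

lemma classical_commutant:
  fixes Z :: "nat set \<Rightarrow> nat set \<Rightarrow> mpoly"
  assumes comm: "\<And>S S'. S \<in> Ks \<Longrightarrow> S' \<in> Ks \<Longrightarrow>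
      (\<Sum>U\<in>Ks. chev0 S U * Z U S') = (\<Sum>U\<in>Ks. Z S U * chev0 U S')"
    and base: "\<And>S'. S' \<in> Ks \<Longrightarrow> Z {0..<k} S' = 0"
    and S: "S \<in> Ks" and S': "S' \<in> Ks"
  shows "Z S S' = 0"
proof -
  have zero: "(\<Sum>U\<in>Ks. Z S U * loc J U) = 0" if J: "J \<in> Ks" and S: "S \<in> Ks" for J S
  proof -
    define \<eta> where "\<eta> = (\<lambda>S. \<Sum>U\<in>Ks. Z S U * loc J U)"
    let ?w = "weight J - weight {0..<k}"
    have eig: "(\<Sum>S'\<in>Ks. chev0 S S' * \<eta> S') = ?w * \<eta> S" if S: "S \<in> Ks" for S
    proof -
      have "(\<Sum>S'\<in>Ks. chev0 S S' * \<eta> S') = (\<Sum>U\<in>Ks. (\<Sum>S'\<in>Ks. chev0 S S' * Z S' U) * loc J U)"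
        unfolding \<eta>_def sum_distrib_left sum_distrib_right
        by (subst sum.swap) (simp add: mult.assoc)
      also have "\<dots> = (\<Sum>U\<in>Ks. (\<Sum>S'\<in>Ks. Z S S' * chev0 S' U) * loc J U)"
        by (intro sum.cong refl arg_cong2[where f = "(*)"] comm[OF S])
      also have "\<dots> = (\<Sum>S'\<in>Ks. Z S S' * (\<Sum>U\<in>Ks. chev0 S' U * loc J U))"
        unfolding sum_distrib_left sum_distrib_right by (subst sum.swap) (simp add: mult.assoc)
      also have "\<dots> = (\<Sum>S'\<in>Ks. Z S S' * (?w * loc J S'))"
        by (intro sum.cong refl arg_cong2[where f = "(*)"] loc_eigen[OF J])
      finally show ?thesis by (simp add: \<eta>_def sum_distrib_left mult_ac)
    qed
    \<comment> \<open>The cross-multiplied form of "\<eta> is a multiple of \<open>loc J\<close>":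
      it vanishes at J by construction and therefore everywhere, without division by
      \<open>loc J J\<close>.\<close>
    define \<theta> where "\<theta> = (\<lambda>S. loc J J * \<eta> S - \<eta> J * loc J S)"
    have "(\<Sum>S'\<in>Ks. chev0 S S' * \<theta> S') = ?w * \<theta> S" if S: "S \<in> Ks" for S
    proof -
      have "(\<Sum>S'\<in>Ks. chev0 S S' * \<theta> S') = loc J J * (\<Sum>S'\<in>Ks. chev0 S S' * \<eta> S')
          - \<eta> J * (\<Sum>S'\<in>Ks. chev0 S S' * loc J S')"
        unfolding \<theta>_def sum_distrib_left sum_subtractf[symmetric]
        by (intro sum.cong refl) (simp add: algebra_simps)
      then show ?thesis unfolding eig[OF S] loc_eigen[OF J S] by (simp add: \<theta>_def algebra_simps)
    qed
    then have "\<theta> {0..<k} = 0"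
      by (rule left_eigen_zero[OF J _ base_in_Ks]) (auto simp: \<theta>_def)
    moreover have "\<eta> {0..<k} = 0" unfolding \<eta>_def using base by simp
    ultimately have "\<eta> J = 0" using loc_base[OF J] by (simp add: \<theta>_def)
    then show ?thesis using left_eigen_zero[OF J eig S] unfolding \<eta>_def by simp
  qed
  show ?thesis
  proof (rule ccontr)
    assume "Z S S' \<noteq> 0"
    define A where "A = {U \<in> Ks. Z S U \<noteq> 0}"
    have A: "finite A" "A \<noteq> {}" using finite_Ks S' \<open>Z S S' \<noteq> 0\<close> by (auto simp: A_def)
    \<comment> \<open>Minimality and triangularity kill \<open>loc J U\<close> for every other U in
      the support of row S, so the sum reduces to the single term at J.\<close>
    define J where "J = arg_min_on (\<lambda>U. \<Sum>U) A"
    have J: "J \<in> Ks" "Z S J \<noteq> 0" using arg_min_if_finite(1)[OF A] by (auto simp: J_def A_def)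
    have min: "\<Sum>J \<le> \<Sum>U" if "U \<in> A" for U
      using arg_min_if_finite(2)[OF A, of "\<lambda>U. \<Sum>U"] that unfolding J_def by (auto simp: not_less)
    have "(\<Sum>U\<in>Ks. Z S U * loc J U) = (\<Sum>U\<in>Ks. if U = J then Z S J * loc J J else 0)"
    proof (rule sum.cong[OF refl])
      fix U assume U: "U \<in> Ks"
      show "Z S U * loc J U = (if U = J then Z S J * loc J J else 0)"
        using left_eigen_zero[OF J(1) loc_eigen[OF J(1)] U] min[of U] U by (auto simp: A_def)
    qed
    also have "\<dots> = Z S J * loc J J" using finite_Ks J by simp
    finally show False using zero[OF J(1) S] J loc_diag[OF J(1)] by simp
  qed
qed

text \<open>Reads an element as a polynomial in q whose coefficients remain in \<open>mpoly\<close>;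
  evaluation at \<open>qq\<close> gives the element back.\<close>

definition q_expand :: "mpoly \<Rightarrow> mpoly poly" where
  "q_expand = eval_mpoly (\<lambda>x. if x = qVar then [:0, 1:] else [:Var x:])"

lemma poly_q_expand: "poly (q_expand f) qq = f"
proof -
  have "f \<in> polys_in UNIV" by (simp add: polys_in_def)
  then show ?thesis
    by (induction rule: polys_in_induct)
      (auto simp: q_expand_def eval_mpoly_add eval_mpoly_mult eval_mpoly.hom_of_int)
qed

lemma q_expand_const: "f \<in> Lambda m \<Longrightarrow> q_expand f = [:f:]"
  unfolding Lambda_def
proof (induction rule: polys_in_induct)
  case (const n)
  show ?case by (simp add: q_expand_def eval_mpoly.hom_of_int of_int_poly)
next
  case (mult x f)
  then have "x \<noteq> qVar" by (auto simp: T_vars_def)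
  then show ?case using mult by (simp add: q_expand_def eval_mpoly_mult)
qed (simp add: q_expand_def eval_mpoly_add)

lemma chev0_in_Lambda: "chev0 S S' \<in> Lambda m"
  unfolding chev0_def weight_def Lambda_def
  by (intro polys_in_add polys_in_sum) (auto intro!: polys_in_diff polys_in_sum t_in[unfolded Lambda_def])

text \<open>In degree n in q, the relation involves only the coefficients n and n - 1 of Z. The
  latter vanish by induction, and what remains is the classical relation for the former.\<close>

theorem commutant_zero:
  fixes Z :: "nat set \<Rightarrow> nat set \<Rightarrow> mpoly"
  assumes comm: "\<And>S S'. S \<in> Ks \<Longrightarrow> S' \<in> Ks \<Longrightarrow>
      (\<Sum>U\<in>Ks. (chev0 S U + qq * chev1 S U) * Z U S') = (\<Sum>U\<in>Ks. Z S U * (chev0 U S' + qq * chev1 U S'))"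
    and base: "\<And>S'. S' \<in> Ks \<Longrightarrow> Z {0..<k} S' = 0"
    and S: "S \<in> Ks" and S': "S' \<in> Ks"
  shows "Z S S' = 0"
proof -
  define c where "c = (\<lambda>n S S'. coeff (q_expand (Z S S')) n)"
  interpret qe: comm_ring_hom q_expand unfolding q_expand_def by (rule eval_mpoly.comm_ring_hom_axioms)
  have q1: "q_expand (chev0 U W + qq * chev1 U W) = [:chev0 U W, chev1 U W:]" for U W
  proof -
    have "q_expand (chev1 U W) = [:chev1 U W:]"
      by (auto simp: chev1_def one_pCons)
    moreover have "q_expand qq = [:0, 1:]" by (simp add: q_expand_def)
    ultimately show ?thesis by (simp add: qe.hom_add qe.hom_mult q_expand_const[OF chev0_in_Lambda])
  qed
  have cs: "coeff ([:a, b:] * F) n = a * coeff F n + b * (if n = 0 then 0 else coeff F (n - 1))"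
    for a b :: mpoly and F n by (cases n) auto
  have main: "\<forall>S\<in>Ks. \<forall>S'\<in>Ks. c n S S' = 0" for n
  proof (induction n rule: less_induct)
    case (less n)
    let ?d = "\<lambda>S S'. if n = 0 then 0 else c (n - 1) S S'"
    have d: "?d U W = 0" if "U \<in> Ks" "W \<in> Ks" for U W using less[of "n - 1"] that by auto
    have "(\<Sum>U\<in>Ks. chev0 S U * c n U S') = (\<Sum>U\<in>Ks. c n S U * chev0 U S')"
      if S: "S \<in> Ks" and S': "S' \<in> Ks" for S S'
    proof -
      have "coeff (q_expand (\<Sum>U\<in>Ks. (chev0 S U + qq * chev1 S U) * Z U S')) n
          = (\<Sum>U\<in>Ks. chev0 S U * c n U S' + chev1 S U * ?d U S')"
        unfolding qe.hom_sum qe.hom_mult q1 coeff_sum cs c_def by (intro sum.cong) auto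
      moreover have "coeff (q_expand (\<Sum>U\<in>Ks. Z S U * (chev0 U S' + qq * chev1 U S'))) n
          = (\<Sum>U\<in>Ks. c n S U * chev0 U S' + chev1 U S' * ?d S U)"
        unfolding qe.hom_sum qe.hom_mult q1 coeff_sum mult.commute[of _ "[:_, _:]"] cs c_def
        by (intro sum.cong) (auto simp: mult.commute)
      ultimately show ?thesis using comm[OF S S'] d S S' by (simp cong: sum.cong)
    qed
    moreover have "c n {0..<k} S' = 0" if "S' \<in> Ks" for S' using base[OF that] by (simp add: c_def)
    ultimately show ?case using classical_commutant[of "c n"] by blast
  qed
  have "q_expand (Z S S') = 0" using main S S' by (intro poly_eqI) (simp add: c_def)
  then show ?thesis using poly_q_expand[of "Z S S'"] by simp
qed

end

section \<open>Residue functionals, Newton expansions and kernels of evaluations\<close>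

lemma lagrange_weights:
  fixes J :: "'a::field set"
  assumes "finite J" "J \<noteq> {}"
  shows "\<exists>w. \<forall>F. degree F < card J \<longrightarrow> (\<Sum>\<xi>\<in>J. w \<xi> * poly F \<xi>) = coeff F (card J - 1)"
  using assms
proof (induction J rule: finite_ne_induct)
  case (singleton x)
  have "poly F x = coeff F 0" if "degree F = 0" for F :: "'a poly"
    using that by (auto elim: degree_eq_zeroE)
  then show ?case by (intro exI[of _ "\<lambda>_. 1"]) auto
next
  case (insert z J)
  define n where "n = card J"
  have n: "n > 0" using insert by (simp add: n_def card_gt_0_iff)
  obtain w where w: "\<And>F. degree F < n \<Longrightarrow> (\<Sum>\<xi>\<in>J. w \<xi> * poly F \<xi>) = coeff F (n - 1)"
    using insert unfolding n_def by blast
  \<comment> \<open>Adjoining the node z divides the old weights by \<xi> - z, and the weight at z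
    is chosen to make constants sum to 0. Hence F may be replaced by F - F(z) = (x - z) H, and the
    case of H applies.\<close>
  define w' where "w' = (\<lambda>\<xi>. if \<xi> = z then - (\<Sum>\<xi>\<in>J. w \<xi> / (\<xi> - z)) else w \<xi> / (\<xi> - z))"
  have "(\<Sum>\<xi>\<in>insert z J. w' \<xi> * poly F \<xi>) = coeff F n" if deg: "degree F < Suc n" for F
  proof -
    let ?H = "synthetic_div F z"
    have F: "F = [:- z, 1:] * ?H + [:poly F z:]" by (rule synthetic_div_correct'[symmetric])
    have degH: "degree ?H < n" using deg n by (simp add: degree_synthetic_div)
    have "(\<Sum>\<xi>\<in>insert z J. w' \<xi> * poly F \<xi>)
        = w' z * poly F z + (\<Sum>\<xi>\<in>J. w' \<xi> * poly F \<xi>)"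
      using insert by simp
    also have "(\<Sum>\<xi>\<in>J. w' \<xi> * poly F \<xi>) = (\<Sum>\<xi>\<in>J. w \<xi> / (\<xi> - z) * poly F \<xi>)"
      using insert by (intro sum.cong) (auto simp: w'_def)
    also have "w' z * poly F z + \<dots> = (\<Sum>\<xi>\<in>J. w \<xi> / (\<xi> - z) * (poly F \<xi> - poly F z))"
      by (simp add: w'_def sum_distrib_right right_diff_distrib sum_subtractf)
    also have "\<dots> = (\<Sum>\<xi>\<in>J. w \<xi> * poly ?H \<xi>)"
    proof (rule sum.cong[OF refl])
      fix \<xi> assume "\<xi> \<in> J"
      then have ne: "\<xi> - z \<noteq> 0" using insert by auto
      have "poly F \<xi> - poly F z = (\<xi> - z) * poly ?H \<xi>"
        by (subst (1) F) (simp add: algebra_simps)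
      then show "w \<xi> / (\<xi> - z) * (poly F \<xi> - poly F z) = w \<xi> * poly ?H \<xi>" using ne by simp
    qed
    also have "\<dots> = coeff ?H (n - 1)" using w degH by simp
    also have "\<dots> = coeff F n"
      using n degH by (subst (2) F, cases n) (auto simp: coeff_eq_0)
    finally show ?thesis .
  qed
  then show ?case using insert by (intro exI[of _ w']) (auto simp: n_def)
qed

lemma fac_power_expansion:
  fixes F :: "'a::comm_ring_1 poly"
  assumes "degree F \<le> n"
  shows "\<exists>c. F = (\<Sum>i\<le>n. smult (c i) (fac_power \<tau> i)) \<and> c n = coeff F n"
  using assms
proof (induction n arbitrary: F)
  case 0
  then obtain a where "F = [:a:]" by (auto elim: degree_eq_zeroE)
  then show ?case by (intro exI[of _ "\<lambda>_. a"]) (simp add: one_pCons)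
next
  case (Suc n)
  let ?H = "F - smult (coeff F (Suc n)) (fac_power \<tau> (Suc n))"
  have "degree ?H \<le> Suc n"
    using Suc.prems fac_power_monic[of \<tau> "Suc n"]
    by (intro degree_diff_le) (auto intro: order.trans[OF degree_smult_le])
  moreover have "coeff ?H (Suc n) = 0" using fac_power_monic[of \<tau> "Suc n"] by simp
  ultimately have "degree ?H \<le> n"
    by (intro degree_le allI impI) (metis Suc_lessI coeff_eq_0 le_less_trans)
  then obtain c where c: "?H = (\<Sum>i\<le>n. smult (c i) (fac_power \<tau> i))" using Suc.IH by blast
  have "F = (\<Sum>i\<le>n. smult (c i) (fac_power \<tau> i)) + smult (coeff F (Suc n)) (fac_power \<tau> (Suc n))"
    unfolding c[symmetric] by simp
  also have "\<dots> = (\<Sum>i\<le>Suc n. smult ((c(Suc n := coeff F (Suc n))) i) (fac_power \<tau> i))" by simp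
  finally show ?case by (intro exI[of _ "c(Suc n := coeff F (Suc n))"]) simp
qed

lemma det_mat_transpose:
  fixes f :: "nat \<Rightarrow> nat \<Rightarrow> 'a::comm_ring_1"
  shows "det (mat n n (\<lambda>(i, j). f j i)) = det (mat n n (\<lambda>(i, j). f i j))"
proof -
  have "mat n n (\<lambda>(i, j). f j i) = transpose_mat (mat n n (\<lambda>(i, j). f i j))" by (intro eq_matI) auto
  then show ?thesis by (simp add: det_transpose[of _ n])
qed

lemma ideal_eval_kernel: "ideal {f \<in> polys_in W. eval_mpoly v f = 0} (Defs.poly_ring W)"
proof -
  interpret cring "Defs.poly_ring W" by (rule cring_poly_ring)
  have inv: "inv\<^bsub>add_monoid (Defs.poly_ring W)\<^esub> x = - x" if "x \<in> polys_in W" for x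
    using that minus_equality[of "- x" x] by (auto simp: a_inv_def)
  show ?thesis
  proof (rule idealI)
    show "ring (Defs.poly_ring W)" by (rule ring_axioms)
    show "subgroup {f \<in> polys_in W. eval_mpoly v f = 0} (add_monoid (Defs.poly_ring W))"
    proof (rule subgroup.intro)
      fix x assume x: "x \<in> {f \<in> polys_in W. eval_mpoly v f = 0}"
      then have "inv\<^bsub>add_monoid (Defs.poly_ring W)\<^esub> x = - x" by (intro inv) simp
      then show "inv\<^bsub>add_monoid (Defs.poly_ring W)\<^esub> x \<in> {f \<in> polys_in W. eval_mpoly v f = 0}"
        using x by (auto simp: eval_mpoly.hom_uminus)
    qed (auto simp: eval_mpoly_add)
  qed (auto simp: eval_mpoly_mult)
qed

context factorial_presentation
begin

subsection \<open>Points of the presentation\<close>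

lemma gen_Var: "1 \<le> j \<Longrightarrow> j \<le> m - k \<Longrightarrow> gen (int j) = Var (gv j)"
  using k_less by (auto simp: gen_def)

lemma eval_I_zero:
  assumes "\<And>c. k < c \<Longrightarrow> c < m \<Longrightarrow> eval_mpoly v (E c) = 0"
    and "eval_mpoly v (E m + (-1) ^ (m - k) * qq) = 0" and "f \<in> I"
  shows "eval_mpoly v f = 0"
proof -
  interpret cring "Defs.poly_ring V" by (rule cring_poly_ring)
  have "I \<subseteq> {f \<in> polys_in V. eval_mpoly v f = 0}"
    unfolding I_def
  proof (rule genideal_minimal[OF ideal_eval_kernel])
    show "E ` {k + 1..m - 1} \<union> {E m + (-1) ^ (m - k) * qq} \<subseteq> {f \<in> polys_in V. eval_mpoly v f = 0}"
      using generators_subset assms(1,2) by auto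
  qed
  then show ?thesis using assms(3) by blast
qed

text \<open>The k chosen roots define the residue functional L, and the j-th generator is sent to
  L((x|\<tau>)^(j+k-1)). The signed E_i with i \<le> k then become the coefficients of \<Prod> (x -
  \<xi>_l) in shifted powers, so the relations hold. Since L is a weighted sum over the roots, s
  becomes the determinant of a product of two k by k matrices, and the second factor is the same for
  all subsets.\<close>

lemma exists_point:
  fixes v0 :: "indet \<Rightarrow> 'a::field"
  defines "\<tau> \<equiv> \<lambda>i. eval_mpoly v0 (t i)"
  assumes inj: "inj_on \<xi> {0..<k}"
    and root: "\<And>i. i < k \<Longrightarrow> poly (fac_power \<tau> m) (\<xi> i) = - ((-1) ^ k * v0 qVar)"
  obtains v C where "\<And>f. f \<in> Lambda_q m \<Longrightarrow> eval_mpoly v f = eval_mpoly v0 f"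
    and "\<And>f. f \<in> I \<Longrightarrow> eval_mpoly v f = 0" and "C \<noteq> 0"
    and "\<And>S. S \<in> Ks \<Longrightarrow>
      eval_mpoly v (s S) = C * det (mat k k (\<lambda>(i, j). poly (fac_power \<tau> (dec_enum S i)) (\<xi> j)))"
proof -
  define \<kappa> where "\<kappa> = - ((-1) ^ k * v0 qVar)"
  obtain w0 where w0: "\<And>F. degree F < k \<Longrightarrow> (\<Sum>z\<in>\<xi> ` {0..<k}. w0 z * poly F z) = coeff F (k - 1)"
    using lagrange_weights[of "\<xi> ` {0..<k}"] k_pos inj by (auto simp: card_image)
  define w where "w = (\<lambda>l. w0 (\<xi> l))"
  define L where "L = (\<lambda>F. \<Sum>l = 0..<k. w l * poly F (\<xi> l))"
  have L_coeff: "L F = coeff F (k - 1)" if "degree F < k" for F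
    unfolding L_def w_def using w0[OF that] sum.reindex[OF inj, of "\<lambda>z. w0 z * poly F z"] by simp
  have L_low: "L F = 0" if "degree F < k - 1" for F
    using that by (subst L_coeff) (auto simp: coeff_eq_0)
  have L_add: "L (F + H) = L F + L H" for F H
    by (simp add: L_def distrib_left sum.distrib)
  have L_smult: "L (smult a F) = a * L F" for a F
    by (simp add: L_def sum_distrib_left mult_ac)
  have L_sum: "L (sum F A) = (\<Sum>x\<in>A. L (F x))" for F :: "nat \<Rightarrow> 'a poly" and A
    unfolding L_def poly_sum sum_distrib_left by (rule sum.swap)
  have L_m: "L (fac_power \<tau> m * F) = \<kappa> * L F" for F
    unfolding L_def sum_distrib_left by (intro sum.cong) (auto simp: root \<kappa>_def)
  define v where "v = (\<lambda>x. if x \<in> gv ` {1..m - k} then L (fac_power \<tau> (inv_into UNIV gv x + k - 1)) else v0 x)"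
  have v_gv: "v (gv j) = L (fac_power \<tau> (j + k - 1))" if "1 \<le> j" "j \<le> m - k" for j
    using that gv_inj by (simp add: v_def inv_f_f)
  have v_eq: "eval_mpoly v f = eval_mpoly v0 f" if "f \<in> Lambda_q m" for f
    using that unfolding Lambda_q_def
    by (rule eval_mpoly_cong) (use gv_fresh in \<open>auto simp: v_def\<close>)
  have \<tau>_eq: "eval_mpoly v (t i) = \<tau> i" for i
    using v_eq[OF t_in_Lambda_q] by (simp add: \<tau>_def)
  have \<tau>_out: "\<tau> i = 0" if "i > int m" for i using t_out[of i] that by (simp add: \<tau>_def)
  \<comment> \<open>Beyond m the parameters vanish, so the higher shifted powers are (x|\<tau>)^m
    times ordinary powers.\<close>
  have fac_high: "fac_power \<tau> (m + n) = fac_power \<tau> m * monom 1 n" for n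
  proof (induction n)
    case (Suc n)
    have "\<tau> (int (m + n) + 1) = 0" by (rule \<tau>_out) simp
    then have "fac_power \<tau> (m + Suc n) = [:0, 1:] * fac_power \<tau> (m + n)"
      using fac_power_Suc[of \<tau> "m + n"] by simp
    also have "\<dots> = fac_power \<tau> m * ([:0, 1:] * monom 1 n)" unfolding Suc by (rule mult.left_commute)
    also have "[:0, 1:] * monom 1 n = (monom 1 (Suc n) :: 'a poly)" by (simp add: monom_Suc)
    finally show ?case .
  qed simp
  have deg_mon: "degree (fac_power \<tau> a * monom 1 j) \<le> a + j" for a j
    using degree_mult_le[of "fac_power \<tau> a" "monom 1 j"] fac_power_monic[of \<tau> a] degree_monom_le[of "1::'a" j]
    by linarith
  have coeff_mon: "coeff (fac_power \<tau> a * monom 1 j) (a + j) = 1" for a j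
    using fac_power_monic[of \<tau> a] coeff_monom_mult[of 1 j "fac_power \<tau> a" "a + j"]
    by (simp add: mult.commute)
  have L_one: "L (fac_power \<tau> a * monom 1 j) = 1" if "a + j = k - 1" for a j
    using deg_mon[of a j] coeff_mon[of a j] that k_pos by (subst L_coeff) auto
  have L_zero: "L (fac_power \<tau> a * monom 1 j) = 0" if "a + j < k - 1" for a j
    using deg_mon[of a j] that by (intro L_low) simp
  \<comment> \<open>In this range the two sides differ at one place: G is 0 for bases from m on,
    whereas L((x|\<tau>)^m x^(k-1)) = \<kappa>. This defect produces the value of
    \<open>E m\<close>.\<close>
  have eG: "eval_mpoly v (G j (int a)) = L (fac_power \<tau> a * monom 1 j)
      - (if a + j = m + k - 1 then \<kappa> else 0)" if "a + j \<le> m + k - 1" for a j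
    using that
  proof (induction j arbitrary: a)
    case 0
    consider "a < k - 1" | "a = k - 1" | "k \<le> a" "a < m" | "m \<le> a" by linarith
    then show ?case
    proof cases
      case 1
      then have "L (fac_power \<tau> a * monom 1 0) = 0" using L_zero[of a 0] by simp
      then show ?thesis using 1 k_less by (simp add: G_low)
    next
      case 2
      then have "L (fac_power \<tau> a * monom 1 0) = 1" using L_one[of a 0] by simp
      moreover have "G 0 (int a) = 1" using 2 k_pos by (intro G_one) auto
      ultimately show ?thesis using 2 k_less k_pos by simp
    next
      case 3
      let ?j = "a + 1 - k"
      have j: "1 \<le> ?j" "?j \<le> m - k" using 3 by auto
      have "int a + 1 - int k = int ?j" using 3 by simp
      then have "G 0 (int a) = gen (int ?j)" by (simp only: G_0)
      also have "\<dots> = Var (gv ?j)" by (rule gen_Var[OF j])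
      finally have "eval_mpoly v (G 0 (int a)) = L (fac_power \<tau> (?j + k - 1))"
        using v_gv[OF j] by simp
      then show ?thesis using 3 k_pos by simp
    next
      case 4
      define n where "n = a - m"
      have a: "a = m + n" "n \<le> k - 1" using 4 0 by (auto simp: n_def)
      have "L (fac_power \<tau> a * monom 1 0) = \<kappa> * L (monom 1 n)"
        using L_m[of "monom 1 n"] by (simp add: a fac_high)
      also have "L (monom 1 n) = (if n = k - 1 then 1 else 0)"
        using L_one[of 0 n] L_zero[of 0 n] a by auto
      finally have "L (fac_power \<tau> a * monom 1 0) = (if n = k - 1 then \<kappa> else 0)" by simp
      moreover have "a + 0 = m + k - 1 \<longleftrightarrow> n = k - 1" using a k_pos by linarith
      moreover have "G 0 (int a) = 0" using 4 by (intro G_high) simp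
      ultimately show ?thesis by simp
    qed
  next
    case (Suc j)
    have "fac_power \<tau> a * monom 1 (Suc j) = fac_power \<tau> (Suc a) * monom 1 j
        + smult (\<tau> (int a + 1)) (fac_power \<tau> a * monom 1 j)"
    proof -
      have "(monom 1 (Suc j) :: 'a poly) = [:- \<tau> (int a + 1), 1:] * monom 1 j + smult (\<tau> (int a + 1)) (monom 1 j)"
        by (simp add: monom_Suc)
      then show ?thesis unfolding fac_power_Suc by (simp only: distrib_left mult_smult_right ac_simps)
    qed
    then have "L (fac_power \<tau> a * monom 1 (Suc j)) = L (fac_power \<tau> (Suc a) * monom 1 j)
        + \<tau> (int a + 1) * L (fac_power \<tau> a * monom 1 j)"
      by (simp only: L_add L_smult)
    then show ?case
      using Suc.IH[of "Suc a"] Suc.IH[of a] Suc.prems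
      by (simp add: G_Suc eval_mpoly_add eval_mpoly_mult \<tau>_eq add.commute)
  qed
  define \<chi> where "\<chi> = (\<Prod>l = 0..<k. [:- \<xi> l, 1:])"
  have deg\<chi>: "degree \<chi> = k" unfolding \<chi>_def by (simp add: degree_prod_sum_eq)
  have "coeff \<chi> (degree \<chi>) = 1" unfolding \<chi>_def by (subst lead_coeff_prod) simp
  then have lead: "coeff \<chi> k = 1" by (simp add: deg\<chi>)
  have L\<chi>: "L (\<chi> * F) = 0" for F
    unfolding L_def \<chi>_def by (intro sum.neutral) (auto simp: poly_prod)
  obtain c where c: "\<chi> = (\<Sum>i\<le>k. smult (c i) (fac_power \<tau> i))" "c k = 1"
    using fac_power_expansion[of \<chi> k \<tau>] deg\<chi> lead by auto
  let ?x = "\<lambda>i. (-1) ^ i * eval_mpoly v (E i)"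
  \<comment> \<open>\<open>E_recursion\<close> and L(\<chi> x^b) = 0 are triangular recursions with
    the same coefficients up to the defect of \<open>eG\<close>, which enters only for n = m.
    Comparing them determines the values one after the other.\<close>
  have xval: "?x n = (if n \<le> k then c (k - n) else if n = m then \<kappa> else 0)" if "n \<le> m" for n
    using that
  proof (induction n rule: less_induct)
    case (less n)
    show ?case
    proof (cases n)
      case 0
      then show ?thesis using c(2) by simp
    next
      case (Suc b)
      let ?f = "\<lambda>i. c (k - i) * L (fac_power \<tau> (k - i) * monom 1 b)"
      have "(\<Sum>i\<le>k. ?f i) = L (\<chi> * monom 1 b)"
      proof -
        have "(\<Sum>i\<le>k. ?f i) = (\<Sum>i\<le>k. c i * L (fac_power \<tau> i * monom 1 b))"
          by (rule sum.reindex_bij_witness[of _ "\<lambda>i. k - i" "\<lambda>i. k - i"]) auto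
        then show ?thesis unfolding c(1) sum_distrib_right L_sum by (simp add: L_smult)
      qed
      then have full: "(\<Sum>i\<le>k. ?f i) = 0" by (simp add: L\<chi>)
      have term_eq: "?x i * eval_mpoly v (G b (int k - int i))
          = (if i \<le> k then ?f i else 0) - (if i = 0 \<and> n = m then \<kappa> else 0)" if "i \<le> b" for i
      proof (cases "i \<le> k")
        case True
        have x: "?x i = c (k - i)" using less.IH[of i] less.prems that Suc True by simp
        have e: "int k - int i = int (k - i)" using True by simp
        have le: "k - i + b \<le> m + k - 1" using less.prems Suc by linarith
        have iff: "k - i + b = m + k - 1 \<longleftrightarrow> i = 0 \<and> n = m"
          using less.prems Suc True k_pos by auto
        show ?thesis unfolding x e eG[OF le] iff using True c(2) by (auto simp: right_diff_distrib)
      next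
        case False
        then have "?x i = 0" using less.IH[of i] less.prems that Suc by simp
        then show ?thesis using False by simp
      qed
      have "0 = eval_mpoly v (\<Sum>i\<le>Suc b. (-1) ^ i * E i * G b (int k - int i))"
        by (simp only: E_recursion eval_mpoly_0)
      also have "\<dots> = (\<Sum>i\<le>Suc b. ?x i * eval_mpoly v (G b (int k - int i)))"
        by (simp add: eval_mpoly_sum eval_mpoly_mult eval_mpoly.hom_power eval_mpoly.hom_uminus
            eval_mpoly_add)
      also have "\<dots> = (\<Sum>i\<le>b. ?x i * eval_mpoly v (G b (int k - int i))) + ?x n"
        using Suc by (simp add: G_one)
      also have "(\<Sum>i\<le>b. ?x i * eval_mpoly v (G b (int k - int i)))
          = (\<Sum>i\<le>b. if i \<le> k then ?f i else 0) - (\<Sum>i\<le>b. if i = 0 \<and> n = m then \<kappa> else 0)"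
        unfolding sum_subtractf[symmetric] by (intro sum.cong refl term_eq) auto
      also have "(\<Sum>i\<le>b. if i = 0 \<and> n = m then \<kappa> else 0) = (if n = m then \<kappa> else 0)"
        by (cases "n = m") auto
      also have "(\<Sum>i\<le>b. if i \<le> k then ?f i else 0) = (if n \<le> k then - c (k - n) else 0)"
      proof (cases "n \<le> k")
        case True
        have "0 = sum ?f {..b} + sum ?f {n..k}"
        proof -
          have "{..k} = {..b} \<union> {n..k}" using True Suc by auto
          then show ?thesis using full sum.union_disjoint[of "{..b}" "{n..k}" ?f] Suc by simp
        qed
        also have "sum ?f {n..k} = (\<Sum>i\<in>{n..k}. if i = n then c (k - n) else 0)"
        proof (rule sum.cong[OF refl])
          fix i assume i: "i \<in> {n..k}"
          show "?f i = (if i = n then c (k - n) else 0)"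
          proof (cases "i = n")
            case True
            then have "k - i + b = k - 1" using i Suc by auto
            then show ?thesis using L_one[of "k - i" b] True by simp
          next
            case False
            then have "k - i + b < k - 1" using i Suc by auto
            then show ?thesis using L_zero[of "k - i" b] False by simp
          qed
        qed
        also have "\<dots> = c (k - n)" using True by simp
        finally have "sum ?f {..b} = - c (k - n)" by (simp add: eq_neg_iff_add_eq_0)
        moreover have "(\<Sum>i\<le>b. if i \<le> k then ?f i else 0) = sum ?f {..b}"
          using True Suc by (intro sum.cong) auto
        ultimately show ?thesis using True by simp
      next
        case False
        have "(\<Sum>i\<le>b. if i \<le> k then ?f i else 0) = sum ?f {..k}"
          using False Suc by (intro sum.mono_neutral_cong_right) auto
        then show ?thesis using full False by simp
      qed
      finally have "?x n = (if n \<le> k then c (k - n) else 0) + (if n = m then \<kappa> else 0)"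
        by (auto split: if_splits simp: add_eq_0_iff)
      then show ?thesis using k_less by auto
    qed
  qed
  have E0: "eval_mpoly v (E n) = 0" if "k < n" "n < m" for n
    using xval[of n] that by simp
  have vq: "v qVar = v0 qVar" using v_eq[OF qq_in_Lambda_q] by simp
  have Em: "eval_mpoly v (E m + (-1) ^ (m - k) * qq) = 0"
  proof -
    have "(-1) ^ m * eval_mpoly v (E m) = \<kappa>" using xval[of m] k_less by simp
    then have "eval_mpoly v (E m) = (-1) ^ m * \<kappa>" by (metis left_minus_one_mult_self)
    also have "\<dots> = - ((-1) ^ (m - k) * v0 qVar)"
    proof -
      have "(-1 :: 'a) ^ m * (-1) ^ k = (-1) ^ (m - k)"
        using k_less minus_one_power_iff[of "m + k", where 'a = 'a] minus_one_power_iff[of "m - k", where 'a = 'a]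
        by (simp flip: power_add)
      then show ?thesis by (simp add: \<kappa>_def flip: mult.assoc)
    qed
    finally show ?thesis
      by (simp add: eval_mpoly_add eval_mpoly_mult eval_mpoly.hom_power eval_mpoly.hom_uminus vq)
  qed
  define C where "C = det (mat k k (\<lambda>(l, j). w l * \<xi> l ^ j))"
  have s_eval: "eval_mpoly v (s S) = C * det (mat k k (\<lambda>(i, j). poly (fac_power \<tau> (dec_enum S i)) (\<xi> j)))"
    if S: "S \<in> Ks" for S
  proof -
    let ?A = "mat k k (\<lambda>(i, l). poly (fac_power \<tau> (dec_enum S i)) (\<xi> l))"
    let ?B = "mat k k (\<lambda>(l, j). w l * \<xi> l ^ j)"
    have "eval_mpoly v (s S) = det (map_mat (eval_mpoly v) (mat k k (\<lambda>(i, j). G j (int (dec_enum S i)))))"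
      unfolding s_def by (rule eval_mpoly.hom_det[symmetric])
    also have "map_mat (eval_mpoly v) (mat k k (\<lambda>(i, j). G j (int (dec_enum S i)))) = ?A * ?B"
    proof (rule eq_matI)
      fix i j assume "i < dim_row (?A * ?B)" "j < dim_col (?A * ?B)"
      then have i: "i < k" and j: "j < k" by auto
      have "dec_enum S i + j < m + k - 1" using dec_enum_Ks(2)[OF S i] j by linarith
      then have "eval_mpoly v (G j (int (dec_enum S i))) = L (fac_power \<tau> (dec_enum S i) * monom 1 j)"
        by (subst eG) auto
      also have "\<dots> = (?A * ?B) $$ (i, j)"
        using i j by (simp add: scalar_prod_def L_def poly_monom mult_ac)
      finally show "map_mat (eval_mpoly v) (mat k k (\<lambda>(i, j). G j (int (dec_enum S i)))) $$ (i, j)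
          = (?A * ?B) $$ (i, j)" using i j by simp
    qed auto
    finally show ?thesis by (simp add: det_mult[of _ k] C_def mult.commute)
  qed
  \<comment> \<open>At the base subset s is 1, so the common factor cannot vanish.\<close>
  have "C \<noteq> 0" using s_eval[OF base_in_Ks] by (auto simp: s_base)
  then show thesis using that[OF v_eq _ _ s_eval] eval_I_zero[OF E0 Em] by blast
qed

end

section \<open>Distinct roots and linear independence\<close>

lemma distinct_roots_of_shift:
  fixes Q :: "'a::alg_closed_field poly"
  assumes nz: "pderiv Q \<noteq> 0" and c: "c \<notin> (\<lambda>z. - poly Q z) ` {z. poly (pderiv Q) z = 0}"
    and deg: "degree Q = n" "n > 0"
  obtains \<xi> where "inj_on \<xi> {0..<n}" "\<And>i. i < n \<Longrightarrow> poly Q (\<xi> i) = - c"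
proof -
  define P where "P = Q + [:c:]"
  have degP: "degree P = n" using deg unfolding P_def by (subst degree_add_eq_left) auto
  have "P \<noteq> 0" using degP deg by auto
  then obtain A where A: "size A = degree P" "P = smult (coeff P (degree P)) (\<Prod>x\<in>#A. [:- x, 1:])"
    using alg_closed_imp_factorization[of P] by blast
  have root: "poly P x = 0" if "x \<in># A" for x
    using that by (subst A(2)) (auto simp: poly_prod_mset prod_mset_zero_iff)
  \<comment> \<open>A double root of Q + c would be a critical point of Q with critical value -c,
    and these values of c are excluded by hypothesis.\<close>
  have "count A x \<le> 1" for x
  proof (rule ccontr)
    assume "\<not> count A x \<le> 1"
    then have "{#x, x#} \<subseteq># A" by (simp add: subseteq_mset_def)
    then obtain B where "A = {#x, x#} + B" by (auto simp: subset_mset.le_iff_add)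
    then have "P = [:- x, 1:] * ([:- x, 1:] * smult (coeff P (degree P)) (\<Prod>x\<in>#B. [:- x, 1:]))"
      by (subst A(2)) (simp add: mult.assoc)
    then obtain H where H: "P = [:- x, 1:] * ([:- x, 1:] * H)" by blast
    have "poly (pderiv P) x = 0" unfolding H pderiv_mult by simp
    then have "poly (pderiv Q) x = 0" by (simp add: P_def pderiv_add)
    moreover have "poly P x = 0" unfolding H by simp
    then have "c = - poly Q x" by (simp add: P_def eq_neg_iff_add_eq_0 add.commute)
    ultimately show False using c by blast
  qed
  then have "card (set_mset A) = n"
    using A(1) degP by (metis size_multiset_overloaded_eq sum.cong card_eq_sum count_greater_zero_iff le_neq_implies_less less_one not_less_zero)
  then obtain \<xi> where "bij_betw \<xi> {0..<n} (set_mset A)"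
    using ex_bij_betw_nat_finite[of "set_mset A"] by auto
  then have "inj_on \<xi> {0..<n}" "\<And>i. i < n \<Longrightarrow> \<xi> i \<in># A" by (auto simp: bij_betw_def)
  moreover have "poly Q z = - c" if "z \<in># A" for z
    using root[OF that] by (simp add: P_def eq_neg_iff_add_eq_0)
  ultimately show thesis using that by blast
qed

context factorial_presentation
begin

text \<open>Each k-tuple of roots gives a point at which the relation can be evaluated. The
  resulting linear system has as matrix the k-th compound of the m by m matrix of shifted powers at
  the m roots; the latter is invertible, hence so is its compound.\<close>

lemma coordinates_vanish:
  fixes v0 :: "indet \<Rightarrow> 'a::field"
  defines "\<tau> \<equiv> \<lambda>i. eval_mpoly v0 (t i)"
  assumes inj: "inj_on \<xi> {0..<m}"
    and root: "\<And>i. i < m \<Longrightarrow> poly (fac_power \<tau> m) (\<xi> i) = - ((-1) ^ k * v0 qVar)"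
    and x: "\<And>S. S \<in> Ks \<Longrightarrow> x S \<in> Lambda_q m" "(\<Sum>S\<in>Ks. x S * s S) \<in> I" and S': "S' \<in> Ks"
  shows "eval_mpoly v0 (x S') = 0"
proof -
  define A where "A = (\<lambda>b l. poly (fac_power \<tau> b) (\<xi> l))"
  define y where "y = (\<lambda>S. eval_mpoly v0 (x S))"
  have zero: "(\<Sum>S\<in>Ks. y S * det (mat k k (\<lambda>(i, j). A (dec_enum S i) (g j)))) = 0"
    if g: "g \<in> PiE {0..<k} (\<lambda>_. {0..<m})" for g
  proof (cases "inj_on g {0..<k}")
    case True
    have gm: "g i < m" if "i < k" for i using g that by (auto simp: PiE_def Pi_def)
    have "g ` {0..<k} \<subseteq> {0..<m}" using gm by auto
    then have inj': "inj_on (\<xi> \<circ> g) {0..<k}" using True inj inj_on_subset by (blast intro: comp_inj_on)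
    have root': "poly (fac_power (\<lambda>i. eval_mpoly v0 (t i)) m) ((\<xi> \<circ> g) i) = - ((-1) ^ k * v0 qVar)"
      if "i < k" for i using root gm[OF that] by (simp add: \<tau>_def)
    obtain v C where v: "\<And>f. f \<in> Lambda_q m \<Longrightarrow> eval_mpoly v f = eval_mpoly v0 f"
      "\<And>f. f \<in> I \<Longrightarrow> eval_mpoly v f = 0" and C: "C \<noteq> 0"
      and vs: "\<And>S. S \<in> Ks \<Longrightarrow> eval_mpoly v (s S) = C * det (mat k k
        (\<lambda>(i, j). poly (fac_power (\<lambda>i. eval_mpoly v0 (t i)) (dec_enum S i)) ((\<xi> \<circ> g) j)))"
      using exists_point[OF inj' root'] by blast
    have "0 = eval_mpoly v (\<Sum>S\<in>Ks. x S * s S)" using v(2)[OF x(2)] by simp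
    also have "\<dots> = (\<Sum>S\<in>Ks. y S * (C * det (mat k k (\<lambda>(i, j). A (dec_enum S i) (g j)))))"
      unfolding eval_mpoly_sum eval_mpoly_mult
      by (intro sum.cong) (auto simp: v(1) x(1) vs y_def A_def \<tau>_def)
    also have "\<dots> = C * (\<Sum>S\<in>Ks. y S * det (mat k k (\<lambda>(i, j). A (dec_enum S i) (g j))))"
      by (simp add: sum_distrib_left mult.left_commute)
    finally show ?thesis using C by simp
  next
    case False
    then obtain r r' where "r < k" "r' < k" "r \<noteq> r'" "g r = g r'" by (auto simp: inj_on_def)
    then have "det (mat k k (\<lambda>(i, j). A (dec_enum S i) (g j))) = 0" for S
      by (intro det_equal_cols[of r _ r']) auto
    then show ?thesis by simp
  qed
  let ?M = "mat m m (\<lambda>(b, l). A b l)"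
  have M: "?M \<in> carrier_mat m m" by simp
  have det: "det ?M \<noteq> 0"
    unfolding A_def by (rule det_newton_vandermonde_nonzero) (use fac_power_monic[of \<tau>] inj in auto)
  define B where "B = (\<lambda>l b. adj_mat ?M $$ (l, b) / det ?M)"
  have AB: "(\<Sum>l\<in>{0..<m}. B l b' * A b l) = (if b = b' then 1 else 0)" if b: "b < m" "b' < m" for b b'
  proof -
    have "(?M * adj_mat ?M) $$ (b, b') = (det ?M \<cdot>\<^sub>m 1\<^sub>m m) $$ (b, b')"
      using adj_mat(2)[OF M] by simp
    moreover have "(?M * adj_mat ?M) $$ (b, b') = (\<Sum>l\<in>{0..<m}. A b l * adj_mat ?M $$ (l, b'))"
      using b adj_mat(1)[OF M] by (simp add: scalar_prod_def)
    ultimately have "(\<Sum>l\<in>{0..<m}. A b l * adj_mat ?M $$ (l, b')) = (if b = b' then det ?M else 0)"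
      using b by simp
    then have "(\<Sum>l\<in>{0..<m}. A b l * adj_mat ?M $$ (l, b')) / det ?M = (if b = b' then 1 else 0)"
      using det by simp
    then show ?thesis by (simp add: B_def sum_divide_distrib mult.commute)
  qed
  define a where "a = dec_enum S'"
  have am: "a j < m" if "j < k" for j using dec_enum_Ks(2)[OF S' that] by (simp add: a_def)
  \<comment> \<open>Weighting the equations by products of entries of the inverse matrix extracts
    the coordinate at S'. Tuples with a repetition contribute 0, so \<open>g\<close> may run over
    all functions, as multilinear expansion requires.\<close>
  have "0 = (\<Sum>g\<in>PiE {0..<k} (\<lambda>_. {0..<m}). (\<Prod>j = 0..<k. B (g j) (a j)) *
      (\<Sum>S\<in>Ks. y S * det (mat k k (\<lambda>(i, j). A (dec_enum S i) (g j)))))"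
    using zero by simp
  also have "\<dots> = (\<Sum>S\<in>Ks. y S * (\<Sum>g\<in>PiE {0..<k} (\<lambda>_. {0..<m}). (\<Prod>j = 0..<k. B (g j) (a j)) *
      det (mat k k (\<lambda>(j, i). A (dec_enum S i) (g j)))))"
    unfolding sum_distrib_left det_mat_transpose[of k "\<lambda>i j. A (dec_enum _ i) (_ j)"]
    by (subst sum.swap) (simp add: mult.left_commute)
  also have "\<dots> = (\<Sum>S\<in>Ks. y S * det (mat k k (\<lambda>(j, i). \<Sum>l\<in>{0..<m}. B l (a j) * A (dec_enum S i) l)))"
    by (subst det_rows_sum) auto
  also have "\<dots> = (\<Sum>S\<in>Ks. if S = S' then y S' else 0)"
  proof (rule sum.cong[OF refl])
    fix S assume S: "S \<in> Ks"
    have "det (mat k k (\<lambda>(j, i). \<Sum>l\<in>{0..<m}. B l (a j) * A (dec_enum S i) l))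
        = det (mat k k (\<lambda>(j, i). if dec_enum S i = a j then 1 else 0))"
      using AB dec_enum_Ks(2)[OF S] am by (intro det_mat_cong) auto
    also have "\<dots> = (if S = S' then 1 else 0)"
    proof (cases "S = S'")
      case True
      have "inj_on a {0..<k}" using dec_enum_inj[OF Ks_finite[OF S']] S' by (simp add: a_def Ks_def)
      then have "mat k k (\<lambda>(j, i). if dec_enum S i = a j then 1 else 0) = (1\<^sub>m k :: 'a mat)"
        using True by (intro eq_matI) (auto simp: a_def inj_on_def)
      then show ?thesis using True by simp
    next
      case False
      have "\<not> S' \<subseteq> S"
        using False S S' card_subset_eq[OF Ks_finite[OF S], of S'] by (auto simp: Ks_def)
      then obtain z where z: "z \<in> S'" "z \<notin> S" by blast
      have "a ` {0..<k} = S'" using dec_enum_image[OF Ks_finite[OF S']] S' by (simp add: a_def Ks_def)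
      then have "z \<in> a ` {0..<k}" using z by (simp only:)
      then obtain r where r: "r < k" "a r = z" by auto
      have "dec_enum S i \<noteq> z" if "i < k" for i using dec_enum_Ks(1)[OF S that] z by auto
      then have "det (mat k k (\<lambda>(j, i). if dec_enum S i = a j then 1 else 0)) = (0 :: 'a)"
        unfolding det_mat_def using r
        by (intro sum.neutral ballI) (auto dest: permutes_in_image[of _ "{0..<k}" r] intro!: prod_zero bexI[of _ r])
      then show ?thesis using False by simp
    qed
    finally show "y S * det (mat k k (\<lambda>(j, i). \<Sum>l\<in>{0..<m}. B l (a j) * A (dec_enum S i) l))
        = (if S = S' then y S' else 0)" by simp
  qed
  also have "\<dots> = y S'" using finite_Ks S' by simp
  finally show ?thesis by (simp add: y_def)
qed

text \<open>The variable q is specialised to an arbitrary \<kappa> in the algebraic closure of the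
  fraction field. Outside finitely many \<kappa> the roots are distinct and the coordinates vanish;
  a polynomial in \<kappa> with infinitely many zeros is 0. Letting \<kappa> vary makes it enough to
  avoid the critical values, instead of proving P separable at \<kappa> = q.\<close>

theorem independent:
  assumes x: "\<And>S. S \<in> Ks \<Longrightarrow> x S \<in> Lambda_q m" "(\<Sum>S\<in>Ks. x S * s S) \<in> I" and S: "S \<in> Ks"
  shows "x S = 0"
proof -
  define \<iota> :: "mpoly \<Rightarrow> mpoly fract alg_closure" where "\<iota> = (\<lambda>f. to_ac (to_fract f))"
  have \<iota>_inj: "\<iota> f = \<iota> g \<longleftrightarrow> f = g" for f g by (simp add: \<iota>_def)
  interpret \<iota>: comm_ring_hom \<iota> by unfold_locales (simp_all add: \<iota>_def hom_distribs)
  define v where "v = (\<lambda>\<kappa> y. if y = qVar then \<kappa> else \<iota> (Var y))"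
  define \<Theta> where "\<Theta> = eval_mpoly (\<lambda>y. if y = qVar then [:0, 1:] else [:\<iota> (Var y):])"
  have poly\<Theta>: "poly (\<Theta> f) \<kappa> = eval_mpoly (v \<kappa>) f" for f \<kappa>
  proof -
    have "f \<in> polys_in UNIV" by (simp add: polys_in_def)
    then show ?thesis
      by (induction rule: polys_in_induct)
        (auto simp: \<Theta>_def v_def eval_mpoly_add eval_mpoly_mult eval_mpoly.hom_of_int)
  qed
  have eval_q: "eval_mpoly (v (\<iota> qq)) f = \<iota> f" for f
  proof -
    have "f \<in> polys_in UNIV" by (simp add: polys_in_def)
    then show ?thesis
      by (induction rule: polys_in_induct)
        (auto simp: v_def eval_mpoly_add eval_mpoly_mult eval_mpoly.hom_of_int
          \<iota>.hom_of_int \<iota>.hom_add \<iota>.hom_mult)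
  qed
  define \<tau> where "\<tau> = (\<lambda>i. \<iota> (t i))"
  have \<tau>: "eval_mpoly (v \<kappa>) (t i) = \<tau> i" for \<kappa> i
  proof -
    have "eval_mpoly (v \<kappa>) (t i) = eval_mpoly (v (\<iota> qq)) (t i)"
      using t_in[of i] unfolding Lambda_def
      by (rule eval_mpoly_cong) (auto simp: v_def T_vars_def)
    then show ?thesis by (simp only: eval_q \<tau>_def)
  qed
  define Q where "Q = fac_power \<tau> m"
  have of_nat_nz: "(of_nat n :: mpoly fract alg_closure) \<noteq> 0" if "n > 0" for n
    using that \<iota>_inj[of "of_nat n" 0] by (simp add: \<iota>.hom_of_nat)
  have Q: "degree Q = m" "coeff Q m = 1" using fac_power_monic[of \<tau> m] by (auto simp: Q_def)
  have "coeff (pderiv Q) (m - 1) \<noteq> 0" using Q of_nat_nz[of m] k_less by (simp add: coeff_pderiv)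
  then have Q': "pderiv Q \<noteq> 0" by auto
  define bad where "bad = (\<lambda>z. - poly Q z) ` {z. poly (pderiv Q) z = 0}"
  have "finite bad" unfolding bad_def using poly_roots_finite[OF Q'] by simp
  have root: "poly (\<Theta> (x S)) \<kappa> = 0" if nb: "(-1) ^ k * \<kappa> \<notin> bad" for \<kappa>
  proof -
    have m: "0 < m" using k_less by simp
    obtain \<xi> where \<xi>: "inj_on \<xi> {0..<m}" "\<And>i. i < m \<Longrightarrow> poly Q (\<xi> i) = - ((-1) ^ k * \<kappa>)"
      by (rule distinct_roots_of_shift[OF Q' nb[unfolded bad_def] Q(1) m]) blast
    have "poly (fac_power (\<lambda>i. eval_mpoly (v \<kappa>) (t i)) m) (\<xi> i) = - ((-1) ^ k * v \<kappa> qVar)" if "i < m" for i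
      using \<xi>(2)[OF that] unfolding \<tau> Q_def by (simp add: v_def)
    then have "eval_mpoly (v \<kappa>) (x S) = 0"
      by (intro coordinates_vanish[OF \<xi>(1) _ x S])
    then show ?thesis by (simp add: poly\<Theta>)
  qed
  have "\<Theta> (x S) = 0"
  proof (rule ccontr)
    assume "\<Theta> (x S) \<noteq> 0"
    then have fin: "finite {\<kappa>. poly (\<Theta> (x S)) \<kappa> = 0}" by (rule poly_roots_finite)
    have "\<kappa> \<in> {\<kappa>. poly (\<Theta> (x S)) \<kappa> = 0} \<union> (\<lambda>z. (-1) ^ k * z) ` bad" for \<kappa>
    proof (cases "(-1) ^ k * \<kappa> \<in> bad")
      case True
      have "\<kappa> = (-1) ^ k * ((-1) ^ k * \<kappa>)" by simp
      then show ?thesis using True by blast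
    qed (use root in auto)
    then have "finite (UNIV :: mpoly fract alg_closure set)"
      using fin \<open>finite bad\<close> by (metis (no_types, lifting) UNIV_eq_I finite_UnI finite_imageI)
    moreover have "inj (\<lambda>n. \<iota> (of_nat n))" by (auto simp: inj_on_def \<iota>_inj)
    ultimately show False using finite_subset[of "range (\<lambda>n. \<iota> (of_nat n))" UNIV] range_inj_infinite by blast
  qed
  then show ?thesis using poly\<Theta>[of "x S" "\<iota> qq"] eval_q[of "x S"] \<iota>_inj[of "x S" 0] by simp
qed

end

section \<open>Comparison of the presentation with the quantum product\<close>

locale qh_presentation = factorial_presentation k m t gv
  for k m :: nat and t :: "int \<Rightarrow> mpoly" and gv :: "nat \<Rightarrow> indet" +
  fixes p :: nat and c :: struct_consts and idx :: "part \<Rightarrow> nat set"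
  assumes idx_bij: "bij_betw idx (partitions_in p m) Ks"
    and idx_empty: "idx empty_part = {0..<k}"
    and empty_in: "empty_part \<in> partitions_in p m"
    and divisor_in: "row_part 1 \<in> partitions_in p m"
    and QH: "cring (QH p m c)"
    and chev: "\<lbrakk>la \<in> partitions_in p m; nu \<in> partitions_in p m\<rbrakk> \<Longrightarrow>
      qh_mult p m c (schubert la) (schubert (row_part 1)) nu
        = chev0 (idx la) (idx nu) + qq * chev1 (idx la) (idx nu)"
begin

abbreviation B :: "part set" where "B \<equiv> partitions_in p m"
abbreviation N :: "(part \<Rightarrow> mpoly) set" where "N \<equiv> carrier (QH p m c)"
abbreviation qmult (infixl \<open>\<star>\<close> 70) where "x \<star> y \<equiv> qh_mult p m c x y"
abbreviation \<sigma>1 :: "part \<Rightarrow> mpoly" where "\<sigma>1 \<equiv> schubert (row_part 1)"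

text \<open>The comparison goes from the free module to polynomial representatives, where it is
  given by a formula. The homomorphism wanted is its inverse modulo \<open>I\<close>, which exists
  by spanning and independence.\<close>

definition F :: "(part \<Rightarrow> mpoly) \<Rightarrow> mpoly" where
  "F x = (\<Sum>la\<in>B. x la * s (idx la))"

lemma finite_B: "finite B"
  using bij_betw_finite[OF idx_bij] finite_Ks by simp

lemma idx_in: "la \<in> B \<Longrightarrow> idx la \<in> Ks"
  using idx_bij by (auto simp: bij_betw_def)

lemma sum_idx: "(\<Sum>la\<in>B. f (idx la)) = (\<Sum>S\<in>Ks. f S)"
  by (rule sum.reindex_bij_betw[OF idx_bij])

lemma N_iff: "x \<in> N \<longleftrightarrow> (\<forall>la\<in>B. x la \<in> Lambda_q m) \<and> (\<forall>la. la \<notin> B \<longrightarrow> x la = 0)"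
  by (simp add: QH_def)

lemma N_in: "x \<in> N \<Longrightarrow> x la \<in> Lambda_q m"
  by (cases "la \<in> B") (auto simp: N_iff Lambda_q_def)

lemma QH_ops: "x \<otimes>\<^bsub>QH p m c\<^esub> y = x \<star> y" "x \<oplus>\<^bsub>QH p m c\<^esub> y = (\<lambda>nu. x nu + y nu)"
  "\<one>\<^bsub>QH p m c\<^esub> = schubert empty_part" "\<zero>\<^bsub>QH p m c\<^esub> = (\<lambda>_. 0)"
  by (simp_all add: QH_def)

lemma schubert_in: "la \<in> B \<Longrightarrow> schubert la \<in> N"
  by (auto simp: N_iff schubert_def Lambda_q_def)

lemma mult_in: "x \<in> N \<Longrightarrow> y \<in> N \<Longrightarrow> x \<star> y \<in> N"
proof -
  interpret Q: cring "QH p m c" by (rule QH)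
  show "x \<in> N \<Longrightarrow> y \<in> N \<Longrightarrow> x \<star> y \<in> N" using Q.m_closed by (simp add: QH_ops)
qed

lemma mult_comm: "x \<in> N \<Longrightarrow> y \<in> N \<Longrightarrow> x \<star> y = y \<star> x"
  and mult_assoc: "x \<in> N \<Longrightarrow> y \<in> N \<Longrightarrow> z \<in> N \<Longrightarrow> x \<star> y \<star> z = x \<star> (y \<star> z)"
  and mult_one: "x \<in> N \<Longrightarrow> schubert empty_part \<star> x = x"
proof -
  interpret Q: cring "QH p m c" by (rule QH)
  show "x \<in> N \<Longrightarrow> y \<in> N \<Longrightarrow> x \<star> y = y \<star> x" using Q.m_comm by (simp add: QH_ops)
  show "x \<in> N \<Longrightarrow> y \<in> N \<Longrightarrow> z \<in> N \<Longrightarrow> x \<star> y \<star> z = x \<star> (y \<star> z)" using Q.m_assoc by (simp add: QH_ops)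
  show "x \<in> N \<Longrightarrow> schubert empty_part \<star> x = x" using Q.l_one by (simp add: QH_ops)
qed

lemma mult_outside: "nu \<notin> B \<Longrightarrow> (x \<star> y) nu = 0"
  by (simp add: qh_mult_def)

lemma mult_expand: "(x \<star> y) nu = (\<Sum>la\<in>B. x la * (schubert la \<star> y) nu)"
proof (cases "nu \<in> B")
  case True
  define d where "d = (\<lambda>la mu. \<Sum>d | c la mu nu d \<noteq> 0. qq ^ d * c la mu nu d)"
  have "(schubert la \<star> y) nu = (\<Sum>mu\<in>B. y mu * d la mu)" if la: "la \<in> B" for la
  proof -
    have "(schubert la \<star> y) nu = (\<Sum>la'\<in>B. \<Sum>mu\<in>B. schubert la la' * y mu * d la' mu)"
      using True by (simp add: qh_mult_def d_def)
    also have "\<dots> = (\<Sum>la'\<in>B. if la' = la then \<Sum>mu\<in>B. y mu * d la mu else 0)"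
      by (intro sum.cong) (auto simp: schubert_def)
    finally show ?thesis using la finite_B by simp
  qed
  then have "(\<Sum>la\<in>B. x la * (schubert la \<star> y) nu) = (\<Sum>la\<in>B. \<Sum>mu\<in>B. x la * y mu * d la mu)"
    by (simp add: sum_distrib_left mult.assoc)
  then show ?thesis using True by (simp add: qh_mult_def d_def)
qed (simp add: mult_outside)

lemma F_in_R: "x \<in> N \<Longrightarrow> F x \<in> R"
  unfolding F_def using s_in_R Lambda_q_in_R[OF N_in] by (intro R_sum R_mult) auto

lemma F_schubert: "la \<in> B \<Longrightarrow> F (schubert la) = s (idx la)"
proof -
  assume la: "la \<in> B"
  have "F (schubert la) = (\<Sum>mu\<in>B. if mu = la then s (idx la) else 0)"
    unfolding F_def by (intro sum.cong) (auto simp: schubert_def)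
  then show ?thesis using la finite_B by simp
qed

lemma F_lin: "F (\<lambda>nu. \<Sum>la\<in>B. x la * z la nu) = (\<Sum>la\<in>B. x la * F (z la))"
  unfolding F_def sum_distrib_left sum_distrib_right by (subst sum.swap) (simp add: mult.assoc)

text \<open>The rule for the quantum product and the one for the determinants have the same
  coefficients \<open>chev0\<close> and \<open>chev1\<close>, so the map intertwines the two divisor
  multiplications.\<close>

lemma F_divisor:
  assumes x: "x \<in> N"
  shows "gen 1 * F x - F (x \<star> \<sigma>1) \<in> I"
proof -
  have eq: "F (schubert la \<star> \<sigma>1) = (\<Sum>x\<in>moves (idx la). s (move (idx la) x))
      + (weight (idx la) - weight {0..<k}) * s (idx la)
      + (if wraps (idx la) then qq * s (wrap (idx la)) else 0)" if la: "la \<in> B" for la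
  proof -
    have "F (schubert la \<star> \<sigma>1) = (\<Sum>nu\<in>B. (chev0 (idx la) (idx nu) + qq * chev1 (idx la) (idx nu)) * s (idx nu))"
      unfolding F_def using chev[OF la] by simp
    also have "\<dots> = (\<Sum>S\<in>Ks. (chev0 (idx la) S + qq * chev1 (idx la) S) * s S)"
      by (rule sum_idx)
    also have "\<dots> = (\<Sum>S\<in>Ks. chev0 (idx la) S * s S) + qq * (\<Sum>S\<in>Ks. chev1 (idx la) S * s S)"
      by (simp add: distrib_right sum.distrib sum_distrib_left mult.assoc)
    finally show ?thesis unfolding sum_chev0[OF idx_in[OF la]] sum_chev1[OF idx_in[OF la]] by simp
  qed
  have "F (x \<star> \<sigma>1) = F (\<lambda>nu. \<Sum>la\<in>B. x la * (schubert la \<star> \<sigma>1) nu)"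
    by (rule arg_cong[where f = F]) (rule ext, rule mult_expand)
  also have "\<dots> = (\<Sum>la\<in>B. x la * F (schubert la \<star> \<sigma>1))" by (rule F_lin)
  finally have "gen 1 * F x - F (x \<star> \<sigma>1) = (\<Sum>la\<in>B. x la * (gen 1 * s (idx la) - F (schubert la \<star> \<sigma>1)))"
    unfolding F_def[of x] by (simp add: sum_distrib_left sum_subtractf algebra_simps)
  also have "\<dots> \<in> I"
  proof (intro I_sum I_mult)
    fix la assume la: "la \<in> B"
    show "gen 1 * s (idx la) - F (schubert la \<star> \<sigma>1) \<in> I"
      unfolding eq[OF la] by (rule chevalley_mod[OF idx_in[OF la]])
    show "x la \<in> R" by (rule Lambda_q_in_R[OF N_in[OF x]])
  qed
  finally show ?thesis .
qed

lemma F_surj: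
  assumes "f \<in> R" obtains x where "x \<in> N" "f - F x \<in> I"
proof -
  obtain y where y: "\<forall>S\<in>Ks. y S \<in> Lambda_q m" "f - (\<Sum>S\<in>Ks. y S * s S) \<in> I"
    using spanning[OF assms] by blast
  define x where "x = (\<lambda>la. if la \<in> B then y (idx la) else 0)"
  have "F x = (\<Sum>la\<in>B. y (idx la) * s (idx la))" by (auto simp: F_def x_def intro!: sum.cong)
  also have "\<dots> = (\<Sum>S\<in>Ks. y S * s S)" by (rule sum_idx)
  finally have "f - F x \<in> I" using y by simp
  moreover have "x \<in> N" using y idx_in by (auto simp: N_iff x_def)
  ultimately show thesis using that by blast
qed

lemma F_inj:
  assumes x: "x \<in> N" and y: "y \<in> N" and I: "F x - F y \<in> I"
  shows "x = y"
proof -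
  let ?ix = "inv_into B idx"
  have ix: "?ix (idx la) = la" if "la \<in> B" for la
    using that idx_bij by (auto simp: bij_betw_def)
  have ix_in: "?ix S \<in> B" if "S \<in> Ks" for S
    using that idx_bij by (metis bij_betw_def inv_into_into)
  have "(\<Sum>S\<in>Ks. (x (?ix S) - y (?ix S)) * s S)
      = (\<Sum>la\<in>B. (x (?ix (idx la)) - y (?ix (idx la))) * s (idx la))"
    by (rule sum_idx[symmetric])
  also have "\<dots> = F x - F y"
    by (simp add: F_def ix left_diff_distrib sum_subtractf)
  finally have "(\<Sum>S\<in>Ks. (x (?ix S) - y (?ix S)) * s S) \<in> I" using I by simp
  moreover have "x (?ix S) - y (?ix S) \<in> Lambda_q m" for S
    using N_in[OF x] N_in[OF y] by (auto simp: Lambda_q_def)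
  ultimately have "x (?ix S) - y (?ix S) = 0" if "S \<in> Ks" for S
    using that independent[of "\<lambda>S. x (?ix S) - y (?ix S)"] by blast
  then have "x la = y la" if "la \<in> B" for la
    using that idx_in[OF that] ix[OF that] by (metis eq_iff_diff_eq_0)
  then show ?thesis using x y by (intro ext) (metis N_iff)
qed

definition coord :: "mpoly \<Rightarrow> part \<Rightarrow> mpoly" where
  "coord f = (THE x. x \<in> N \<and> f - F x \<in> I)"

lemma coord_eq: "x \<in> N \<Longrightarrow> f - F x \<in> I \<Longrightarrow> coord f = x"
  unfolding coord_def
proof (rule the_equality)
  fix y assume "x \<in> N" "f - F x \<in> I" "y \<in> N \<and> f - F y \<in> I"
  then show "y = x" using I_diff[of "f - F x" "f - F y"] by (intro F_inj) auto
qed auto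

lemma coord: "f \<in> R \<Longrightarrow> coord f \<in> N" "f \<in> R \<Longrightarrow> f - F (coord f) \<in> I"
  using F_surj[of f] coord_eq by metis+

lemma coord_F: "x \<in> N \<Longrightarrow> coord (F x) = x"
  by (rule coord_eq) (simp_all add: I_zero)

lemma lin_in_N:
  assumes "x \<in> N" "\<And>la. la \<in> B \<Longrightarrow> z la \<in> N"
  shows "(\<lambda>nu. \<Sum>la\<in>B. x la * z la nu) \<in> N"
  using N_in[OF assms(1)] N_in[OF assms(2)] assms(2)
  by (auto simp: N_iff Lambda_q_def intro!: polys_in_sum polys_in_mult sum.neutral)

text \<open>Multiplication by a fixed y is carried out twice on the basis: through representatives,
  giving \<open>z\<close>, and by the quantum product. Both operators commute with the divisor class
  and agree on the unit, so their difference \<open>Z\<close> falls under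
  \<open>commutant_zero\<close>.\<close>

lemma F_mult:
  assumes x: "x \<in> N" and y: "y \<in> N"
  shows "F x * F y - F (x \<star> y) \<in> I"
proof -
  define z where "z = (\<lambda>la. coord (s (idx la) * F y))"
  have z: "z la \<in> N" "s (idx la) * F y - F (z la) \<in> I" for la
    unfolding z_def using coord[of "s (idx la) * F y"] R_mult[OF s_in_R F_in_R[OF y]] by auto
  have lin: "F u * F y - F (\<lambda>nu. \<Sum>la\<in>B. u la * z la nu) \<in> I" if u: "u \<in> N" for u
  proof -
    have "F u * F y - F (\<lambda>nu. \<Sum>la\<in>B. u la * z la nu)
        = (\<Sum>la\<in>B. u la * (s (idx la) * F y - F (z la)))"
      unfolding F_lin by (simp add: F_def[of u] sum_distrib_right right_diff_distrib sum_subtractf mult.assoc)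
    also have "\<dots> \<in> I" using z(2) Lambda_q_in_R[OF N_in[OF u]] by (intro I_sum I_mult) auto
    finally show ?thesis .
  qed
  have \<sigma>: "\<sigma>1 \<in> N" by (rule schubert_in[OF divisor_in])
  let ?ix = "inv_into B idx"
  have ix: "?ix (idx la) = la" if "la \<in> B" for la
    using that idx_bij by (auto simp: bij_betw_def)
  have ix_in: "?ix S \<in> B" and idx_ix: "idx (?ix S) = S" if "S \<in> Ks" for S
    using that idx_bij by (metis bij_betw_def inv_into_into, metis bij_betw_def f_inv_into_f)
  define Z where "Z = (\<lambda>S S'. z (?ix S) (?ix S') - (schubert (?ix S) \<star> y) (?ix S'))"
  let ?M = "\<lambda>S U. chev0 S U + qq * chev1 S U"
  have M: "?M (idx la) (idx mu) = (schubert la \<star> \<sigma>1) mu" if "la \<in> B" "mu \<in> B" for la mu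
    using chev[OF that] by simp
  have Z0: "Z S S' = 0" if "S \<in> Ks" "S' \<in> Ks" for S S'
  proof (rule commutant_zero[OF _ _ that])
    fix S S' assume S: "S \<in> Ks" and S': "S' \<in> Ks"
    define la nu where "la = ?ix S" and "nu = ?ix S'"
    have la: "la \<in> B" "idx la = S" and nu: "nu \<in> B" "idx nu = S'"
      using S S' ix_in idx_ix by (auto simp: la_def nu_def)
    have "(\<Sum>U\<in>Ks. ?M S U * Z U S') = (\<Sum>mu\<in>B. ?M S (idx mu) * Z (idx mu) S')"
      by (rule sum_idx[symmetric])
    also have "\<dots> = (\<Sum>mu\<in>B. (schubert la \<star> \<sigma>1) mu * (z mu nu - (schubert mu \<star> y) nu))"
      by (intro sum.cong) (auto simp: M la(2)[symmetric] la(1) Z_def ix nu_def)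
    also have "\<dots> = (\<Sum>mu\<in>B. (schubert la \<star> \<sigma>1) mu * z mu nu) - (schubert la \<star> \<sigma>1 \<star> y) nu"
      by (subst mult_expand[of _ y]) (simp add: right_diff_distrib sum_subtractf)
    finally have lhs: "(\<Sum>U\<in>Ks. ?M S U * Z U S')
        = (\<Sum>mu\<in>B. (schubert la \<star> \<sigma>1) mu * z mu nu) - (schubert la \<star> \<sigma>1 \<star> y) nu" .
    have "(\<Sum>U\<in>Ks. Z S U * ?M U S') = (\<Sum>mu\<in>B. Z S (idx mu) * ?M (idx mu) S')"
      by (rule sum_idx[symmetric])
    also have "\<dots> = (\<Sum>mu\<in>B. (z la mu - (schubert la \<star> y) mu) * (schubert mu \<star> \<sigma>1) nu)"
      by (intro sum.cong) (auto simp: M nu(2)[symmetric] nu(1) Z_def ix la_def)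
    also have "\<dots> = (z la \<star> \<sigma>1) nu - (schubert la \<star> y \<star> \<sigma>1) nu"
      by (subst (2 3) mult_expand) (simp add: left_diff_distrib sum_subtractf)
    finally have rhs: "(\<Sum>U\<in>Ks. Z S U * ?M U S') = (z la \<star> \<sigma>1) nu - (schubert la \<star> y \<star> \<sigma>1) nu" .
    let ?u = "schubert la \<star> \<sigma>1"
    have u: "?u \<in> N" by (rule mult_in[OF schubert_in[OF la(1)] \<sigma>])
    \<comment> \<open>Both sides represent gen 1 times s times F y modulo \<open>I\<close>: this is
      commutativity of the quotient, written in coordinates. On the quantum side, the same exchange
      is associativity and commutativity of the product.\<close>
    have "(\<lambda>nu. \<Sum>mu\<in>B. ?u mu * z mu nu) = z la \<star> \<sigma>1"
    proof (rule F_inj[OF lin_in_N[OF u z(1)] mult_in[OF z(1) \<sigma>]])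
      have a: "F ?u * F y - F (\<lambda>nu. \<Sum>mu\<in>B. ?u mu * z mu nu) \<in> I" by (rule lin[OF u])
      have b: "gen 1 * s (idx la) - F ?u \<in> I"
        using F_divisor[OF schubert_in[OF la(1)]] by (simp add: F_schubert la(1))
      have d: "gen 1 * F (z la) - F (z la \<star> \<sigma>1) \<in> I" by (rule F_divisor[OF z(1)])
      have "F (\<lambda>nu. \<Sum>mu\<in>B. ?u mu * z mu nu) - F (z la \<star> \<sigma>1)
          = (gen 1 * F (z la) - F (z la \<star> \<sigma>1)) + gen 1 * (s (idx la) * F y - F (z la))
            - F y * (gen 1 * s (idx la) - F ?u)
            - (F ?u * F y - F (\<lambda>nu. \<Sum>mu\<in>B. ?u mu * z mu nu))"
        by (simp add: algebra_simps)
      also have "\<dots> \<in> I"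
        by (rule I_diff[OF I_diff[OF I_add[OF d I_mult[OF gen_in_R z(2)]] I_mult[OF F_in_R[OF y] b]] a])
      finally show "F (\<lambda>nu. \<Sum>mu\<in>B. ?u mu * z mu nu) - F (z la \<star> \<sigma>1) \<in> I" .
    qed
    moreover have "schubert la \<star> \<sigma>1 \<star> y = schubert la \<star> y \<star> \<sigma>1"
      using mult_assoc mult_comm[OF \<sigma> y] schubert_in[OF la(1)] \<sigma> y by simp
    ultimately show "(\<Sum>U\<in>Ks. ?M S U * Z U S') = (\<Sum>U\<in>Ks. Z S U * ?M U S')"
      unfolding lhs rhs by (metis (no_types, lifting))
  next
    fix S' assume S': "S' \<in> Ks"
    have "?ix {0..<k} = empty_part" using ix[OF empty_in] idx_empty by simp
    moreover have "z empty_part = y" unfolding z_def idx_empty s_base by (simp add: coord_F[OF y])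
    ultimately show "Z {0..<k} S' = 0" using mult_one[OF y] by (simp add: Z_def)
  qed
  have "z la nu = (schubert la \<star> y) nu" if "la \<in> B" "nu \<in> B" for la nu
    using Z0[OF idx_in[OF that(1)] idx_in[OF that(2)]] by (simp add: Z_def ix that)
  then have "(\<lambda>nu. \<Sum>la\<in>B. x la * z la nu) = x \<star> y"
  proof (intro ext)
    fix nu assume *: "\<And>la nu. la \<in> B \<Longrightarrow> nu \<in> B \<Longrightarrow> z la nu = (schubert la \<star> y) nu"
    show "(\<Sum>la\<in>B. x la * z la nu) = (x \<star> y) nu"
    proof (cases "nu \<in> B")
      case True
      then show ?thesis by (subst mult_expand) (simp add: *)
    next
      case False
      then have "z la nu = 0" for la using z(1)[of la] by (auto simp: N_iff)
      then show ?thesis using False by (simp add: mult_outside)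
    qed
  qed
  then show ?thesis using lin[OF x] by simp
qed

lemma coord_hom: "coord \<in> Ring.ring_hom (Defs.poly_ring V) (QH p m c)"
proof (rule ring_hom_memI)
  fix f g assume f: "f \<in> carrier (Defs.poly_ring V)" and g: "g \<in> carrier (Defs.poly_ring V)"
  then have f: "f \<in> R" and g: "g \<in> R" by simp_all
  note cf = coord[OF f] and cg = coord[OF g]
  show "coord f \<in> N" by (rule cf(1))
  have "f * g - F (coord f \<star> coord g) = g * (f - F (coord f)) + F (coord f) * (g - F (coord g))
      + (F (coord f) * F (coord g) - F (coord f \<star> coord g))"
    by (simp add: algebra_simps)
  also have "\<dots> \<in> I"
    by (rule I_add[OF I_add[OF I_mult[OF g cf(2)] I_mult[OF F_in_R[OF cf(1)] cg(2)]] F_mult[OF cf(1) cg(1)]])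
  finally have "coord (f * g) = coord f \<star> coord g"
    by (intro coord_eq mult_in cf cg)
  then show "coord (f \<otimes>\<^bsub>Defs.poly_ring V\<^esub> g) = coord f \<otimes>\<^bsub>QH p m c\<^esub> coord g"
    by (simp add: QH_ops)
  have "F (\<lambda>nu. coord f nu + coord g nu) = F (coord f) + F (coord g)"
    by (simp add: F_def distrib_right sum.distrib)
  then have "f + g - F (\<lambda>nu. coord f nu + coord g nu) = (f - F (coord f)) + (g - F (coord g))" by simp
  then have "f + g - F (\<lambda>nu. coord f nu + coord g nu) \<in> I"
    using I_add[OF cf(2) cg(2)] by (simp only:)
  moreover have "(\<lambda>nu. coord f nu + coord g nu) \<in> N"
    using cf(1) cg(1) by (auto simp: N_iff Lambda_q_def)
  ultimately have "coord (f + g) = (\<lambda>nu. coord f nu + coord g nu)"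
    by (intro coord_eq)
  then show "coord (f \<oplus>\<^bsub>Defs.poly_ring V\<^esub> g) = coord f \<oplus>\<^bsub>QH p m c\<^esub> coord g"
    by (simp add: QH_ops)
next
  show "coord \<one>\<^bsub>Defs.poly_ring V\<^esub> = \<one>\<^bsub>QH p m c\<^esub>"
    using coord_F[OF schubert_in[OF empty_in]]
    by (simp add: QH_ops F_schubert empty_in idx_empty s_base)
qed

text \<open>The first isomorphism theorem for \<open>coord\<close>, whose kernel is \<open>I\<close>
  because 0 represents exactly the elements of \<open>I\<close>. The clause about \<Lambda>[q] makes
  the ring isomorphism one of algebras.\<close>

theorem presentation:
  "\<exists>\<Phi> \<in> ring_iso (Defs.poly_ring V Quot I) (QH p m c).
    (\<forall>a \<in> Lambda_q m. \<Phi> (I +>\<^bsub>Defs.poly_ring V\<^esub> a) = qh_smult a \<one>\<^bsub>QH p m c\<^esub>) \<and>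
    (\<forall>la \<in> B. \<Phi> (I +>\<^bsub>Defs.poly_ring V\<^esub> s (idx la)) = schubert la)"
proof -
  interpret Q: cring "QH p m c" by (rule QH)
  interpret P: cring "Defs.poly_ring V" by (rule cring_poly_ring)
  interpret h: ring_hom_ring "Defs.poly_ring V" "QH p m c" coord
    by (rule ring_hom_ringI2[OF P.ring_axioms Q.ring_axioms coord_hom])
  have F0: "F (\<lambda>_. 0) = 0" by (simp add: F_def)
  have zeroN: "(\<lambda>_. 0) \<in> N" by (simp add: N_iff Lambda_q_def)
  have kernel: "a_kernel (Defs.poly_ring V) (QH p m c) coord = I"
  proof -
    have "coord f = (\<lambda>_. 0) \<longleftrightarrow> f \<in> I" if "f \<in> R" for f
      using coord(2)[OF that] coord_eq[OF zeroN, of f] F0 by auto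
    then show ?thesis unfolding a_kernel_def' using I_R by (auto simp: QH_ops)
  qed
  have "coord ` carrier (Defs.poly_ring V) = N"
  proof (intro equalityI subsetI)
    fix x assume "x \<in> N"
    then show "x \<in> coord ` carrier (Defs.poly_ring V)"
      using coord_F F_in_R by (metis image_eqI poly_ring_simps(1))
  qed (auto intro: coord(1))
  then have iso: "(\<lambda>A. the_elem (coord ` A)) \<in> ring_iso (Defs.poly_ring V Quot I) (QH p m c)"
    using h.FactRing_iso_set kernel by simp
  have class_eq: "the_elem (coord ` (I +>\<^bsub>Defs.poly_ring V\<^esub> f)) = coord f" if f: "f \<in> R" for f
  proof -
    have "coord (i + f) = coord f" if i: "i \<in> I" for i
    proof (rule coord_eq[OF coord(1)[OF f]])
      have "i + f - F (coord f) = i + (f - F (coord f))" by simp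
      also have "\<dots> \<in> I" using i coord(2)[OF f] by (rule I_add)
      finally show "i + f - F (coord f) \<in> I" .
    qed
    then have "coord ` (I +>\<^bsub>Defs.poly_ring V\<^esub> f) = {coord f}"
      using I_zero by (auto simp: a_r_coset_def')
    then show ?thesis by simp
  qed
  have a1: "the_elem (coord ` (I +>\<^bsub>Defs.poly_ring V\<^esub> a)) = qh_smult a \<one>\<^bsub>QH p m c\<^esub>" if a: "a \<in> Lambda_q m" for a
  proof -
    have N: "qh_smult a (schubert empty_part) \<in> N"
      using a empty_in by (auto simp: N_iff qh_smult_def schubert_def Lambda_q_def)
    have "F (qh_smult a (schubert empty_part)) = a * F (schubert empty_part)"
      by (simp add: F_def qh_smult_def sum_distrib_left mult.assoc)
    then have "F (qh_smult a (schubert empty_part)) = a"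
      by (simp add: F_schubert empty_in idx_empty s_base)
    then show ?thesis
      using coord_F[OF N] class_eq[OF Lambda_q_in_R[OF a]] by (simp add: QH_ops)
  qed
  have a2: "the_elem (coord ` (I +>\<^bsub>Defs.poly_ring V\<^esub> s (idx la))) = schubert la" if "la \<in> B" for la
    using coord_F[OF schubert_in[OF that]] class_eq[OF s_in_R] by (simp add: F_schubert that)
  show ?thesis by (intro bexI[OF _ iso] conjI ballI a1 a2)
qed

end

text \<open>Setting one T-variable to 1 and all other variables to 0 tests membership of a single
  index. The sign \<open>e\<close> admits both families of parameters.\<close>

lemma sum_TT_inj:
  fixes t :: "nat \<Rightarrow> mpoly"
  assumes t: "\<And>a. a < m \<Longrightarrow> t a = e * TT (f a)" and e: "e \<in> {1, - 1}" and inj: "inj_on f {0..<m}"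
    and S: "S \<subseteq> {0..<m}" "S' \<subseteq> {0..<m}" and eq: "(\<Sum>a\<in>S. t a) = (\<Sum>a\<in>S'. t a)"
  shows "S = S'"
proof -
  have val: "eval_mpoly (\<lambda>x. if x = TVar (f b) then 1 else 0 :: int) (\<Sum>a\<in>U. t a)
      = eval_mpoly (\<lambda>x. if x = TVar (f b) then 1 else 0) e * (if b \<in> U then 1 else 0)"
    if U: "U \<subseteq> {0..<m}" and b: "b < m" for U b
  proof -
    let ?v = "\<lambda>x. if x = TVar (f b) then 1 else 0 :: int"
    have "eval_mpoly ?v (\<Sum>a\<in>U. t a) = (\<Sum>a\<in>U. eval_mpoly ?v e * (if a = b then 1 else 0))"
      unfolding eval_mpoly_sum
    proof (rule sum.cong[OF refl])
      fix a assume "a \<in> U"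
      then have "a < m" using U by auto
      moreover have "f a = f b \<longleftrightarrow> a = b" using inj_onD[OF inj, of a b] \<open>a < m\<close> b by auto
      ultimately show "eval_mpoly ?v (t a) = eval_mpoly ?v e * (if a = b then 1 else 0)"
        by (simp add: t eval_mpoly_mult)
    qed
    moreover have "finite U" using U finite_subset by blast
    ultimately show ?thesis by (simp flip: sum_distrib_left)
  qed
  have "b \<in> S \<longleftrightarrow> b \<in> S'" if "b < m" for b
  proof -
    have "eval_mpoly v e \<noteq> 0" for v :: "indet \<Rightarrow> int" using e by (auto simp: eval_mpoly.hom_uminus)
    then show ?thesis using val[OF S(1) that] val[OF S(2) that] unfolding eq by (auto split: if_splits)
  qed
  then show ?thesis using S by auto
qed

lemma TT_in_Lambda: "1 \<le> i \<Longrightarrow> i \<le> m \<Longrightarrow> TT i \<in> Lambda m"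
  by (auto simp: Lambda_def T_vars_def)

lemma tt_in_Lambda: "tt m i \<in> Lambda m"
proof (cases "1 \<le> i \<and> i \<le> int m")
  case True
  then have "TT (nat (int m - i + 1)) \<in> Lambda m" by (intro TT_in_Lambda) linarith+
  then show ?thesis using True by (simp add: tt_def)
qed (auto simp: tt_def Lambda_def)

lemma tt_eq: "a < m \<Longrightarrow> tt m (int a + 1) = TT (m - a)"
proof -
  assume "a < m"
  then have "nat (int m - (int a + 1) + 1) = m - a" by linarith
  then show ?thesis using \<open>a < m\<close> by (simp add: tt_def)
qed

lemma tt_rev_eq: "a < m \<Longrightarrow> tt m (int m - int a) = TT (Suc a)"
proof -
  assume "a < m"
  then have "nat (int m - (int m - int a) + 1) = Suc a" by linarith
  then show ?thesis using \<open>a < m\<close> by (simp add: tt_def)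
qed

lemma inj_on_shifted:
  fixes t :: "int \<Rightarrow> mpoly"
  assumes "inj_on (\<lambda>a. t (int a + 1)) {0..<m}"
  shows "inj_on t {1..int m}"
proof (rule inj_onI)
  fix x y assume x: "x \<in> {1..int m}" and y: "y \<in> {1..int m}" and eq: "t x = t y"
  have "nat (x - 1) = nat (y - 1)"
    using inj_onD[OF assms, of "nat (x - 1)" "nat (y - 1)"] x y eq by auto
  then show "x = y" using x y by auto
qed

section \<open>The two instances attached to the Grassmannian\<close>

locale grassmannian =
  fixes p m :: nat
  assumes p_pos: "1 \<le> p" and p_less: "p < m"
begin

lemma tt_sums:
  assumes "S \<subseteq> {0..<m}" "S' \<subseteq> {0..<m}" "(\<Sum>a\<in>S. tt m (int a + 1)) = (\<Sum>a\<in>S'. tt m (int a + 1))"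
  shows "S = S'"
  by (rule sum_TT_inj[of m _ 1 "\<lambda>a. m - a"]) (use assms in \<open>auto simp: tt_eq inj_on_def\<close>)

lemma tt_rev_sums:
  assumes "S \<subseteq> {0..<m}" "S' \<subseteq> {0..<m}"
    "(\<Sum>a\<in>S. - tt m (int m + 1 - (int a + 1))) = (\<Sum>a\<in>S'. - tt m (int m + 1 - (int a + 1)))"
  shows "S = S'"
  by (rule sum_TT_inj[of m "\<lambda>a. - tt m (int m + 1 - (int a + 1))" "- 1" Suc])
    (use assms in \<open>auto simp: tt_rev_eq inj_on_def\<close>)

sublocale h: factorial_presentation p m "tt m" hVar
proof
  show "0 < p" "p < m" using p_pos p_less by auto
  show "inj_on (tt m) {1..int m}"
  proof (rule inj_on_shifted, rule inj_onI)
    fix a b assume "a \<in> {0..<m}" "b \<in> {0..<m}" "tt m (int a + 1) = tt m (int b + 1)"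
    then have "{a} = {b}" by (intro tt_sums) auto
    then show "a = b" by simp
  qed
  show "tt m i \<in> Lambda m" for i by (rule tt_in_Lambda)
  show "tt m i = 0" if "\<not> (1 \<le> i \<and> i \<le> int m)" for i using that by (auto simp: tt_def)
  show "S = S'" if "S \<subseteq> {0..<m}" "S' \<subseteq> {0..<m}" "card S = p" "card S' = p"
    "(\<Sum>a\<in>S. tt m (int a + 1)) = (\<Sum>a\<in>S'. tt m (int a + 1))" for S S'
    by (rule tt_sums[OF that(1,2,5)])
  show "inj hVar" by (simp add: inj_def)
  show "hVar n \<notin> insert qVar (T_vars m)" for n by (auto simp: T_vars_def)
qed

text \<open>For 1 \<le> i \<le> m the parameter is -T_i, since t_(m+1-i) = T_i.\<close>

sublocale e: factorial_presentation "m - p" m "\<lambda>i. - tt m (int m + 1 - i)" eVar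
proof
  show "0 < m - p" "m - p < m" using p_pos p_less by auto
  show "inj_on (\<lambda>i. - tt m (int m + 1 - i)) {1..int m}"
  proof (rule inj_on_shifted, rule inj_onI)
    fix a b assume "a \<in> {0..<m}" "b \<in> {0..<m}"
      "- tt m (int m + 1 - (int a + 1)) = - tt m (int m + 1 - (int b + 1))"
    then have "{a} = {b}" by (intro tt_rev_sums) auto
    then show "a = b" by simp
  qed
  show "- tt m (int m + 1 - i) \<in> Lambda m" for i
    using tt_in_Lambda[of m "int m + 1 - i"] by (auto simp: Lambda_def)
  show "- tt m (int m + 1 - i) = 0" if "\<not> (1 \<le> i \<and> i \<le> int m)" for i
    using that by (auto simp: tt_def)
  show "S = S'" if "S \<subseteq> {0..<m}" "S' \<subseteq> {0..<m}" "card S = m - p" "card S' = m - p"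
    "(\<Sum>a\<in>S. - tt m (int m + 1 - (int a + 1))) = (\<Sum>a\<in>S'. - tt m (int m + 1 - (int a + 1)))" for S S'
    by (rule tt_rev_sums[OF that(1,2,5)])
  show "inj eVar" by (simp add: inj_def)
  show "eVar n \<notin> insert qVar (T_vars m)" for n by (auto simp: T_vars_def)
qed

text \<open>The subtracted parameter t_(1-s) vanishes for s \<ge> 1, so there is no second shift
  here.\<close>

lemma tau_h_G: "tau_h p m s j = h.G s (j + int p - int s - 1)"
proof (induction s arbitrary: j)
  case 0
  show ?case by (simp add: h.G_0 h.gen_def hh_def)
next
  case (Suc s)
  have "tt m (1 - int (Suc s)) = 0" by (simp add: tt_def)
  moreover have "h.G (Suc s) (j + int p - int (Suc s) - 1)
      = h.G s (j + int p - int s - 1) + tt m (j + int p - int (Suc s)) * h.G s (j - 1 + int p - int s - 1)"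
    unfolding h.G_Suc by (simp add: algebra_simps)
  ultimately show ?case using Suc.IH by simp
qed

lemma E_poly_eq: "E_poly p m c = h.E c"
  unfolding E_poly_def h.E_def by (rule det_mat_cong) (simp add: tau_h_G algebra_simps)

text \<open>Here the parameter t_s is a genuine second shift, with \<beta>_s = -t_s. It stays in the
  entries and disappears only in determinants, through \<open>det_fac_shift\<close>.\<close>

lemma tau_e_shift: "tau_e p m s i = fac_shift (\<lambda>i. - tt m (int m + 1 - i))
    (\<lambda>a. e.gen (a + 1 - int (m - p))) (\<lambda>s. - tt m (int s)) s (i + int (m - p) - int s - 1)"
proof (induction s arbitrary: i)
  case 0
  have "int m - int (m - p) = int p" using p_less by simp
  then show ?case by (simp add: e.gen_def ee_def)
next
  case (Suc s)
  have "int p - i + int (Suc s) + 1 = int m + 1 - (i + int (m - p) - int (Suc s) - 1 + 1)"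
    using p_less by simp
  then show ?case using Suc.IH[of i] Suc.IH[of "i - 1"] by (simp add: algebra_simps)
qed

lemma H_poly_eq: "H_poly p m c = e.E c"
proof -
  have "H_poly p m c = det (mat c c (\<lambda>(i, j). fac_shift (\<lambda>i. - tt m (int m + 1 - i))
      (\<lambda>a. e.gen (a + 1 - int (m - p))) (\<lambda>s. - tt m (int s)) j (int (m - p) - int i)))"
    unfolding H_poly_def by (rule det_mat_cong) (simp add: tau_e_shift algebra_simps)
  also have "\<dots> = e.E c" unfolding e.E_def e.G_def by (rule det_fac_shift)
  finally show ?thesis .
qed

lemma h_ring_eq: "h_ring p m = Defs.poly_ring h.V"
  by (simp add: h_ring_def h.V_def)

lemma h_ideal_eq: "h_ideal p m = h.I"
  unfolding h_ideal_def h.I_def h_ring_eq E_poly_eq[abs_def] by simp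

lemma e_ring_eq: "e_ring p m = Defs.poly_ring e.V"
  using p_less by (simp add: e_ring_def e.V_def)

lemma e_ideal_eq: "e_ideal p m = e.I"
  unfolding e_ideal_def e.I_def e_ring_eq H_poly_eq[abs_def] using p_less by simp

subsection \<open>Partitions and subsets\<close>

text \<open>The beta numbers \<lambda>_i + p - i, with rows counted from 0.\<close>

definition beta_num :: "part \<Rightarrow> nat \<Rightarrow> nat" where
  "beta_num la i = la (Suc i) + (p - 1 - i)"

definition beta_set :: "part \<Rightarrow> nat set" where
  "beta_set la = beta_num la ` {0..<p}"

lemma part_mono: "la \<in> partitions_in p m \<Longrightarrow> 1 \<le> i \<Longrightarrow> i \<le> j \<Longrightarrow> j \<le> p \<Longrightarrow> la j \<le> la i"
  by (auto simp: partitions_in_def)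

lemma part_le: "la \<in> partitions_in p m \<Longrightarrow> la i \<le> m - p"
  by (cases "i \<in> {1..p}") (auto simp: partitions_in_def)

lemma part_zero: "la \<in> partitions_in p m \<Longrightarrow> i \<notin> {1..p} \<Longrightarrow> la i = 0"
  unfolding partitions_in_def by blast

lemma beta_num_dec:
  assumes "la \<in> partitions_in p m" "i < j" "j < p"
  shows "beta_num la j < beta_num la i"
  using part_mono[OF assms(1), of "Suc i" "Suc j"] assms(2,3) by (simp add: beta_num_def)

lemma beta_num_less: "la \<in> partitions_in p m \<Longrightarrow> i < p \<Longrightarrow> beta_num la i < m"
  using part_le[of la "Suc i"] p_less by (simp add: beta_num_def)

lemma dec_enum_beta: "la \<in> partitions_in p m \<Longrightarrow> i < p \<Longrightarrow> dec_enum (beta_set la) i = beta_num la i"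
  unfolding beta_set_def by (rule dec_enum_unique) (auto intro: beta_num_dec)

lemma beta_num_inj: "la \<in> partitions_in p m \<Longrightarrow> inj_on (beta_num la) {0..<p}"
  using beta_num_dec[of la] by (intro inj_onI) (metis atLeastLessThan_iff less_irrefl nat_neq_iff)

lemma beta_set_in: "la \<in> partitions_in p m \<Longrightarrow> beta_set la \<in> h.Ks"
  using beta_num_less card_image[OF beta_num_inj] by (auto simp: h.Ks_def beta_set_def)

lemma beta_set_inj:
  assumes la: "la \<in> partitions_in p m" and mu: "mu \<in> partitions_in p m" and eq: "beta_set la = beta_set mu"
  shows "la = mu"
proof (rule ext)
  fix i
  show "la i = mu i"
  proof (cases "i \<in> {1..p}")
    case True
    then have "beta_num la (i - 1) = beta_num mu (i - 1)"
      using dec_enum_beta[OF la, of "i - 1"] dec_enum_beta[OF mu, of "i - 1"] eq by auto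
    then show ?thesis using True by (simp add: beta_num_def)
  qed (simp add: part_zero[OF la] part_zero[OF mu])
qed

text \<open>This gap is what makes a strictly decreasing sequence, after subtraction of the
  staircase, a partition.\<close>

lemma dec_gap:
  assumes dec: "\<And>i j. i < j \<Longrightarrow> j < n \<Longrightarrow> (a j :: nat) < a i" and "i \<le> j" "j < n"
  shows "a j + (j - i) \<le> a i"
  using assms(2,3)
proof (induction j rule: dec_induct)
  case (step j)
  then show ?case using dec[of j "Suc j"] by simp
qed simp

lemma partitions_inI:
  assumes dec: "\<And>i j. i < j \<Longrightarrow> j < p \<Longrightarrow> beta_num la j < beta_num la i"
    and less: "\<And>i. i < p \<Longrightarrow> beta_num la i < m" and zero: "\<And>i. i \<notin> {1..p} \<Longrightarrow> la i = 0"
  shows "la \<in> partitions_in p m"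
proof -
  have mono: "la j \<le> la i" if "i \<in> {1..p}" "j \<in> {1..p}" "i \<le> j" for i j
  proof -
    have "beta_num la (j - 1) + (j - 1 - (i - 1)) \<le> beta_num la (i - 1)"
      using that by (intro dec_gap[of p "beta_num la", OF dec]) auto
    moreover have "p - 1 - (j - 1) + (j - 1 - (i - 1)) = p - 1 - (i - 1)" using that by auto
    ultimately show ?thesis using that unfolding beta_num_def by auto
  qed
  have "la 1 \<le> m - p" using less[of 0] p_pos by (simp add: beta_num_def)
  then have "la i \<le> m - p" if "i \<in> {1..p}" for i using mono[of 1 i] that by auto
  then show ?thesis using mono zero by (auto simp: partitions_in_def)
qed

lemma beta_set_surj:
  assumes S: "S \<in> h.Ks"
  shows "\<exists>la\<in>partitions_in p m. beta_set la = S"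
proof -
  define a where "a = dec_enum S"
  have dec: "a j < a i" if "i < j" "j < p" for i j
    using dec_enum_less[OF h.Ks_finite[OF S]] that S by (auto simp: a_def h.Ks_def)
  define la where "la = (\<lambda>i. if i \<in> {1..p} then a (i - 1) - (p - i) else 0)"
  have beta: "beta_num la i = a i" if "i < p" for i
  proof -
    have "a (p - 1) + (p - 1 - i) \<le> a i" using that by (intro dec_gap[of p a, OF dec]) auto
    then have "p - Suc i \<le> a i" by linarith
    then show ?thesis using that by (simp add: beta_num_def la_def)
  qed
  have "la \<in> partitions_in p m"
  proof (rule partitions_inI)
    show "beta_num la i < m" if "i < p" for i
      using h.dec_enum_Ks(2)[OF S that] beta[OF that] by (simp add: a_def)
  qed (use dec beta in \<open>auto simp: la_def\<close>)
  moreover have "beta_set la = a ` {0..<p}" unfolding beta_set_def using beta by (intro image_cong) auto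
  moreover have "a ` {0..<p} = S"
    using dec_enum_image[OF h.Ks_finite[OF S]] S by (simp add: a_def h.Ks_def)
  ultimately show ?thesis by blast
qed

lemma beta_set_bij: "bij_betw beta_set (partitions_in p m) h.Ks"
  unfolding bij_betw_def
proof
  show "inj_on beta_set (partitions_in p m)" by (rule inj_onI) (rule beta_set_inj)
  show "beta_set ` partitions_in p m = h.Ks" using beta_set_in beta_set_surj by blast
qed

lemma row_part_in: "j \<le> m - p \<Longrightarrow> row_part j \<in> partitions_in p m"
  using p_pos by (auto simp: partitions_in_def row_part_def)

lemma empty_part_in: "empty_part \<in> partitions_in p m"
  by (auto simp: partitions_in_def empty_part_def)

lemma beta_set_row: "beta_set (row_part j) = insert (p - 1 + j) {0..<p - 1}"
proof -
  have "{0..<p} = insert 0 {1..<p}" using p_pos by auto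
  then have "beta_set (row_part j) = insert (beta_num (row_part j) 0) (beta_num (row_part j) ` {1..<p})"
    unfolding beta_set_def by (simp only: image_insert)
  also have "beta_num (row_part j) ` {1..<p} = {0..<p - 1}"
  proof (intro equalityI subsetI)
    fix x assume "x \<in> {0..<p - 1}"
    then have "x = beta_num (row_part j) (p - 1 - x)" "p - 1 - x \<in> {1..<p}"
      by (auto simp: beta_num_def row_part_def)
    then show "x \<in> beta_num (row_part j) ` {1..<p}" by (rule image_eqI)
  qed (auto simp: beta_num_def row_part_def)
  finally show ?thesis by (simp add: beta_num_def row_part_def add.commute)
qed

lemma beta_set_empty: "beta_set empty_part = {0..<p}"
proof -
  have "empty_part = row_part 0" by (auto simp: empty_part_def row_part_def)
  moreover have "insert (p - 1) {0..<p - 1} = {0..<p}" using p_pos by auto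
  ultimately show ?thesis using beta_set_row[of 0] by simp
qed

lemma s_poly_eq:
  assumes la: "la \<in> partitions_in p m"
  shows "s_poly p m la = h.s (beta_set la)"
  unfolding s_poly_def h.s_def
proof (rule det_mat_cong)
  fix i j assume i: "i < p"
  have "int (beta_num la i) = int (la (i + 1)) + int j - int i + int p - int j - 1"
    using i by (simp add: beta_num_def of_nat_diff)
  then show "tau_h p m j (int (la (i + 1)) + int j - int i) = h.G j (int (dec_enum (beta_set la) i))"
    by (simp only: tau_h_G dec_enum_beta[OF la i])
qed

lemma beta_num_upd:
  "beta_num (la(Suc r := la (Suc r) + 1)) = (beta_num la)(r := Suc (beta_num la r))"
  by (auto simp: beta_num_def)

lemma beta_set_upd:
  assumes la: "la \<in> partitions_in p m" and r: "r < p"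
  shows "beta_set (la(Suc r := la (Suc r) + 1)) = h.move (beta_set la) (beta_num la r)"
proof -
  have "beta_num la ` ({0..<p} - {r}) = beta_set la - {beta_num la r}"
    using inj_on_image_set_diff[OF beta_num_inj[OF la], of "{0..<p}" "{r}"] r by (auto simp: beta_set_def)
  then show ?thesis
    unfolding beta_set_def[of "la(_ := _)"] beta_num_upd h.move_def fun_upd_image using r by simp
qed

text \<open>Adding a box to a row raises its beta number by one. The result is again a partition in
  the rectangle exactly when the new place is free and below m.\<close>

lemma add_box_iff:
  assumes la: "la \<in> partitions_in p m" and nu: "nu \<in> partitions_in p m"
  shows "nu \<in> add_box p m la \<longleftrightarrow> (\<exists>x\<in>h.moves (beta_set la). h.move (beta_set la) x = beta_set nu)"
proof
  assume "nu \<in> add_box p m la"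
  then obtain i where i: "i \<in> {1..p}" "nu = la(i := la i + 1)" by (auto simp: add_box_def)
  define r where "r = i - 1"
  have r: "r < p" "nu = la(Suc r := la (Suc r) + 1)" using i by (auto simp: r_def)
  let ?x = "beta_num la r"
  have nub: "beta_num nu = (beta_num la)(r := Suc ?x)" unfolding r(2) by (rule beta_num_upd)
  have "Suc ?x \<notin> beta_set la"
  proof
    assume "Suc ?x \<in> beta_set la"
    then obtain r' where r': "r' < p" "beta_num la r' = Suc ?x" by (auto simp: beta_set_def)
    then have "beta_num nu r' = beta_num nu r" by (auto simp: nub)
    then have "r' = r" using inj_onD[OF beta_num_inj[OF nu], of r' r] r' r by simp
    then show False using r' by simp
  qed
  moreover have "Suc ?x < m" using beta_num_less[OF nu r(1)] by (simp add: nub)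
  ultimately have "?x \<in> h.moves (beta_set la)" using r by (auto simp: h.moves_def beta_set_def)
  moreover have "h.move (beta_set la) ?x = beta_set nu"
    unfolding r(2) by (rule beta_set_upd[OF la r(1), symmetric])
  ultimately show "\<exists>x\<in>h.moves (beta_set la). h.move (beta_set la) x = beta_set nu" by blast
next
  assume "\<exists>x\<in>h.moves (beta_set la). h.move (beta_set la) x = beta_set nu"
  then obtain x where x: "x \<in> h.moves (beta_set la)" "h.move (beta_set la) x = beta_set nu" by blast
  then have "x \<in> beta_set la" by (simp add: h.moves_def)
  then obtain r where r: "r < p" "x = beta_num la r" by (auto simp: beta_set_def)
  define mu where "mu = la(Suc r := la (Suc r) + 1)"
  have mub: "beta_num mu = (beta_num la)(r := Suc x)" unfolding mu_def r(2) by (rule beta_num_upd)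
  have ne: "beta_num la i \<noteq> Suc x" if "i < p" for i
    using x(1) that by (force simp: h.moves_def beta_set_def)
  have "mu \<in> partitions_in p m"
  proof (rule partitions_inI)
    fix i j assume ij: "i < j" "j < p"
    have "beta_num la i \<noteq> Suc x" using ne ij by simp
    then show "beta_num mu j < beta_num mu i"
      using beta_num_dec[OF la ij] r(2) ij unfolding mub
      by (cases "i = r"; cases "j = r") (auto intro: Suc_lessI)
  next
    fix i assume "i < p"
    then show "beta_num mu i < m"
      using beta_num_less[OF la] x(1) by (auto simp: mub h.moves_def)
  next
    fix i assume "i \<notin> {1..p}"
    then show "mu i = 0" using part_zero[OF la] r(1) by (auto simp: mu_def)
  qed
  moreover have "beta_set mu = beta_set nu"
    using beta_set_upd[OF la r(1)] x(2) r(2) by (simp add: mu_def)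
  ultimately have "mu = nu" using nu by (intro beta_set_inj)
  then show "nu \<in> add_box p m la"
    using nu r(1) unfolding add_box_def by (auto simp: mu_def intro!: bexI[of _ "Suc r"])
qed

lemma finite_partitions: "finite (partitions_in p m)"
  using bij_betw_finite[OF beta_set_bij] h.finite_Ks by simp

lemma weight_beta_set:
  assumes la: "la \<in> partitions_in p m"
  shows "h.weight (beta_set la) = (\<Sum>i = 1..p. TT (m - p + i - la i))"
proof -
  have "h.weight (beta_set la) = (\<Sum>i\<in>{0..<p}. tt m (int (beta_num la i) + 1))"
    unfolding h.weight_def beta_set_def using sum.reindex[OF beta_num_inj[OF la]] by simp
  also have "\<dots> = (\<Sum>i\<in>{0..<p}. TT (m - p + Suc i - la (Suc i)))"
  proof (rule sum.cong[OF refl])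
    fix i assume "i \<in> {0..<p}"
    then have "m - beta_num la i = m - p + Suc i - la (Suc i)"
      using part_le[OF la, of "Suc i"] p_less by (auto simp: beta_num_def)
    then show "tt m (int (beta_num la i) + 1) = TT (m - p + Suc i - la (Suc i))"
      using tt_eq[OF beta_num_less[OF la, of i]] \<open>i \<in> {0..<p}\<close> by simp
  qed
  also have "\<dots> = (\<Sum>i = 1..p. TT (m - p + i - la i))"
    by (rule sum.reindex_bij_witness[of _ "\<lambda>i. i - 1" Suc]) auto
  finally show ?thesis .
qed

lemma weight_base: "h.weight {0..<p} = (\<Sum>j = m - p + 1..m. TT j)"
proof -
  have "h.weight {0..<p} = (\<Sum>a\<in>{0..<p}. TT (m - a))"
    unfolding h.weight_def using p_less by (intro sum.cong) (auto simp: tt_eq)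
  also have "\<dots> = (\<Sum>j = m - p + 1..m. TT j)"
    using p_less by (intro sum.reindex_bij_witness[of _ "\<lambda>j. m - j" "\<lambda>a. m - a"]) auto
  finally show ?thesis .
qed

text \<open>The largest bead belongs to the first row and the smallest to the last: place m - 1 is
  taken iff the first row is full, and place 0 is free iff the last row is nonempty.\<close>

lemma wraps_beta_set:
  assumes la: "la \<in> partitions_in p m"
  shows "h.wraps (beta_set la) \<longleftrightarrow> la 1 = m - p \<and> 0 < la p"
proof -
  have "m - 1 \<in> beta_set la \<longleftrightarrow> la 1 = m - p"
  proof
    assume "m - 1 \<in> beta_set la"
    then obtain i where i: "i < p" "m - 1 = beta_num la i" by (auto simp: beta_set_def)
    have "beta_num la i \<le> beta_num la 0" using beta_num_dec[OF la, of 0 i] i by (cases "i = 0") auto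
    moreover have "beta_num la 0 < m" using beta_num_less[OF la, of 0] p_pos by simp
    ultimately have "beta_num la 0 = m - 1" using i by simp
    then show "la 1 = m - p" using p_pos p_less by (simp add: beta_num_def)
  next
    assume "la 1 = m - p"
    then have "beta_num la 0 = m - 1" using p_pos p_less by (simp add: beta_num_def)
    then have "m - 1 = beta_num la 0" by simp
    moreover have "0 \<in> {0..<p}" using p_pos by simp
    ultimately show "m - 1 \<in> beta_set la" unfolding beta_set_def by (rule image_eqI)
  qed
  moreover have "0 \<in> beta_set la \<longleftrightarrow> la p = 0"
  proof
    assume "0 \<in> beta_set la"
    then obtain i where i: "i < p" "beta_num la i = 0" by (auto simp: beta_set_def)
    then have "i = p - 1" by (simp add: beta_num_def)
    then show "la p = 0" using i p_pos by (simp add: beta_num_def)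
  next
    assume "la p = 0"
    then have "0 = beta_num la (p - 1)" using p_pos by (simp add: beta_num_def)
    moreover have "p - 1 \<in> {0..<p}" using p_pos by simp
    ultimately show "0 \<in> beta_set la" unfolding beta_set_def by (rule image_eqI)
  qed
  ultimately show ?thesis by (auto simp: h.wraps_def)
qed

text \<open>The beads of rows 2, ..., p stay where they are: the box lost in each of these rows is
  compensated by the shift of its row number. The new last row is empty and puts a bead at
  0.\<close>

lemma rim_removed_beta:
  assumes la: "la \<in> partitions_in p m" and l1: "la 1 = m - p" and lp: "0 < la p"
  shows "rim_removed p la \<in> partitions_in p m" "beta_set (rim_removed p la) = h.wrap (beta_set la)"
proof -
  let ?mu = "rim_removed p la"
  \<comment> \<open>All parts are positive, so the truncated subtraction in
    \<open>rim_removed\<close> is a true one.\<close>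
  have pos: "0 < la i" if "1 \<le> i" "i \<le> p" for i using part_mono[OF la that(1,2)] lp by simp
  have b: "beta_num ?mu i = (if i = p - 1 then 0 else beta_num la (Suc i))" if "i < p" for i
    using that pos[of "Suc (Suc i)"] by (auto simp: beta_num_def rim_removed_def)
  have bpos: "0 < beta_num la i" if "i < p" for i using pos[of "Suc i"] that by (simp add: beta_num_def)
  show "?mu \<in> partitions_in p m"
  proof (rule partitions_inI)
    fix i j assume "i < j" "j < p"
    then show "beta_num ?mu j < beta_num ?mu i"
      using b[of i] b[of j] bpos[of "Suc i"] beta_num_dec[OF la, of "Suc i" "Suc j"] by auto
  next
    fix i assume "i < p"
    then show "beta_num ?mu i < m" using b[of i] beta_num_less[OF la, of "Suc i"] p_less by auto
  qed (auto simp: rim_removed_def)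
  have b0: "beta_num la 0 = m - 1" using l1 p_pos p_less by (simp add: beta_num_def)
  have "beta_set la - {m - 1} = beta_num la ` ({0..<p} - {0})"
    using inj_on_image_set_diff[OF beta_num_inj[OF la], of "{0..<p}" "{0}"] b0 p_pos
    by (simp add: beta_set_def)
  also have "{0..<p} - {0} = Suc ` {0..<p - 1}"
    using p_pos by auto
  finally have rest: "beta_set la - {m - 1} = (\<lambda>i. beta_num la (Suc i)) ` {0..<p - 1}"
    by (simp only: image_image)
  have "beta_set ?mu = beta_num ?mu ` insert (p - 1) {0..<p - 1}"
    unfolding beta_set_def using p_pos by (intro arg_cong[where f = "image _"]) auto
  also have "\<dots> = insert 0 ((\<lambda>i. beta_num la (Suc i)) ` {0..<p - 1})"
  proof -
    have "beta_num ?mu ` {0..<p - 1} = (\<lambda>i. beta_num la (Suc i)) ` {0..<p - 1}"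
      by (rule image_cong) (auto simp: b)
    moreover have "beta_num ?mu (p - 1) = 0" using b[of "p - 1"] p_pos by simp
    ultimately show ?thesis by (simp only: image_insert)
  qed
  finally show "beta_set ?mu = h.wrap (beta_set la)" unfolding h.wrap_def rest .
qed

lemma chevalley_beta:
  assumes EQ: "equivariant_quantum_cohomology p m c"
    and la: "la \<in> partitions_in p m" and nu: "nu \<in> partitions_in p m"
  shows "qh_mult p m c (schubert la) (schubert (row_part 1)) nu
    = h.chev0 (beta_set la) (beta_set nu) + qq * h.chev1 (beta_set la) (beta_set nu)"
proof -
  let ?S = "beta_set la"
  have inj: "beta_set la' = beta_set nu \<longleftrightarrow> la' = nu" if "la' \<in> partitions_in p m" for la'
    using beta_set_inj[OF that nu] by blast
  have "finite (add_box p m la)"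
    using finite_partitions by (rule rev_finite_subset) (auto simp: add_box_def)
  then have "(\<Sum>mu\<in>add_box p m la. schubert mu nu) = (if nu \<in> add_box p m la then 1 else 0)"
    by (simp add: schubert_def)
  also have "\<dots> = (\<Sum>x\<in>h.moves ?S. if h.move ?S x = beta_set nu then 1 else 0)"
    unfolding add_box_iff[OF la nu] by (rule h.sum_moves_indicator[OF beta_set_in[OF la], symmetric])
  finally have 1: "(\<Sum>mu\<in>add_box p m la. schubert mu nu)
      = (\<Sum>x\<in>h.moves ?S. if h.move ?S x = beta_set nu then 1 else 0)" .
  have 2: "((\<Sum>i = 1..p. TT (m - p + i - la i)) - (\<Sum>j = m - p + 1..m. TT j)) * schubert la nu
      = (if ?S = beta_set nu then h.weight ?S - h.weight {0..<p} else 0)"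
    unfolding weight_beta_set[OF la] weight_base inj[OF la] by (auto simp: schubert_def)
  have 3: "(if la 1 = m - p \<and> 0 < la p then qq * schubert (rim_removed p la) nu else 0)
      = qq * h.chev1 ?S (beta_set nu)"
  proof (cases "la 1 = m - p \<and> 0 < la p")
    case True
    then have "h.wrap ?S = beta_set nu \<longleftrightarrow> rim_removed p la = nu"
      using rim_removed_beta[OF la] inj[of "rim_removed p la"] by simp
    then show ?thesis using True wraps_beta_set[OF la] by (auto simp: h.chev1_def schubert_def)
  next
    case False
    then show ?thesis using wraps_beta_set[OF la] by (auto simp: h.chev1_def)
  qed
  have "qh_mult p m c (schubert la) (schubert (row_part 1)) nu
      = (schubert la \<otimes>\<^bsub>QH p m c\<^esub> schubert (row_part 1)) nu" by (simp add: QH_def)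
  then show ?thesis
    unfolding equivariant_quantum_cohomology.chevalley[OF EQ la nu] 1 2 3 h.chev0_def by simp
qed

subsection \<open>Conjugation is complementation\<close>

text \<open>The holes of the bead configuration, read from the top.\<close>

definition co :: "nat set \<Rightarrow> nat set" where
  "co S = (\<lambda>b. m - 1 - b) ` ({0..<m} - S)"

lemma co_iff: "y \<in> co S \<longleftrightarrow> y < m \<and> m - 1 - y \<notin> S"
proof
  assume "y \<in> co S"
  then obtain b where "b < m" "b \<notin> S" "y = m - 1 - b" by (auto simp: co_def)
  then show "y < m \<and> m - 1 - y \<notin> S" by auto
next
  assume "y < m \<and> m - 1 - y \<notin> S"
  then show "y \<in> co S" unfolding co_def by (intro image_eqI[of _ _ "m - 1 - y"]) auto
qed

lemma co_co: "S \<subseteq> {0..<m} \<Longrightarrow> co (co S) = S"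
proof (intro equalityI subsetI)
  assume S: "S \<subseteq> {0..<m}"
  show "x \<in> S" if "x \<in> co (co S)" for x
    using that by (auto simp: co_iff)
  show "x \<in> co (co S)" if "x \<in> S" for x
    using that S by (auto simp: co_iff)
qed

lemma co_subset: "co S \<subseteq> {0..<m}" by (auto simp: co_iff)

lemma co_inj_on: "inj_on (\<lambda>b. m - 1 - b) ({0..<m} - S)"
  by (auto simp: inj_on_def)

lemma card_co: "S \<subseteq> {0..<m} \<Longrightarrow> card (co S) = m - card S"
  unfolding co_def card_image[OF co_inj_on]
  by (subst card_Diff_subset) (auto intro: finite_subset)

lemma co_bij: "bij_betw co h.Ks e.Ks"
proof (rule bij_betw_byWitness[where f' = co])
  show "\<forall>S\<in>h.Ks. co (co S) = S" "\<forall>S\<in>e.Ks. co (co S) = S" by (auto simp: h.Ks_def e.Ks_def co_co)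
  show "co ` h.Ks \<subseteq> e.Ks" using co_subset by (auto simp: h.Ks_def e.Ks_def card_co)
  show "co ` e.Ks \<subseteq> h.Ks" using co_subset p_less by (auto simp: h.Ks_def e.Ks_def card_co)
qed

lemma co_base: "co {0..<p} = {0..<m - p}"
  using p_less by (auto simp: co_iff)

text \<open>With negated parameters the holes of S count minus their weight, which is the weight of
  S up to the constant total. The constant cancels in the difference with the base weight that
  enters \<open>chev0\<close>.\<close>

lemma weight_co:
  assumes "S \<subseteq> {0..<m}"
  shows "e.weight (co S) = h.weight S - h.weight {0..<m}"
proof -
  have "e.weight (co S) = (\<Sum>b\<in>{0..<m} - S. - tt m (int m + 1 - (int (m - 1 - b) + 1)))"
    unfolding e.weight_def co_def by (subst sum.reindex[OF co_inj_on]) (simp only: comp_def)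
  also have "\<dots> = (\<Sum>b\<in>{0..<m} - S. - tt m (int b + 1))"
    by (intro sum.cong) (auto simp: of_nat_diff algebra_simps)
  also have "\<dots> = - (h.weight {0..<m} - h.weight S)"
    unfolding h.weight_def sum_negf using assms by (subst sum_diff) auto
  finally show ?thesis by simp
qed

text \<open>A bead going from x to x + 1 is a hole going from x + 1 to x; after reversal this is
  again an upward move, from m - 2 - x to m - 1 - x.\<close>

lemma move_co:
  assumes "x \<in> h.moves S"
  shows "m - 2 - x \<in> e.moves (co S)" "e.move (co S) (m - 2 - x) = co (h.move S x)"
proof -
  have x: "x \<in> S" "Suc x \<notin> S" "Suc x < m" using assms by (auto simp: h.moves_def)
  have a: "m - 1 - (m - 2 - x) = Suc x" "Suc (m - 2 - x) = m - 1 - x" "m - 1 - (m - 1 - x) = x"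
    using x by auto
  show "m - 2 - x \<in> e.moves (co S)"
    unfolding e.moves_def mem_Collect_eq co_iff a using x by auto
  show "e.move (co S) (m - 2 - x) = co (h.move S x)"
  proof (intro equalityI subsetI)
    fix y assume "y \<in> e.move (co S) (m - 2 - x)"
    then show "y \<in> co (h.move S x)" using x by (auto simp: e.move_def h.move_def co_iff)
  next
    fix y assume "y \<in> co (h.move S x)"
    then have y: "y < m" "m - 1 - y \<noteq> Suc x" "m - 1 - y = x \<or> m - 1 - y \<notin> S"
      by (auto simp: h.move_def co_iff)
    show "y \<in> e.move (co S) (m - 2 - x)"
    proof (cases "m - 1 - y = x")
      case True
      then have "y = Suc (m - 2 - x)" using y x by auto
      then show ?thesis by (simp add: e.move_def)
    next
      case False
      then have "y \<in> co S" "y \<noteq> m - 2 - x" using y x by (auto simp: co_iff)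
      then show ?thesis by (simp add: e.move_def)
    qed
  qed
qed

lemma moves_co:
  assumes y: "y \<in> e.moves (co S)"
  shows "\<exists>x\<in>h.moves S. y = m - 2 - x"
proof -
  have "y < m" "m - 1 - y \<notin> S" "Suc y < m" "m - 1 - Suc y \<in> S"
    using y by (auto simp: e.moves_def co_iff)
  moreover have "Suc (m - 2 - y) = m - 1 - y" "m - 1 - Suc y = m - 2 - y" "y = m - 2 - (m - 2 - y)"
    using \<open>Suc y < m\<close> by auto
  ultimately show ?thesis by (intro bexI[of _ "m - 2 - y"]) (auto simp: h.moves_def)
qed

text \<open>Moves, relative weights and wraps correspond under \<open>co\<close>. The divisor class
  thus has the same matrix in both indexings, and one quantum ring serves both
  presentations.\<close>

lemma chev_co:
  assumes S: "S \<in> h.Ks" and U: "U \<in> h.Ks"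
  shows "e.chev0 (co S) (co U) = h.chev0 S U" "e.chev1 (co S) (co U) = h.chev1 S U"
proof -
  have sub: "S \<subseteq> {0..<m}" "U \<subseteq> {0..<m}" using S U by (auto simp: h.Ks_def)
  have inj: "co W = co U \<longleftrightarrow> W = U" if "W \<in> h.Ks" for W
    using that U bij_betw_imp_inj_on[OF co_bij] by (auto dest: inj_onD)
  have coS: "co S \<in> e.Ks" using co_bij S by (auto simp: bij_betw_def)
  have "(\<exists>y\<in>e.moves (co S). e.move (co S) y = co U) \<longleftrightarrow> (\<exists>x\<in>h.moves S. h.move S x = U)"
  proof
    assume "\<exists>y\<in>e.moves (co S). e.move (co S) y = co U"
    then obtain x where x: "x \<in> h.moves S" "e.move (co S) (m - 2 - x) = co U" using moves_co by blast
    then have "co (h.move S x) = co U" using move_co(2) by simp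
    then have "h.move S x = U" using inj[OF h.move_in_Ks[OF S x(1)]] by blast
    then show "\<exists>x\<in>h.moves S. h.move S x = U" using x(1) by blast
  next
    assume "\<exists>x\<in>h.moves S. h.move S x = U"
    then show "\<exists>y\<in>e.moves (co S). e.move (co S) y = co U" using move_co by blast
  qed
  moreover have "e.weight (co S) - e.weight {0..<m - p} = h.weight S - h.weight {0..<p}"
    using weight_co[OF sub(1)] weight_co[of "{0..<p}"] p_less unfolding co_base by simp
  ultimately show "e.chev0 (co S) (co U) = h.chev0 S U"
    unfolding e.chev0_def h.chev0_def e.sum_moves_indicator[OF coS] h.sum_moves_indicator[OF S] inj[OF S]
    by (simp only:)
  have w: "e.wraps (co S) \<longleftrightarrow> h.wraps S"
    using p_less by (auto simp: e.wraps_def h.wraps_def co_iff)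
  have "e.wrap (co S) = co (h.wrap S)" if "h.wraps S"
  proof (intro equalityI subsetI)
    have "m - 1 \<in> S" using that by (simp add: h.wraps_def)
    fix y assume "y \<in> e.wrap (co S)"
    then show "y \<in> co (h.wrap S)"
      using p_less that by (auto simp: e.wrap_def h.wrap_def co_iff h.wraps_def)
  next
    fix y assume "y \<in> co (h.wrap S)"
    then have "y < m" "m - 1 - y \<noteq> 0" "m - 1 - y = m - 1 \<or> m - 1 - y \<notin> S"
      by (auto simp: h.wrap_def co_iff)
    then show "y \<in> e.wrap (co S)" by (cases "y = 0") (auto simp: e.wrap_def co_iff)
  qed
  then show "e.chev1 (co S) (co U) = h.chev1 S U"
    unfolding e.chev1_def h.chev1_def w using inj[OF h.wrap_in_Ks[OF S]] by auto
qed

definition conj_num :: "part \<Rightarrow> nat \<Rightarrow> nat" where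
  "conj_num la j = conj_part p la (Suc j) + (m - p - 1 - j)"

lemma conj_part_le: "conj_part p la j \<le> p"
proof -
  have "conj_part p la j \<le> card {1..p}" unfolding conj_part_def by (rule card_mono) auto
  then show ?thesis by simp
qed

lemma conj_num_dec:
  assumes "i < j" "j < m - p"
  shows "conj_num la j < conj_num la i"
proof -
  have "conj_part p la (Suc j) \<le> conj_part p la (Suc i)"
    unfolding conj_part_def using assms by (intro card_mono) auto
  then show ?thesis using assms by (simp add: conj_num_def)
qed

text \<open>The conjugate beta numbers fill the reversed holes. It is enough that they avoid the
  reversed beads, since there are m - p of them.\<close>

lemma co_beta_set:
  assumes la: "la \<in> partitions_in p m"
  shows "co (beta_set la) = conj_num la ` {0..<m - p}"
proof (rule card_subset_eq[symmetric])
  show "finite (co (beta_set la))" using co_subset by (rule finite_subset) simp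
  show "conj_num la ` {0..<m - p} \<subseteq> co (beta_set la)"
  proof
    fix y assume "y \<in> conj_num la ` {0..<m - p}"
    then obtain j where j: "j < m - p" "y = conj_num la j" by auto
    let ?c = "conj_part p la (Suc j)"
    have ym: "y < m" using j conj_part_le[of la "Suc j"] p_less by (simp add: conj_num_def)
    \<comment> \<open>The test is whether the box (i + 1, j + 1) belongs to \<lambda>: if it does,
      the beta number exceeds m - 1 - y, and otherwise it is smaller.\<close>
    have "m - 1 - y \<noteq> beta_num la i" if i: "i < p" for i
    proof (cases "Suc j \<le> la (Suc i)")
      case True
      have "{1..Suc i} \<subseteq> {i' \<in> {1..p}. Suc j \<le> la i'}"
        using True part_mono[OF la, of _ "Suc i"] i by (auto intro: order.trans)
      then have "card {1..Suc i} \<le> ?c" unfolding conj_part_def by (intro card_mono) auto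
      then have "Suc i \<le> ?c" by simp
      then show ?thesis
        using True i j conj_part_le[of la "Suc j"] by (auto simp: conj_num_def beta_num_def)
    next
      case False
      have "{i' \<in> {1..p}. Suc j \<le> la i'} \<subseteq> {1..i}"
      proof
        fix i' assume i': "i' \<in> {i' \<in> {1..p}. Suc j \<le> la i'}"
        show "i' \<in> {1..i}"
        proof (rule ccontr)
          assume "i' \<notin> {1..i}"
          then have "Suc i \<le> i'" using i' by auto
          then have "la i' \<le> la (Suc i)" using part_mono[OF la, of "Suc i" i'] i' by auto
          then show False using i' False by auto
        qed
      qed
      then have "?c \<le> card {1..i}" unfolding conj_part_def by (intro card_mono) auto
      then have "?c \<le> i" by simp
      then show ?thesis using False i j by (auto simp: conj_num_def beta_num_def)
    qed
    then have "m - 1 - y \<notin> beta_set la" unfolding beta_set_def by fastforce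
    then show "y \<in> co (beta_set la)" using ym unfolding co_iff by blast
  qed
  have "inj_on (conj_num la) {0..<m - p}"
    using conj_num_dec[of _ _ la] by (intro inj_onI) (metis atLeastLessThan_iff less_irrefl nat_neq_iff)
  then have "card (conj_num la ` {0..<m - p}) = m - p" by (simp add: card_image)
  moreover have "beta_set la \<subseteq> {0..<m}" "card (beta_set la) = p" using beta_set_in[OF la] by (auto simp: h.Ks_def)
  ultimately show "card (conj_num la ` {0..<m - p}) = card (co (beta_set la))" by (simp add: card_co)
qed

lemma s_dual_poly_eq:
  assumes la: "la \<in> partitions_in p m"
  shows "s_dual_poly p m la = e.s (co (beta_set la))"
proof -
  have "s_dual_poly p m la = det (mat (m - p) (m - p) (\<lambda>(i, j). fac_shift (\<lambda>i. - tt m (int m + 1 - i))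
      (\<lambda>a. e.gen (a + 1 - int (m - p))) (\<lambda>s. - tt m (int s)) j (int (dec_enum (co (beta_set la)) i))))"
    unfolding s_dual_poly_def
  proof (rule det_mat_cong)
    fix i j assume i: "i < m - p"
    have "dec_enum (co (beta_set la)) i = conj_num la i"
      unfolding co_beta_set[OF la] using conj_num_dec i by (rule dec_enum_unique)
    moreover have "int (conj_num la i)
        = int (conj_part p la (i + 1)) + int j - int i + int (m - p) - int j - 1"
      using i by (simp add: conj_num_def of_nat_diff)
    ultimately show "tau_e p m j (int (conj_part p la (i + 1)) + int j - int i)
        = fac_shift (\<lambda>i. - tt m (int m + 1 - i)) (\<lambda>a. e.gen (a + 1 - int (m - p)))
          (\<lambda>s. - tt m (int s)) j (int (dec_enum (co (beta_set la)) i))"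
      by (simp only: tau_e_shift)
  qed
  also have "\<dots> = e.s (co (beta_set la))" unfolding e.s_def e.G_def by (rule det_fac_shift)
  finally show ?thesis .
qed

lemma col_part_in: "j \<le> p \<Longrightarrow> col_part j \<in> partitions_in p m"
  using p_less by (auto simp: partitions_in_def col_part_def)

lemma co_beta_col:
  assumes j: "1 \<le> j" "j \<le> p"
  shows "co (beta_set (col_part j)) = insert (m - p - 1 + j) {0..<m - p - 1}"
proof -
  let ?a = "conj_num (col_part j)"
  have "{i \<in> {1..p}. Suc 0 \<le> col_part j i} = {1..j}" using j by (auto simp: col_part_def)
  then have "conj_part p (col_part j) (Suc 0) = j" by (simp add: conj_part_def)
  then have a0: "?a 0 = m - p - 1 + j" by (simp add: conj_num_def)
  have "conj_part p (col_part j) (Suc i) = 0" if "1 \<le> i" for i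
    using that by (auto simp: conj_part_def col_part_def)
  then have a1: "?a i = m - p - 1 - i" if "1 \<le> i" for i using that by (simp add: conj_num_def)
  have "co (beta_set (col_part j)) = ?a ` insert 0 {1..<m - p}"
    unfolding co_beta_set[OF col_part_in[OF j(2)]] using p_less by (intro arg_cong[where f = "image _"]) auto
  also have "\<dots> = insert (m - p - 1 + j) (?a ` {1..<m - p})" by (simp only: image_insert a0)
  also have "?a ` {1..<m - p} = {0..<m - p - 1}"
  proof (intro equalityI subsetI)
    fix x assume "x \<in> {0..<m - p - 1}"
    then have "x = ?a (m - p - 1 - x)" "m - p - 1 - x \<in> {1..<m - p}" using a1[of "m - p - 1 - x"] by auto
    then show "x \<in> ?a ` {1..<m - p}" by (rule image_eqI)
  next
    fix x assume "x \<in> ?a ` {1..<m - p}"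
    then obtain i where "1 \<le> i" "i < m - p" "x = ?a i" by auto
    then show "x \<in> {0..<m - p - 1}" using a1[of i] by simp
  qed
  finally show ?thesis .
qed

end

theorem theorem1p1:
  fixes p m :: nat and c :: struct_consts
  assumes "1 \<le> p" and "p < m"
    and "equivariant_quantum_cohomology p m c"
  shows "(\<exists>\<Phi> \<in> ring_iso (h_ring p m Quot h_ideal p m) (QH p m c).
            (\<forall>a \<in> Lambda_q m. \<Phi> (h_class p m a) = qh_smult a \<one>\<^bsub>QH p m c\<^esub>) \<and>
            (\<forall>i \<in> {1..m - p}. \<Phi> (h_class p m (Var (hVar i))) = schubert (row_part i)) \<and>
            (\<forall>la \<in> partitions_in p m. \<Phi> (h_class p m (s_poly p m la)) = schubert la)) \<and>
         (\<exists>\<Psi> \<in> ring_iso (e_ring p m Quot e_ideal p m) (QH p m c).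
            (\<forall>a \<in> Lambda_q m. \<Psi> (e_class p m a) = qh_smult a \<one>\<^bsub>QH p m c\<^esub>) \<and>
            (\<forall>j \<in> {1..p}. \<Psi> (e_class p m (Var (eVar j))) = schubert (col_part j)) \<and>
            (\<forall>la \<in> partitions_in p m. \<Psi> (e_class p m (s_dual_poly p m la)) = schubert la))"
proof -
  interpret grassmannian p m by unfold_locales (use assms in auto)
  have QH: "cring (QH p m c)" by (rule equivariant_quantum_cohomology.QH_cring[OF assms(3)])
  have one: "row_part 1 \<in> partitions_in p m" using assms by (intro row_part_in) simp
  interpret A: qh_presentation p m "tt m" hVar p c beta_set
    by (intro qh_presentation.intro qh_presentation_axioms.intro h.factorial_presentation_axioms
        beta_set_bij beta_set_empty empty_part_in one QH chevalley_beta[OF assms(3)])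
  \<comment> \<open>The dual presentation indexes the Schubert basis by \<open>co\<close> after
    \<open>beta_set\<close>; its Chevalley condition is that of the first presentation transported
    by \<open>chev_co\<close>.\<close>
  interpret B: qh_presentation "m - p" m "\<lambda>i. - tt m (int m + 1 - i)" eVar p c "\<lambda>la. co (beta_set la)"
  proof (intro qh_presentation.intro qh_presentation_axioms.intro e.factorial_presentation_axioms)
    show "bij_betw (\<lambda>la. co (beta_set la)) (partitions_in p m) e.Ks"
      using bij_betw_trans[OF beta_set_bij co_bij] by (simp add: comp_def)
    show "co (beta_set empty_part) = {0..<m - p}" by (simp only: beta_set_empty co_base)
    show "empty_part \<in> partitions_in p m" "row_part 1 \<in> partitions_in p m" "cring (QH p m c)"
      by (rule empty_part_in one QH)+
    fix la nu assume la: "la \<in> partitions_in p m" and nu: "nu \<in> partitions_in p m"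
    show "qh_mult p m c (schubert la) (schubert (row_part 1)) nu = e.chev0 (co (beta_set la)) (co (beta_set nu))
        + qq * e.chev1 (co (beta_set la)) (co (beta_set nu))"
      unfolding chevalley_beta[OF assms(3) la nu] chev_co[OF beta_set_in[OF la] beta_set_in[OF nu]] ..
  qed
  obtain \<Phi> where \<Phi>: "\<Phi> \<in> ring_iso (Defs.poly_ring h.V Quot h.I) (QH p m c)"
    "\<And>a. a \<in> Lambda_q m \<Longrightarrow> \<Phi> (h.I +>\<^bsub>Defs.poly_ring h.V\<^esub> a) = qh_smult a \<one>\<^bsub>QH p m c\<^esub>"
    "\<And>la. la \<in> partitions_in p m \<Longrightarrow> \<Phi> (h.I +>\<^bsub>Defs.poly_ring h.V\<^esub> h.s (beta_set la)) = schubert la"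
    using A.presentation by blast
  obtain \<Psi> where \<Psi>: "\<Psi> \<in> ring_iso (Defs.poly_ring e.V Quot e.I) (QH p m c)"
    "\<And>a. a \<in> Lambda_q m \<Longrightarrow> \<Psi> (e.I +>\<^bsub>Defs.poly_ring e.V\<^esub> a) = qh_smult a \<one>\<^bsub>QH p m c\<^esub>"
    "\<And>la. la \<in> partitions_in p m \<Longrightarrow> \<Psi> (e.I +>\<^bsub>Defs.poly_ring e.V\<^esub> e.s (co (beta_set la))) = schubert la"
    using B.presentation by blast
  \<comment> \<open>The generators are themselves determinants of one-row shapes, so their images
    are instances of the general clause on Schubert classes.\<close>
  have hv: "Var (hVar i) = h.s (beta_set (row_part i))" if "i \<in> {1..m - p}" for i
    unfolding beta_set_row using that h.s_row[of i] h.gen_Var[of i] by simp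
  have ev: "Var (eVar j) = e.s (co (beta_set (col_part j)))" if j: "j \<in> {1..p}" for j
  proof -
    have "m - (m - p) = p" using assms by simp
    then show ?thesis using j e.s_row[of j] e.gen_Var[of j] co_beta_col[of j] by simp
  qed
  show ?thesis
    unfolding h_ring_eq h_ideal_eq e_ring_eq e_ideal_eq
  proof (intro conjI bexI[OF _ \<Phi>(1)] bexI[OF _ \<Psi>(1)] ballI)
    fix i assume i: "i \<in> {1..m - p}"
    show "\<Phi> (h.I +>\<^bsub>Defs.poly_ring h.V\<^esub> Var (hVar i)) = schubert (row_part i)"
      unfolding hv[OF i] using i by (intro \<Phi>(3) row_part_in) simp
  next
    fix j assume j: "j \<in> {1..p}"
    show "\<Psi> (e.I +>\<^bsub>Defs.poly_ring e.V\<^esub> Var (eVar j)) = schubert (col_part j)"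
      unfolding ev[OF j] using j by (intro \<Psi>(3) col_part_in) simp
  qed (simp_all only: s_poly_eq s_dual_poly_eq \<Phi> \<Psi>)
qed

end
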